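(* Let $H=0$. Then the whole Kruskal extension is foliated by the $T$-axisymmetric spacelike spherically symmetric maximal hypersurfaces $$\{\tilde\Sigma^+_{0,c}\}_{0<c\le C_0}\ \cup\ \{\tilde\Sigma^-_{0,c}\}_{C_0>c>0}\ \cup\ \{\Sigma^+_{0,c}\}_{0\ge c>c_0}\ \cup\ \{\Sigma^-_{0,c}\}_{c_0\le c<0},$$ where at $c=c_0$ and $c=C_0$ the members are the cylindrical hypersurfaces. That is, distinct hypersurfaces in this family are disjoint, and the union of the family is the whole Kruskal extension.
   Context: Fix $M>0$ and put $h(r)=1-\frac{2M}{r}$. The Kruskal extension of the Schwarzschild spacetime is $\{(U,V)\in\mathbb{R}^2: UV>-2M\}\times S^2$ with metric $\frac{16M^2e^{-r/(2M)}}{r}\,dU\,dV+r^2(d\theta^2+\sin^2\theta\,d\phi^2)$, where $r=r(U,V)>0$ is determined by $(r-2M)e^{r/(2M)}=UV$. Regions: I is $\{U>0,V>0\}$, II is $\{U<0,V>0\}$, I$'$ is $\{U<0,V<0\}$, II$'$ is $\{U>0,V<0\}$. Spherically symmetric hypersurfaces are identified with curves in the $(U,V)$-plane; such a curve is $T$-axisymmetric if it is invariant under $\rho(U,V)=(-V,-U)$. A maximal hypersurface is a spacelike hypersurface of mean curvature $0$. For $r\in(0,2M)$ let $k_0(r)=-r^{3/2}(2M-r)^{1/2}$ and $\tilde k_0(r)=-k_0(r)$. The function $k_0$ has a unique minimum point $r_0$, with value $c_0<0$, is strictly decreasing on $(0,r_0]$ and strictly increasing on $[r_0,2M)$; accordingly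 $\tilde k_0$ has its maximum $C_0=-c_0$ at $R_0=r_0$. Write $D_c(x)=c^2+x^3(x-2M)$. Each hypersurface below is the union of the listed curve (its part in $U+V\ge0$) and the image of that curve under $\rho$. $\bullet$ $\Sigma^-_{0,c}$, $c\in(c_0,0)$: let $r^-_{c}\in(0,r_0)$ with $k_0(r^-_c)=c$; for $0<r\le r^-_c$ put $t(r)=\int_{r^-_c}^r\frac{x}{x-2M}\frac{-c}{\sqrt{D_c(x)}}dx$, $U=-e^{-\frac1{4M}(t(r)-r-2M\ln|r-2M|)}$, $V=e^{\frac1{4M}(t(r)+r+2M\ln|r-2M|)}$. $\bullet$ $\tilde\Sigma^+_{0,c}$, $c\in(0,C_0)$: let $\tilde r^+_{c}\in(0,R_0)$ with $\tilde k_0(\tilde r^+_c)=c$; for $0<r\le \tilde r^+_c$ put $t(r)=\int_{\tilde r^+_c}^r\frac{x}{2M-x}\frac{c}{\sqrt{D_c(x)}}dx$, $U=e^{-\frac1{4M}(t(r)-r-2M\ln|r-2M|)}$, $V=-e^{\frac1{4M}(t(r)+r+2M\ln|r-2M|)}$. $\bullet$ $\Sigma^+_{0,c}$, $c\in(c_0,0)$: let $r^+_c\in(r_0,2M)$ with $k_0(r^+_c)=c$; for $r\ge r^+_c$ put $V=\exp\big[\frac1{4M}\big(r^+_c+2M\ln|r^+_c-2M|+\int_{r^+_c}^r\frac{x^4}{D_c(x)-c\sqrt{D_c(x)}}dx\big)\big]$, $U=(r-2M)e^{r/(2M)}/V$. $\bullet$ $\tilde\Sigma^-_{0,c}$, $c\in(0,C_0)$: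 let $\tilde r^-_c\in(R_0,2M)$ with $\tilde k_0(\tilde r^-_c)=c$; for $r\ge\tilde r^-_c$ put $U=\exp\big[\frac1{4M}\big(\tilde r^-_c+2M\ln|\tilde r^-_c-2M|+\int_{\tilde r^-_c}^r\frac{x^4}{D_c(x)+c\sqrt{D_c(x)}}dx\big)\big]$, $V=(r-2M)e^{r/(2M)}/U$. $\bullet$ $\Sigma^+_{0,0}$ ($c=0$): $U=V=\sqrt{r-2M}\,e^{r/(4M)}$, $r\ge2M$ (so with its $\rho$-image it is the line $U=V$). Finally, $\Sigma^-_{0,c_0}$ is the cylindrical hypersurface $r=r_0$ in region II and $\tilde\Sigma^+_{0,C_0}$ is the cylindrical hypersurface $r=R_0$ in region II$'$. *)

theory Defs
  imports "HOL-Analysis.Analysis"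
begin

section \<open>Hypersurfaces in a coordinate chart with a pseudo-Riemannian metric\<close>

text \<open>
  A metric is given by its coordinate matrices \<open>g x\<close>, a hypersurface locally by a
  parametrisation \<open>X\<close>.
\<close>

definition partial :: "'n::finite \<Rightarrow> (real^'n \<Rightarrow> real) \<Rightarrow> real^'n \<Rightarrow> real" where
  "partial k f x = deriv (\<lambda>h. f (x + h *\<^sub>R axis k 1)) 0"

definition metric_prod :: "(real^'n \<Rightarrow> real^'n^'n) \<Rightarrow> real^'n::finite \<Rightarrow> real^'n \<Rightarrow> real^'n \<Rightarrow> real" where
  "metric_prod g x v w = v \<bullet> (g x *v w)"

definition christoffel ::
    "(real^'n \<Rightarrow> real^'n^'n) \<Rightarrow> 'n::finite \<Rightarrow> 'n \<Rightarrow> 'n \<Rightarrow> real^'n \<Rightarrow> real" where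
  "christoffel g i j k x =
     (1/2) * (\<Sum>l\<in>UNIV. matrix_inv (g x) $ i $ l *
       (partial j (\<lambda>y. g y $ l $ k) x + partial k (\<lambda>y. g y $ l $ j) x
        - partial l (\<lambda>y. g y $ j $ k) x))"

definition coord_tangent :: "(real^'m::finite \<Rightarrow> real^'n::finite) \<Rightarrow> 'm \<Rightarrow> real^'m \<Rightarrow> real^'n" where
  "coord_tangent X a p = (\<chi> i. partial a (\<lambda>q. X q $ i) p)"

definition first_fund ::
    "(real^'n \<Rightarrow> real^'n^'n) \<Rightarrow> (real^'m::finite \<Rightarrow> real^'n::finite) \<Rightarrow> real^'m \<Rightarrow> real^'m^'m" where
  "first_fund g X p = (\<chi> a b. metric_prod g (X p) (coord_tangent X a p) (coord_tangent X b p))"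

text \<open>The ambient covariant derivative of the coordinate field \<open>b\<close> along the coordinate field \<open>a\<close>.\<close>

definition cov_tangent ::
    "(real^'n \<Rightarrow> real^'n^'n) \<Rightarrow> (real^'m::finite \<Rightarrow> real^'n::finite) \<Rightarrow> 'm \<Rightarrow> 'm \<Rightarrow> real^'m \<Rightarrow> real^'n" where
  "cov_tangent g X a b p =
     (\<chi> i. partial a (\<lambda>q. coord_tangent X b q $ i) p
        + (\<Sum>j\<in>UNIV. \<Sum>k\<in>UNIV. christoffel g i j k (X p)
             * coord_tangent X a p $ j * coord_tangent X b p $ k))"

definition spacelike_at ::
    "(real^'n \<Rightarrow> real^'n^'n) \<Rightarrow> (real^'m::finite \<Rightarrow> real^'n::finite) \<Rightarrow> real^'m \<Rightarrow> bool" where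
  "spacelike_at g X p \<longleftrightarrow> (\<forall>v. v \<noteq> 0 \<longrightarrow> v \<bullet> (first_fund g X p *v v) > 0)"

definition unit_normal ::
    "(real^'n \<Rightarrow> real^'n^'n) \<Rightarrow> (real^'m::finite \<Rightarrow> real^'n::finite) \<Rightarrow> real^'m \<Rightarrow> real^'n \<Rightarrow> bool" where
  "unit_normal g X p n \<longleftrightarrow>
     metric_prod g (X p) n n = -1 \<and> (\<forall>a. metric_prod g (X p) n (coord_tangent X a p) = 0)"

text \<open>
  The normalised trace of the second fundamental form with respect to the unit normal \<open>n\<close>.
  Replacing \<open>n\<close> by \<open>- n\<close>, like the other sign convention for the second fundamental form,
  changes the sign only.
\<close>

definition mean_curvature ::
    "(real^'n \<Rightarrow> real^'n^'n) \<Rightarrow> (real^'m::finite \<Rightarrow> real^'n::finite) \<Rightarrow> real^'m \<Rightarrow> real^'n \<Rightarrow> real" where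
  "mean_curvature g X p n =
     (1 / real CARD('m)) * (\<Sum>a\<in>UNIV. \<Sum>b\<in>UNIV. matrix_inv (first_fund g X p) $ a $ b
        * metric_prod g (X p) (cov_tangent g X a b p) n)"

section \<open>The Kruskal extension\<close>

definition kruskal :: "real \<Rightarrow> (real \<times> real) set" where
  "kruskal M = {(U, V). U * V > - 2 * M}"

definition area_radius :: "real \<Rightarrow> real \<Rightarrow> real \<Rightarrow> real" where
  "area_radius M U V = (THE r. r > 0 \<and> (r - 2 * M) * exp (r / (2 * M)) = U * V)"

text \<open>
  The coordinates are \<open>U, V, \<theta>, \<phi>\<close>. The off-diagonal entry is \<open>F / 2\<close> because the
  line element contains \<open>F dU dV\<close> as a symmetric product.
\<close>

definition kruskal_metric :: "real \<Rightarrow> real^4 \<Rightarrow> real^4^4" where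
  "kruskal_metric M x =
     (let r = area_radius M (x $ 1) (x $ 2);
          F = 16 * M\<^sup>2 * exp (- r / (2 * M)) / r
      in (\<chi> i j. if i = 1 \<and> j = 2 \<or> i = 2 \<and> j = 1 then F / 2
                 else if i = 3 \<and> j = 3 then r\<^sup>2
                 else if i = 4 \<and> j = 4 then r\<^sup>2 * (sin (x $ 3))\<^sup>2
                 else 0))"

definition rho :: "real \<times> real \<Rightarrow> real \<times> real" where
  "rho = (\<lambda>(U, V). (- V, - U))"

definition T_axisymmetric :: "(real \<times> real) set \<Rightarrow> bool" where
  "T_axisymmetric S \<longleftrightarrow> rho ` S = S"

definition smooth_on_open :: "real set \<Rightarrow> (real \<Rightarrow> real) \<Rightarrow> bool" where
  "smooth_on_open I f \<longleftrightarrow> (\<forall>n. \<forall>s\<in>I. (deriv ^^ n) f differentiable (at s))"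

text \<open>The hypersurface swept out by a curve in the \<open>(U, V)\<close>-plane, with parameters \<open>s, \<theta>, \<phi>\<close>.\<close>

definition rotate_curve :: "(real \<Rightarrow> real) \<Rightarrow> (real \<Rightarrow> real) \<Rightarrow> real^3 \<Rightarrow> real^4" where
  "rotate_curve u v p =
     (\<chi> i. if i = 1 then u (p $ 1) else if i = 2 then v (p $ 1) else if i = 3 then p $ 2 else p $ 3)"

text \<open>
  A spherically symmetric hypersurface is represented by its curve \<open>S\<close> in the \<open>(U, V)\<close>-plane.
  Spacelikeness means that \<open>U\<close> and \<open>V\<close> have derivatives of the same strict sign
  along the curve; both are therefore strictly monotone on the interval \<open>I\<close>, so that the
  parametrisation is automatically an embedding. By spherical symmetry it suffices to impose the
  conditions away from the poles of the sphere, where the chart degenerates.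
\<close>

definition spacelike_maximal_hypersurface :: "real \<Rightarrow> (real \<times> real) set \<Rightarrow> bool" where
  "spacelike_maximal_hypersurface M S \<longleftrightarrow> S \<subseteq> kruskal M \<and>
     (\<exists>I u v. open I \<and> connected I \<and> I \<noteq> {} \<and> smooth_on_open I u \<and> smooth_on_open I v \<and>
        S = (\<lambda>s. (u s, v s)) ` I \<and>
        (\<forall>p. p $ 1 \<in> I \<and> 0 < p $ 2 \<and> p $ 2 < pi \<longrightarrow>
           spacelike_at (kruskal_metric M) (rotate_curve u v) p \<and>
           (\<forall>n. unit_normal (kruskal_metric M) (rotate_curve u v) p n \<longrightarrow>
              mean_curvature (kruskal_metric M) (rotate_curve u v) p n = 0)))"

section \<open>The hypersurfaces of the family\<close>

definition k0 :: "real \<Rightarrow> real \<Rightarrow> real" where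
  "k0 M r = - (r powr (3/2)) * (2 * M - r) powr (1/2)"

definition k0t :: "real \<Rightarrow> real \<Rightarrow> real" where
  "k0t M r = - k0 M r"

definition r0 :: "real \<Rightarrow> real" where
  "r0 M = (THE r. r \<in> {0<..<2*M} \<and> (\<forall>x\<in>{0<..<2*M}. k0 M r \<le> k0 M x))"

definition c0 :: "real \<Rightarrow> real" where
  "c0 M = k0 M (r0 M)"

definition R0 :: "real \<Rightarrow> real" where
  "R0 M = (THE r. r \<in> {0<..<2*M} \<and> (\<forall>x\<in>{0<..<2*M}. k0t M x \<le> k0t M r))"

definition C0 :: "real \<Rightarrow> real" where
  "C0 M = k0t M (R0 M)"

definition D :: "real \<Rightarrow> real \<Rightarrow> real \<Rightarrow> real" where
  "D M c x = c\<^sup>2 + x ^ 3 * (x - 2 * M)"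

definition r_minus :: "real \<Rightarrow> real \<Rightarrow> real" where
  "r_minus M c = (THE r. r \<in> {0<..<r0 M} \<and> k0 M r = c)"

definition r_plus :: "real \<Rightarrow> real \<Rightarrow> real" where
  "r_plus M c = (THE r. r \<in> {r0 M<..<2*M} \<and> k0 M r = c)"

definition rt_plus :: "real \<Rightarrow> real \<Rightarrow> real" where
  "rt_plus M c = (THE r. r \<in> {0<..<R0 M} \<and> k0t M r = c)"

definition rt_minus :: "real \<Rightarrow> real \<Rightarrow> real" where
  "rt_minus M c = (THE r. r \<in> {R0 M<..<2*M} \<and> k0t M r = c)"

definition symmetrize :: "(real \<times> real) set \<Rightarrow> (real \<times> real) set" where
  "symmetrize S = S \<union> rho ` S"

text \<open>
  In the two functions \<open>t\<close> the upper limit \<open>r\<close> of the integral lies below the lower limit, whence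
  the minus sign in front of an integral over \<open>{r..r_minus M c}\<close>.
\<close>

definition t_minus :: "real \<Rightarrow> real \<Rightarrow> real \<Rightarrow> real" where
  "t_minus M c r =
     - integral {r..r_minus M c} (\<lambda>x. x / (x - 2 * M) * (- c / sqrt (D M c x)))"

definition tt_plus :: "real \<Rightarrow> real \<Rightarrow> real \<Rightarrow> real" where
  "tt_plus M c r =
     - integral {r..rt_plus M c} (\<lambda>x. x / (2 * M - x) * (c / sqrt (D M c x)))"

definition Sigma_minus :: "real \<Rightarrow> real \<Rightarrow> (real \<times> real) set" where
  "Sigma_minus M c =
     (if c = c0 M
      then {(U, V) \<in> kruskal M. U < 0 \<and> V > 0 \<and> area_radius M U V = r0 M}
      else symmetrize ((\<lambda>r.
        (- exp (- (1 / (4 * M)) * (t_minus M c r - r - 2 * M * ln \<bar>r - 2 * M\<bar>)),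
         exp ((1 / (4 * M)) * (t_minus M c r + r + 2 * M * ln \<bar>r - 2 * M\<bar>))))
        ` {0<..r_minus M c}))"

definition Sigmat_plus :: "real \<Rightarrow> real \<Rightarrow> (real \<times> real) set" where
  "Sigmat_plus M c =
     (if c = C0 M
      then {(U, V) \<in> kruskal M. U > 0 \<and> V < 0 \<and> area_radius M U V = R0 M}
      else symmetrize ((\<lambda>r.
        (exp (- (1 / (4 * M)) * (tt_plus M c r - r - 2 * M * ln \<bar>r - 2 * M\<bar>)),
         - exp ((1 / (4 * M)) * (tt_plus M c r + r + 2 * M * ln \<bar>r - 2 * M\<bar>))))
        ` {0<..rt_plus M c}))"

definition V_plus :: "real \<Rightarrow> real \<Rightarrow> real \<Rightarrow> real" where
  "V_plus M c r =
     exp ((1 / (4 * M)) * (r_plus M c + 2 * M * ln \<bar>r_plus M c - 2 * M\<bar>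
       + integral {r_plus M c..r} (\<lambda>x. x ^ 4 / (D M c x - c * sqrt (D M c x)))))"

definition Sigma_plus :: "real \<Rightarrow> real \<Rightarrow> (real \<times> real) set" where
  "Sigma_plus M c =
     (if c = 0
      then symmetrize ((\<lambda>r. (sqrt (r - 2 * M) * exp (r / (4 * M)),
                             sqrt (r - 2 * M) * exp (r / (4 * M)))) ` {2 * M..})
      else symmetrize ((\<lambda>r. ((r - 2 * M) * exp (r / (2 * M)) / V_plus M c r, V_plus M c r))
        ` {r_plus M c..}))"

definition Ut_minus :: "real \<Rightarrow> real \<Rightarrow> real \<Rightarrow> real" where
  "Ut_minus M c r =
     exp ((1 / (4 * M)) * (rt_minus M c + 2 * M * ln \<bar>rt_minus M c - 2 * M\<bar>
       + integral {rt_minus M c..r} (\<lambda>x. x ^ 4 / (D M c x + c * sqrt (D M c x)))))"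

definition Sigmat_minus :: "real \<Rightarrow> real \<Rightarrow> (real \<times> real) set" where
  "Sigmat_minus M c =
     symmetrize ((\<lambda>r. (Ut_minus M c r, (r - 2 * M) * exp (r / (2 * M)) / Ut_minus M c r))
       ` {rt_minus M c..})"

datatype leaf_index = Tilde_Plus real | Tilde_Minus real | Plus real | Minus real

definition leaf_indices :: "real \<Rightarrow> leaf_index set" where
  "leaf_indices M = Tilde_Plus ` {0<..C0 M} \<union> Tilde_Minus ` {0<..<C0 M}
     \<union> Plus ` {c0 M<..0} \<union> Minus ` {c0 M..<0}"

fun leaf :: "real \<Rightarrow> leaf_index \<Rightarrow> (real \<times> real) set" where
  "leaf M (Tilde_Plus c) = Sigmat_plus M c"
| "leaf M (Tilde_Minus c) = Sigmat_minus M c"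
| "leaf M (Plus c) = Sigma_plus M c"
| "leaf M (Minus c) = Sigma_minus M c"

end

theory Submission
  imports Defs
begin

text \<open>
  On a leaf with constant \<open>c\<close> put \<open>C = \<bar>c\<bar>\<close>. In the region \<open>U < V\<close> the leaf is a component of the
  curve \<open>y\<^sup>2 = D\<^sub>c(x)\<close>, with \<open>x\<close> the area radius, and in closed form
  \<open>U = (y - C) N exp (- C J)\<close>, \<open>V = (y + C) N exp (C J)\<close>, where \<open>N = exp (x / 4M) / (x sqrt x)\<close> and
  the integral \<open>J\<close> is regular on the horizons and at the throat. Hence the leaf is a smooth curve with
  \<open>U' = P exp (- C J)\<close>, \<open>V' = P exp (C J)\<close>, \<open>P > 0\<close>, for which the equation of vanishing mean
  curvature can be checked directly. By the reflection exchanging \<open>U\<close> and \<open>V\<close> only the region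
  \<open>U < V\<close> matters, and by \<open>rho\<close> only \<open>U + V \<ge> 0\<close>. There, for fixed area radius \<open>r\<close>, the
  coordinate \<open>V\<close> is a strictly increasing function of \<open>C\<close>, which starts at the least value
  admissible for \<open>r\<close> and tends to infinity as the leaf approaches the cylinder. So through every point
  passes exactly one leaf.
\<close>

section \<open>Smooth functions of one variable\<close>

text \<open>The closed form arises as follows. In terms of \<open>x\<close> one has
  \<open>(ln V)' = x ^ 4 / (4 * M * y * (y + C))\<close>; taking off the derivatives of
  \<open>ln (y + C)\<close> and \<open>ln N\<close> leaves
  \<open>C * (6 * M - x) / (4 * M * x * y)\<close>, which is \<open>C\<close> times the derivative
  of \<open>J\<close> in \<open>x\<close>. Replacing \<open>C\<close> by \<open>- C\<close> gives
  \<open>U\<close>. The delicate point is the order of the leaves. With growing \<open>C\<close> the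
  throat moves towards \<open>3 * M / 2\<close>, so a leaf has a longer way from its throat to a
  given radius, but on that way \<open>V\<close> grows more slowly. The two effects compete, and
  differentiating in \<open>C\<close> is hampered by an integrand that is singular at the moving
  throat. Hence two leaves are compared along the radius instead: \<open>4 * M * ln V\<close> is
  corrected by terms in closed form such that the difference of two leaves becomes monotone in the
  radius, and its sign at the throat of the shorter leaf follows from the same inequality, applied
  along a one-parameter family of throats.\<close>

definition smooth_order :: "nat \<Rightarrow> real set \<Rightarrow> (real \<Rightarrow> real) \<Rightarrow> bool" where
  "smooth_order n I f \<longleftrightarrow> (\<forall>k<n. \<forall>s\<in>I. (deriv ^^ k) f differentiable (at s))"

lemma smooth_on_open_iff: "smooth_on_open I f \<longleftrightarrow> (\<forall>n. smooth_order n I f)"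
  unfolding smooth_on_open_def smooth_order_def by (meson lessI)

lemma smooth_order_0 [simp]: "smooth_order 0 I f"
  by (simp add: smooth_order_def)

lemma smooth_order_Suc:
  "smooth_order (Suc n) I f \<longleftrightarrow> (\<forall>s\<in>I. f differentiable (at s)) \<and> smooth_order n I (deriv f)"
proof -
  have "(\<forall>k<Suc n. P k) \<longleftrightarrow> P 0 \<and> (\<forall>k<n. P (Suc k))" for P :: "nat \<Rightarrow> bool"
    by (metis less_Suc_eq_0_disj)
  from this[of "\<lambda>k. \<forall>s\<in>I. (deriv ^^ k) f differentiable (at s)"] show ?thesis
    by (simp add: smooth_order_def funpow_Suc_right del: funpow.simps(2))
qed

lemma smooth_order_mono: "smooth_order n I f \<Longrightarrow> m \<le> n \<Longrightarrow> smooth_order m I f"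
  by (auto simp: smooth_order_def)

lemma differentiable_iff_real: "f differentiable (at s) \<longleftrightarrow> (f has_real_derivative deriv f s) (at s)"
  by (metis DERIV_deriv_iff_real_differentiable)

text \<open>\<open>deriv\<close> sees a function on a whole neighbourhood, so agreement on
  \<open>I\<close> passes to derivatives because \<open>I\<close> is open. This lets a formula valid
  only on \<open>I\<close> stand for \<open>deriv f\<close>.\<close>

lemma smooth_order_cong:
  assumes "open I" "\<And>s. s \<in> I \<Longrightarrow> f s = g s"
  shows "smooth_order n I f \<longleftrightarrow> smooth_order n I g"
proof -
  have "smooth_order n I g" if "smooth_order n I f" "\<And>s. s \<in> I \<Longrightarrow> f s = g s" for f g
    using that
  proof (induction n arbitrary: f g)
    case (Suc n)
    have ev: "eventually (\<lambda>x. f x = g x) (nhds s)" if "s \<in> I" for s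
      using assms(1) that Suc.prems(2) eventually_nhds by blast
    have "g differentiable (at s)" if s: "s \<in> I" for s
      using Suc.prems(1) s unfolding smooth_order_Suc differentiable_iff_real
      by (metis DERIV_cong_ev[OF refl ev[OF s] refl] deriv_cong_ev[OF ev[OF s] refl])
    moreover have "deriv f s = deriv g s" if s: "s \<in> I" for s
      by (rule deriv_cong_ev[OF ev[OF s] refl])
    ultimately show ?case
      using Suc.IH[of "deriv f" "deriv g"] Suc.prems(1) by (auto simp: smooth_order_Suc)
  qed simp
  from this[of f g] this[of g f] assms(2) show ?thesis by metis
qed

lemma smooth_order_SucI:
  assumes "open I" "\<And>s. s \<in> I \<Longrightarrow> (f has_real_derivative f' s) (at s)" "smooth_order n I f'"
  shows "smooth_order (Suc n) I f"
proof -
  have "smooth_order n I (deriv f) \<longleftrightarrow> smooth_order n I f'"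
    by (rule smooth_order_cong) (use assms DERIV_imp_deriv in auto)
  then show ?thesis
    using assms real_differentiable_def by (auto simp: smooth_order_Suc)
qed

lemma smooth_on_openI:
  assumes "open I" "\<And>s. s \<in> I \<Longrightarrow> (f has_real_derivative f' s) (at s)" "smooth_on_open I f'"
  shows "smooth_on_open I f"
  unfolding smooth_on_open_iff
proof
  fix n show "smooth_order n I f"
    using assms smooth_order_SucI[of I f f' n] smooth_order_mono[of "Suc n" I f n]
    by (auto simp: smooth_on_open_iff)
qed

lemma smooth_order_DERIV:
  "smooth_order (Suc n) I f \<Longrightarrow> s \<in> I \<Longrightarrow> (f has_real_derivative deriv f s) (at s)"
  by (simp add: smooth_order_Suc differentiable_iff_real)

lemma smooth_order_const: "open I \<Longrightarrow> smooth_order n I (\<lambda>_. c)"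
proof (induction n arbitrary: c)
  case (Suc n)
  show ?case by (rule smooth_order_SucI[where f'="\<lambda>_. 0"]) (use Suc in auto)
qed simp

lemma smooth_order_ident: "open I \<Longrightarrow> smooth_order n I (\<lambda>s. s)"
proof (cases n)
  case (Suc m)
  assume "open I"
  then show ?thesis unfolding Suc
    by (intro smooth_order_SucI[where f'="\<lambda>_. 1"] smooth_order_const) auto
qed simp

lemma smooth_order_add:
  "open I \<Longrightarrow> smooth_order n I f \<Longrightarrow> smooth_order n I g \<Longrightarrow> smooth_order n I (\<lambda>s. f s + g s)"
proof (induction n arbitrary: f g)
  case (Suc n)
  have "((\<lambda>s. f s + g s) has_real_derivative deriv f s + deriv g s) (at s)" if "s \<in> I" for s
    using Suc.prems that by (intro DERIV_add smooth_order_DERIV[of n I]) auto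
  then show ?case
    using Suc by (intro smooth_order_SucI[where f'="\<lambda>s. deriv f s + deriv g s"] Suc.IH)
      (auto simp: smooth_order_Suc)
qed simp

text \<open>The derivative of a product contains the undifferentiated factors, so the induction
  needs these at order \<open>n\<close> as well, by lowering the order from \<open>Suc n\<close>.
  The same scheme serves \<open>exp\<close>, \<open>inverse\<close> and \<open>sqrt\<close>, whose
  derivatives contain the composed function itself.\<close>

lemma smooth_order_mult:
  "open I \<Longrightarrow> smooth_order n I f \<Longrightarrow> smooth_order n I g \<Longrightarrow> smooth_order n I (\<lambda>s. f s * g s)"
proof (induction n arbitrary: f g)
  case (Suc n)
  have "((\<lambda>s. f s * g s) has_real_derivative deriv f s * g s + deriv g s * f s) (at s)" if "s \<in> I" for s
    using Suc.prems that by (intro DERIV_mult smooth_order_DERIV[of n I]) auto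
  moreover have "smooth_order n I f" "smooth_order n I g"
    using Suc.prems smooth_order_mono[of "Suc n" I _ n] by auto
  ultimately show ?case
    using Suc by (intro smooth_order_SucI[where f'="\<lambda>s. deriv f s * g s + deriv g s * f s"]
        smooth_order_add Suc.IH) (auto simp: smooth_order_Suc)
qed simp

lemma smooth_order_exp:
  "open I \<Longrightarrow> smooth_order n I f \<Longrightarrow> smooth_order n I (\<lambda>s. exp (f s))"
proof (induction n)
  case (Suc n)
  have "((\<lambda>s. exp (f s)) has_real_derivative exp (f s) * deriv f s) (at s)" if "s \<in> I" for s
    using Suc.prems that by (intro DERIV_fun_exp smooth_order_DERIV[of n I]) auto
  moreover have "smooth_order n I f"
    using Suc.prems smooth_order_mono[of "Suc n" I _ n] by auto
  ultimately show ?case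
    using Suc by (intro smooth_order_SucI[where f'="\<lambda>s. exp (f s) * deriv f s"]
        smooth_order_mult) (auto simp: smooth_order_Suc)
qed simp

lemma smooth_order_inverse:
  assumes "\<And>s. s \<in> I \<Longrightarrow> f s \<noteq> 0"
  shows "open I \<Longrightarrow> smooth_order n I f \<Longrightarrow> smooth_order n I (\<lambda>s. inverse (f s))"
proof (induction n)
  case (Suc n)
  have "((\<lambda>s. inverse (f s)) has_real_derivative (-1) * (inverse (f s) * deriv f s * inverse (f s))) (at s)"
    if "s \<in> I" for s
    using DERIV_inverse'[OF smooth_order_DERIV[OF Suc.prems(2) that]] assms[OF that] by simp
  moreover have "smooth_order n I f"
    using Suc.prems smooth_order_mono[of "Suc n" I _ n] by auto
  ultimately show ?case
    using Suc by (intro smooth_order_SucI[where f'="\<lambda>s. (-1) * (inverse (f s) * deriv f s * inverse (f s))"]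
        smooth_order_mult smooth_order_const) (auto simp: smooth_order_Suc)
qed simp

lemma smooth_order_sqrt:
  assumes pos: "\<And>s. s \<in> I \<Longrightarrow> f s > 0"
  shows "open I \<Longrightarrow> smooth_order n I f \<Longrightarrow> smooth_order n I (\<lambda>s. sqrt (f s))"
proof (induction n)
  case (Suc n)
  have "((\<lambda>s. sqrt (f s)) has_real_derivative (1/2) * (inverse (sqrt (f s)) * deriv f s)) (at s)"
    if "s \<in> I" for s
    by (rule DERIV_cong[OF DERIV_chain2[OF DERIV_real_sqrt smooth_order_DERIV[OF Suc.prems(2) that]]])
       (use pos[OF that] in \<open>auto simp: field_simps\<close>)
  moreover have "smooth_order n I f"
    using Suc.prems smooth_order_mono[of "Suc n" I _ n] by auto
  ultimately show ?case
    using Suc pos by (intro smooth_order_SucI[where f'="\<lambda>s. (1/2) * (inverse (sqrt (f s)) * deriv f s)"]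
        smooth_order_mult smooth_order_const smooth_order_inverse)
      (auto simp: smooth_order_Suc less_imp_neq[symmetric])
qed simp

lemma smooth_const [intro]: "open I \<Longrightarrow> smooth_on_open I (\<lambda>_. c)"
  and smooth_ident [intro]: "open I \<Longrightarrow> smooth_on_open I (\<lambda>s. s)"
  by (simp_all add: smooth_on_open_iff smooth_order_const smooth_order_ident)

lemma smooth_add: "open I \<Longrightarrow> smooth_on_open I f \<Longrightarrow> smooth_on_open I g \<Longrightarrow> smooth_on_open I (\<lambda>s. f s + g s)"
  and smooth_mult: "open I \<Longrightarrow> smooth_on_open I f \<Longrightarrow> smooth_on_open I g \<Longrightarrow> smooth_on_open I (\<lambda>s. f s * g s)"
  and smooth_exp: "open I \<Longrightarrow> smooth_on_open I f \<Longrightarrow> smooth_on_open I (\<lambda>s. exp (f s))"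
  by (simp_all add: smooth_on_open_iff smooth_order_add smooth_order_mult smooth_order_exp)

lemma smooth_sqrt:
  "open I \<Longrightarrow> (\<And>s. s \<in> I \<Longrightarrow> f s > 0) \<Longrightarrow> smooth_on_open I f \<Longrightarrow> smooth_on_open I (\<lambda>s. sqrt (f s))"
  by (simp add: smooth_on_open_iff smooth_order_sqrt)

lemma smooth_minus: "open I \<Longrightarrow> smooth_on_open I f \<Longrightarrow> smooth_on_open I (\<lambda>s. - f s)"
  using smooth_mult[of I "\<lambda>_. -1" f] smooth_const[of I "-1"] by simp

lemma smooth_diff:
  "open I \<Longrightarrow> smooth_on_open I f \<Longrightarrow> smooth_on_open I g \<Longrightarrow> smooth_on_open I (\<lambda>s. f s - g s)"
  using smooth_add[of I f "\<lambda>s. - g s"] smooth_minus[of I g] by simp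

lemma smooth_power: "open I \<Longrightarrow> smooth_on_open I f \<Longrightarrow> smooth_on_open I (\<lambda>s. f s ^ n)"
  by (induction n) (auto intro: smooth_mult)

lemma smooth_divide:
  assumes "open I" "\<And>s. s \<in> I \<Longrightarrow> g s \<noteq> 0" "smooth_on_open I f" "smooth_on_open I g"
  shows "smooth_on_open I (\<lambda>s. f s / g s)"
proof -
  have "smooth_on_open I (\<lambda>s. inverse (g s))"
    using assms by (simp add: smooth_on_open_iff smooth_order_inverse)
  then show ?thesis
    using smooth_mult[of I f "\<lambda>s. inverse (g s)"] assms by (simp add: divide_inverse)
qed

lemmas smooth_intros = smooth_const smooth_ident smooth_add smooth_mult smooth_exp smooth_sqrt
  smooth_minus smooth_diff smooth_power smooth_divide

section \<open>The area radius\<close>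

text \<open>The derivative is positive for \<open>x > 0\<close> but vanishes at \<open>0\<close>,
  hence the argument on the open interval. The value at \<open>0\<close> is \<open>- 2 * M\<close>,
  which is why \<open>U * V > - 2 * M\<close> describes exactly the products with a positive
  radius.\<close>

lemma area_fun_strict_mono:
  fixes M :: real
  assumes "M > 0" "0 \<le> r" "r < s"
  shows "(r - 2 * M) * exp (r / (2 * M)) < (s - 2 * M) * exp (s / (2 * M))"
proof (rule DERIV_pos_imp_increasing_open[where f="\<lambda>r. (r - 2 * M) * exp (r / (2 * M))"])
  show "r < s" by fact
next
  fix x assume "r < x" "x < s"
  have "((\<lambda>r. (r - 2 * M) * exp (r / (2 * M))) has_real_derivative x / (2 * M) * exp (x / (2 * M))) (at x)"
    using assms by (auto intro!: derivative_eq_intros simp: field_simps)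
  then show "\<exists>y. ((\<lambda>r. (r - 2 * M) * exp (r / (2 * M))) has_real_derivative y) (at x) \<and> y > 0"
    by (rule exI[of _ "x / (2 * M) * exp (x / (2 * M))", OF conjI]) (use assms \<open>r < x\<close> in auto)
qed (use assms(1) in \<open>intro continuous_intros; auto\<close>)

lemma area_radius_eqI:
  assumes "M > 0" "r > 0" "(r - 2 * M) * exp (r / (2 * M)) = U * V"
  shows "area_radius M U V = r"
  unfolding area_radius_def
proof (rule the_equality)
  fix s assume "0 < s \<and> (s - 2 * M) * exp (s / (2 * M)) = U * V"
  then show "s = r"
    using area_fun_strict_mono[OF assms(1), of r s] area_fun_strict_mono[OF assms(1), of s r] assms
    by (cases s r rule: linorder_cases) auto
qed (use assms in auto)

lemma area_radius:
  assumes "M > 0" "U * V > - 2 * M"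
  shows "area_radius M U V > 0"
    and "(area_radius M U V - 2 * M) * exp (area_radius M U V / (2 * M)) = U * V"
proof -
  let ?f = "\<lambda>r. (r - 2 * M) * exp (r / (2 * M))"
  \<comment> \<open>At this \<open>b\<close> the first factor is \<open>\<bar>U * V\<bar>\<close>
    and the exponential is at least \<open>1\<close>, so the value at \<open>b\<close> is at least
    \<open>U * V\<close>.\<close>
  define b where "b = 2 * M + \<bar>U * V\<bar>"
  have "\<bar>U * V\<bar> * 1 \<le> \<bar>U * V\<bar> * exp (b / (2 * M))"
    using assms by (intro mult_left_mono) (auto simp: b_def)
  then have "U * V \<le> ?f b" by (simp add: b_def)
  moreover have "?f 0 \<le> U * V" using assms by simp
  moreover have "continuous_on {0..b} ?f" using assms(1) by (intro continuous_intros) auto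
  ultimately obtain r where r: "0 \<le> r" "?f r = U * V"
    using IVT'[of ?f 0 "U * V" b] assms by (auto simp: b_def)
  with assms have "r > 0" by (cases "r = 0") auto
  from area_radius_eqI[OF assms(1) this r(2)] \<open>r > 0\<close> r(2)
  show "area_radius M U V > 0"
    "(area_radius M U V - 2 * M) * exp (area_radius M U V / (2 * M)) = U * V" by simp_all
qed

text \<open>Only the product enters. With second argument \<open>1\<close> the radius becomes a
  function of one variable, and both partial derivatives follow by the chain rule from a single
  inverse function.\<close>

lemma area_radius_mult: "area_radius M U V = area_radius M (U * V) 1"
  by (simp add: area_radius_def)

lemma DERIV_area_radius:
  assumes M: "M > 0" and z: "z > - 2 * M"
  defines "r \<equiv> area_radius M z 1"
  shows "((\<lambda>z. area_radius M z 1) has_real_derivative 2 * M * exp (- r / (2 * M)) / r) (at z)"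
proof -
  let ?f = "\<lambda>r. (r - 2 * M) * exp (r / (2 * M))"
  have r: "r > 0" "?f r = z"
    using area_radius[OF M, of z 1] z by (auto simp: r_def)
  have inv: "area_radius M (?f x) 1 = x" if "x > 0" for x
    by (rule area_radius_eqI[OF M that]) simp
  have "isCont (\<lambda>z. area_radius M z 1) (?f r)"
  proof (rule isCont_inverse_function2[of "r/2" r "r+1"])
    show "isCont ?f x" for x using M by (intro continuous_intros) auto
  qed (use r inv in auto)
  then have c: "isCont (\<lambda>z. area_radius M z 1) z" using r(2) by simp
  have d: "(?f has_real_derivative r / (2 * M) * exp (r / (2 * M))) (at (area_radius M z 1))"
    using M by (auto intro!: derivative_eq_intros simp: field_simps r_def)
  have i: "?f (area_radius M y 1) = y" if "- 2 * M < y" for y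
    using area_radius(2)[OF M, of y 1] that by simp
  have "((\<lambda>z. area_radius M z 1) has_real_derivative inverse (r / (2 * M) * exp (r / (2 * M)))) (at z)"
    by (rule DERIV_inverse_function[where f="?f" and g="\<lambda>z. area_radius M z 1"
          and a="- 2 * M" and b="z + 1"]) (use d z r(1) M c i in auto)
  then show ?thesis
    using r(1) M by (simp add: exp_minus field_simps)
qed

lemma DERIV_area_radius_chain:
  assumes "M > 0" "(p has_real_derivative p') (at h)" "p h = U * V" "U * V > - 2 * M"
  defines "r \<equiv> area_radius M U V"
  shows "((\<lambda>h. area_radius M (p h) 1) has_real_derivative 2 * M * exp (- r / (2 * M)) / r * p') (at h)"
  using DERIV_chain2[OF DERIV_area_radius[of M "p h"] assms(2)] assms
  by (simp add: area_radius_mult[of M U V])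

section \<open>Mean curvature of rotationally symmetric hypersurfaces\<close>

lemma matrix_inv_eqI:
  fixes A B :: "real^'n^'n"
  assumes "A ** B = mat 1"
  shows "matrix_inv A = B"
  unfolding matrix_inv_def
proof (rule some_equality)
  show "A ** B = mat 1 \<and> B ** A = mat 1"
    using assms matrix_left_right_inverse by blast
next
  fix A' assume "A ** A' = mat 1 \<and> A' ** A = mat 1"
  then have "A' = A' ** (A ** B)" "A' ** A = mat 1" using assms by simp_all
  then show "A' = B" by (metis matrix_mul_assoc matrix_mul_lid)
qed

lemma deriv_shift: "deriv (\<lambda>h. f (x + h)) 0 = deriv f (x :: real)"
proof -
  have "(f has_real_derivative d) (at x) \<longleftrightarrow> ((\<lambda>h. f (x + h)) has_real_derivative d) (at 0)" for d
    using DERIV_shift[of f d 0 x] by (simp add: add.commute)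
  then show ?thesis by (simp add: deriv_def)
qed

lemma partial_const [simp]: "partial k (\<lambda>_. c) x = 0"
  by (simp add: partial_def)

lemma partialI: "((\<lambda>h. f (x + h *\<^sub>R axis k 1)) has_real_derivative d) (at 0) \<Longrightarrow> partial k f x = d"
  unfolding partial_def by (rule DERIV_imp_deriv)

definition null_factor :: "real \<Rightarrow> real \<Rightarrow> real" where
  "null_factor M r = 16 * M\<^sup>2 * exp (- r / (2 * M)) / r"

lemma kruskal_metric_nth:
  "kruskal_metric M x $ i $ j =
    (if i = 1 \<and> j = 2 \<or> i = 2 \<and> j = 1 then null_factor M (area_radius M (x $ 1 * x $ 2) 1) / 2
     else if i = 3 \<and> j = 3 then (area_radius M (x $ 1 * x $ 2) 1)\<^sup>2
     else if i = 4 \<and> j = 4 then (area_radius M (x $ 1 * x $ 2) 1)\<^sup>2 * (sin (x $ 3))\<^sup>2 else 0)"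
  by (simp add: kruskal_metric_def Let_def null_factor_def area_radius_mult[of M "x $ 1" "x $ 2"])

lemma matrix_inv_kruskal_metric:
  assumes "null_factor M r \<noteq> 0" "r \<noteq> 0" "sin (x $ 3) \<noteq> 0" "area_radius M (x $ 1 * x $ 2) 1 = r"
  shows "matrix_inv (kruskal_metric M x) =
    (\<chi> i j. if i = 1 \<and> j = 2 \<or> i = 2 \<and> j = 1 then 2 / null_factor M r
     else if i = 3 \<and> j = 3 then 1 / r\<^sup>2
     else if i = 4 \<and> j = 4 then 1 / (r\<^sup>2 * (sin (x $ 3))\<^sup>2) else 0)"
  by (rule matrix_inv_eqI)
     (use assms in \<open>auto simp: vec_eq_iff matrix_matrix_mult_def mat_def sum_4 kruskal_metric_nth forall_4\<close>)

lemma metric_prod_kruskal: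
  assumes "area_radius M (x $ 1 * x $ 2) 1 = r"
  shows "metric_prod (kruskal_metric M) x a b =
    null_factor M r / 2 * (a $ 1 * b $ 2 + a $ 2 * b $ 1) + r\<^sup>2 * a $ 3 * b $ 3
      + r\<^sup>2 * (sin (x $ 3))\<^sup>2 * a $ 4 * b $ 4"
  by (simp add: metric_prod_def inner_vec_def matrix_vector_mult_def sum_4 kruskal_metric_nth assms algebra_simps)

lemma rotate_curve_nth [simp]:
  "rotate_curve u v p $ 1 = u (p $ 1)" "rotate_curve u v p $ 2 = v (p $ 1)"
  "rotate_curve u v p $ 3 = p $ 2" "rotate_curve u v p $ 4 = p $ 3"
  by (simp_all add: rotate_curve_def)

lemma partial_nth: "partial a (\<lambda>q. f (q $ b)) p = (if a = b then deriv f (p $ b) else 0)"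
  by (simp add: partial_def axis_def deriv_shift)

lemma coord_tangent_rotate_curve:
  "coord_tangent (rotate_curve u v) 1 p =
     (\<chi> i. if i = 1 then deriv u (p $ 1) else if i = 2 then deriv v (p $ 1) else 0)"
  "coord_tangent (rotate_curve u v) 2 p = axis 3 1"
  "coord_tangent (rotate_curve u v) 3 p = axis 4 1"
  using partial_nth[of _ "\<lambda>x. x" "2::3" p] partial_nth[of _ "\<lambda>x. x" "3::3" p]
  by (simp_all add: coord_tangent_def vec_eq_iff forall_4 partial_nth axis_def)

section \<open>Christoffel symbols of the Kruskal metric\<close>

context
  fixes M r U V th :: real and x :: "real^4"
  assumes M: "M > 0" and UV: "U * V > - 2 * M" and r_def: "r = area_radius M U V"
    and x: "x $ 1 = U" "x $ 2 = V" "x $ 3 = th" and th: "sin th \<noteq> 0"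
begin

lemma r_pos: "r > 0" and r_product: "area_radius M (x $ 1 * x $ 2) 1 = r"
  using area_radius(1)[OF M UV] by (simp_all add: r_def x flip: area_radius_mult)

lemma null_factor_pos: "null_factor M r > 0"
  using M r_pos by (simp add: null_factor_def)

lemma DERIV_radius_U: "((\<lambda>h. area_radius M ((U + h) * V) 1) has_real_derivative
    2 * M * exp (- r / (2 * M)) / r * V) (at 0)"
  unfolding r_def by (rule DERIV_area_radius_chain[OF M _ _ UV]) (auto intro!: derivative_eq_intros)

lemma DERIV_radius_V: "((\<lambda>h. area_radius M (U * (V + h)) 1) has_real_derivative
    2 * M * exp (- r / (2 * M)) / r * U) (at 0)"
  unfolding r_def by (rule DERIV_area_radius_chain[OF M _ _ UV]) (auto intro!: derivative_eq_intros)

lemma DERIV_null_factor: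
  assumes "(R has_real_derivative R') (at 0)" "R 0 = r"
  shows "((\<lambda>h. null_factor M (R h) / 2) has_real_derivative
    - null_factor M r * (1 / (2 * M) + 1 / r) * R' / 2) (at 0)"
  unfolding null_factor_def using assms M r_pos
  by (auto intro!: derivative_eq_intros simp: field_simps power2_eq_square)

lemma partial_kruskal_12:
  "partial 1 (\<lambda>y. kruskal_metric M y $ 1 $ 2) x =
    - null_factor M r * (1 / (2 * M) + 1 / r) * (2 * M * exp (- r / (2 * M)) / r * V) / 2"
  "partial 2 (\<lambda>y. kruskal_metric M y $ 2 $ 1) x =
    - null_factor M r * (1 / (2 * M) + 1 / r) * (2 * M * exp (- r / (2 * M)) / r * U) / 2"
  using r_product DERIV_null_factor[OF DERIV_radius_U] DERIV_null_factor[OF DERIV_radius_V]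
  by (auto intro!: partialI simp: kruskal_metric_nth axis_def x)

lemma partial_kruskal_33:
  "partial 1 (\<lambda>y. kruskal_metric M y $ 3 $ 3) x = 2 * r * (2 * M * exp (- r / (2 * M)) / r * V)"
  "partial 2 (\<lambda>y. kruskal_metric M y $ 3 $ 3) x = 2 * r * (2 * M * exp (- r / (2 * M)) / r * U)"
  using r_product
  by (auto intro!: partialI derivative_eq_intros DERIV_radius_U[simplified] DERIV_radius_V[simplified] 
      simp: kruskal_metric_nth axis_def x)

lemma partial_kruskal_44:
  "partial 1 (\<lambda>y. kruskal_metric M y $ 4 $ 4) x
    = 2 * r * (2 * M * exp (- r / (2 * M)) / r * V) * (sin th)\<^sup>2"
  "partial 2 (\<lambda>y. kruskal_metric M y $ 4 $ 4) x
    = 2 * r * (2 * M * exp (- r / (2 * M)) / r * U) * (sin th)\<^sup>2"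
  using r_product
  by (auto intro!: partialI derivative_eq_intros DERIV_radius_U[simplified] DERIV_radius_V[simplified] 
      simp: kruskal_metric_nth axis_def x)

lemma kruskal_metric_0:
  "kruskal_metric M y $ 1 $ 1 = 0" "kruskal_metric M y $ 2 $ 2 = 0"
  "kruskal_metric M y $ 1 $ 3 = 0" "kruskal_metric M y $ 2 $ 3 = 0"
  "kruskal_metric M y $ 3 $ 1 = 0" "kruskal_metric M y $ 3 $ 2 = 0"
  "kruskal_metric M y $ 1 $ 4 = 0" "kruskal_metric M y $ 2 $ 4 = 0"
  "kruskal_metric M y $ 4 $ 1 = 0" "kruskal_metric M y $ 4 $ 2 = 0"
  by (simp_all add: kruskal_metric_nth)

lemma christoffel_kruskal:
  "christoffel (kruskal_metric M) 1 j k x = 1 / null_factor M r *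
     (partial j (\<lambda>y. kruskal_metric M y $ 2 $ k) x + partial k (\<lambda>y. kruskal_metric M y $ 2 $ j) x
      - partial 2 (\<lambda>y. kruskal_metric M y $ j $ k) x)"
  "christoffel (kruskal_metric M) 2 j k x = 1 / null_factor M r *
     (partial j (\<lambda>y. kruskal_metric M y $ 1 $ k) x + partial k (\<lambda>y. kruskal_metric M y $ 1 $ j) x
      - partial 1 (\<lambda>y. kruskal_metric M y $ j $ k) x)"
  using null_factor_pos r_pos th x
  by (simp_all add: christoffel_def sum_4 matrix_inv_kruskal_metric[OF _ _ _ r_product] field_simps)

lemma kruskal_metric_sym: "kruskal_metric M y $ 2 $ 1 = kruskal_metric M y $ 1 $ 2"
  by (simp add: kruskal_metric_nth)

text \<open>In null coordinates the only nonzero symbols of the \<open>(U, V)\<close>-plane are the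
  derivatives of the logarithm of \<open>null_factor\<close> in \<open>U\<close> and in
  \<open>V\<close>. That logarithm has the derivative \<open>- (1 / (2 * M) + 1 / r)\<close> in
  \<open>r\<close>; the last factor is the derivative of \<open>r\<close> in \<open>U\<close> or in
  \<open>V\<close>.\<close>

lemma christoffel_kruskal_null:
  "christoffel (kruskal_metric M) 1 1 1 x = - (1 / (2 * M) + 1 / r) * (2 * M * exp (- r / (2 * M)) / r * V)"
  "christoffel (kruskal_metric M) 1 1 2 x = 0" "christoffel (kruskal_metric M) 1 2 1 x = 0"
  "christoffel (kruskal_metric M) 1 2 2 x = 0"
  "christoffel (kruskal_metric M) 2 2 2 x = - (1 / (2 * M) + 1 / r) * (2 * M * exp (- r / (2 * M)) / r * U)"
  "christoffel (kruskal_metric M) 2 1 2 x = 0" "christoffel (kruskal_metric M) 2 2 1 x = 0"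
  "christoffel (kruskal_metric M) 2 1 1 x = 0"
  using null_factor_pos r_pos M
  by (simp_all add: christoffel_kruskal kruskal_metric_0 partial_kruskal_12[unfolded kruskal_metric_sym]
      kruskal_metric_sym)
    (simp_all add: field_simps)

lemma christoffel_kruskal_sphere:
  "christoffel (kruskal_metric M) 1 3 3 x = - 4 * M * exp (- r / (2 * M)) * U / null_factor M r"
  "christoffel (kruskal_metric M) 2 3 3 x = - 4 * M * exp (- r / (2 * M)) * V / null_factor M r"
  "christoffel (kruskal_metric M) 1 4 4 x = - 4 * M * exp (- r / (2 * M)) * U * (sin th)\<^sup>2 / null_factor M r"
  "christoffel (kruskal_metric M) 2 4 4 x = - 4 * M * exp (- r / (2 * M)) * V * (sin th)\<^sup>2 / null_factor M r"
  using r_pos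
  by (simp_all add: christoffel_kruskal kruskal_metric_0 partial_kruskal_33 partial_kruskal_44)

end

text \<open>The normal is a multiple of \<open>(u1, - v1)\<close>. The curve direction therefore
  contributes \<open>v2 * u1 - u2 * v1\<close> and a Christoffel term with factor
  \<open>1 / (2 * M) + 1 / r\<close>; the two sphere directions contribute equally, together with
  factor \<open>- 4 / r\<close>. The sum of these factors is
  \<open>- (6 * M - r) / (2 * M * r)\<close>, the origin of \<open>6 * M\<close>.\<close>

lemma maximal_criterion:
  fixes p :: "real^3"
  assumes M: "M > 0" and p: "0 < p $ 2" "p $ 2 < pi"
    and u2: "(deriv u has_real_derivative u2) (at (p $ 1))"
    and v2: "(deriv v has_real_derivative v2) (at (p $ 1))"
  defines "U \<equiv> u (p $ 1)" and "V \<equiv> v (p $ 1)" and "u1 \<equiv> deriv u (p $ 1)" and "v1 \<equiv> deriv v (p $ 1)"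
  defines "r \<equiv> area_radius M U V"
  assumes UV: "U * V > - 2 * M" and pos: "u1 * v1 > 0"
    and eq: "v2 * u1 - u2 * v1 = u1 * v1 * (6 * M - r) / r\<^sup>2 * exp (- r / (2 * M)) * (V * u1 - U * v1)"
  shows "spacelike_at (kruskal_metric M) (rotate_curve u v) p"
    and "unit_normal (kruskal_metric M) (rotate_curve u v) p n \<Longrightarrow>
         mean_curvature (kruskal_metric M) (rotate_curve u v) p n = 0"
proof -
  let ?X = "rotate_curve u v" let ?g = "kruskal_metric M" let ?x = "?X p"
  define F where "F = null_factor M r"
  have s: "sin (p $ 2) > 0" using p by (intro sin_gt_zero) auto
  note ctx = M UV r_def[THEN meta_eq_to_obj_eq] rotate_curve_nth(1)[of u v p, folded U_def]
    rotate_curve_nth(2)[of u v p, folded V_def] rotate_curve_nth(3)[of u v p] s[THEN less_imp_neq, THEN not_sym]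
  have r: "r > 0" and F: "F > 0" and rp: "area_radius M (?x $ 1 * ?x $ 2) 1 = r"
    using r_pos[OF ctx] r_product[OF ctx] null_factor_pos[OF ctx] by (simp_all add: F_def)
  note mp = metric_prod_kruskal[OF rp, folded F_def]
  have ff: "first_fund ?g ?X p = (\<chi> a b. if a = 1 \<and> b = 1 then F * u1 * v1
      else if a = 2 \<and> b = 2 then r\<^sup>2 else if a = 3 \<and> b = 3 then r\<^sup>2 * (sin (p $ 2))\<^sup>2 else 0)"
    by (simp add: first_fund_def vec_eq_iff forall_3 mp coord_tangent_rotate_curve axis_def u1_def v1_def)
  have "F * u1 * v1 > 0" using F pos by (simp add: mult.assoc)
  show "spacelike_at ?g ?X p"
    unfolding spacelike_at_def
  proof (intro allI impI)
    fix w :: "real^3" assume "w \<noteq> 0"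
    have "w \<bullet> (first_fund ?g ?X p *v w) =
      F * u1 * v1 * (w $ 1)\<^sup>2 + r\<^sup>2 * (w $ 2)\<^sup>2 + r\<^sup>2 * (sin (p $ 2))\<^sup>2 * (w $ 3)\<^sup>2"
      by (simp add: ff inner_vec_def matrix_vector_mult_def sum_3 power2_eq_square)
    moreover have "w $ 1 \<noteq> 0 \<or> w $ 2 \<noteq> 0 \<or> w $ 3 \<noteq> 0"
      using \<open>w \<noteq> 0\<close> by (simp add: vec_eq_iff forall_3)
    moreover have "F * u1 * v1 * (w $ 1)\<^sup>2 \<ge> 0" "r\<^sup>2 * (w $ 2)\<^sup>2 \<ge> 0"
      "r\<^sup>2 * (sin (p $ 2))\<^sup>2 * (w $ 3)\<^sup>2 \<ge> 0" using \<open>F * u1 * v1 > 0\<close> by simp_all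
    moreover have "w $ 1 \<noteq> 0 \<Longrightarrow> F * u1 * v1 * (w $ 1)\<^sup>2 > 0" "w $ 2 \<noteq> 0 \<Longrightarrow> r\<^sup>2 * (w $ 2)\<^sup>2 > 0"
      "w $ 3 \<noteq> 0 \<Longrightarrow> r\<^sup>2 * (sin (p $ 2))\<^sup>2 * (w $ 3)\<^sup>2 > 0"
      using \<open>F * u1 * v1 > 0\<close> r s by simp_all
    ultimately show "w \<bullet> (first_fund ?g ?X p *v w) > 0" by linarith
  qed
  assume n: "unit_normal ?g ?X p n"
  have inv: "matrix_inv (first_fund ?g ?X p) = (\<chi> a b. if a = 1 \<and> b = 1 then 1 / (F * u1 * v1)
      else if a = 2 \<and> b = 2 then 1 / r\<^sup>2 else if a = 3 \<and> b = 3 then 1 / (r\<^sup>2 * (sin (p $ 2))\<^sup>2) else 0)"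
    by (rule matrix_inv_eqI)
       (use \<open>F * u1 * v1 > 0\<close> r s in \<open>auto simp: ff vec_eq_iff matrix_matrix_mult_def mat_def sum_3 forall_3\<close>)
  have nt: "metric_prod ?g ?x n (coord_tangent ?X a p) = 0" for a
    using n by (simp add: unit_normal_def)
  have n3: "n $ 3 = 0" using nt[of 2] r by (simp add: mp coord_tangent_rotate_curve axis_def)
  have n4: "n $ 4 = 0" using nt[of 3] r s by (simp add: mp coord_tangent_rotate_curve axis_def)
  have n12: "n $ 1 * v1 + n $ 2 * u1 = 0"
    using nt[of 1] F by (simp add: mp coord_tangent_rotate_curve u1_def v1_def)
  \<comment> \<open>The derivative of the area radius with respect to the product
    \<open>U * V\<close>.\<close>
  define e where "e = 2 * M * exp (- r / (2 * M)) / r"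
  have cov1: "cov_tangent ?g ?X 1 1 p $ 1 = u2 - (1 / (2 * M) + 1 / r) * (e * V) * u1\<^sup>2"
    "cov_tangent ?g ?X 1 1 p $ 2 = v2 - (1 / (2 * M) + 1 / r) * (e * U) * v1\<^sup>2"
    using DERIV_imp_deriv[OF u2] DERIV_imp_deriv[OF v2] r M
    by (simp_all add: cov_tangent_def coord_tangent_rotate_curve sum_4 partial_nth
        christoffel_kruskal_null[OF ctx] u1_def v1_def power2_eq_square e_def)
      (simp_all add: field_simps)
  have cov2: "cov_tangent ?g ?X 2 2 p $ 1 = - 2 * r * e * U / F"
    "cov_tangent ?g ?X 2 2 p $ 2 = - 2 * r * e * V / F"
    using r by (simp_all add: cov_tangent_def coord_tangent_rotate_curve sum_4 axis_def
        christoffel_kruskal_sphere[OF ctx] e_def F_def)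
  have cov3: "cov_tangent ?g ?X 3 3 p $ 1 = - 2 * r * e * U * (sin (p $ 2))\<^sup>2 / F"
    "cov_tangent ?g ?X 3 3 p $ 2 = - 2 * r * e * V * (sin (p $ 2))\<^sup>2 / F"
    using r by (simp_all add: cov_tangent_def coord_tangent_rotate_curve sum_4 axis_def
        christoffel_kruskal_sphere[OF ctx] e_def F_def)
  have un: "u1 \<noteq> 0" "v1 \<noteq> 0" using pos by auto
  \<comment> \<open>Orthogonality to the curve makes the normal \<open>k\<close> times
    \<open>(u1, - v1)\<close>, so \<open>k\<close> can be pulled out of the trace.\<close>
  define k where "k = n $ 1 / u1"
  have k: "n $ 1 = k * u1" "n $ 2 = - k * v1"
    using un n12 by (simp_all add: k_def field_simps add_eq_0_iff)
  have eq': "v2 * u1 - u2 * v1 = u1 * v1 * (6 * M - r) / (2 * M * r) * e * (V * u1 - U * v1)"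
  proof -
    have "(6 * M - r) / (2 * M * r) * e = (6 * M - r) / r\<^sup>2 * exp (- r / (2 * M))"
      using r M by (simp add: e_def power2_eq_square field_simps)
    then show ?thesis unfolding eq by (metis (no_types, opaque_lifting) mult.assoc times_divide_eq_right)
  qed
  have sn: "sin (p $ 2) \<noteq> 0" using s by simp
  have "mean_curvature ?g ?X p n = (1 / 3) *
      ((u2 - (1 / (2 * M) + 1 / r) * (e * V) * u1\<^sup>2) * (n $ 2) / (2 * u1 * v1)
       + (v2 - (1 / (2 * M) + 1 / r) * (e * U) * v1\<^sup>2) * (n $ 1) / (2 * u1 * v1)
       - 2 * e / r * (U * n $ 2 + V * n $ 1))"
    using un r F sn
    by (simp add: mean_curvature_def sum_3 inv mp n3 n4 cov1 cov2 cov3)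
       (simp add: field_simps power2_eq_square)
  also have "\<dots> = (k / (6 * u1 * v1)) * ((v2 * u1 - u2 * v1)
       + (1 / (2 * M) + 1 / r) * e * u1 * v1 * (V * u1 - U * v1) 
       - 4 * e / r * u1 * v1 * (V * u1 - U * v1))"
    using un r M by (simp add: k field_simps power2_eq_square)
  also have "\<dots> = 0"
    unfolding eq' using un r M by (simp add: field_simps)
  finally show "mean_curvature ?g ?X p n = 0" .
qed

text \<open>\<open>K\<close> is the rapidity of the tangent in null coordinates. In
  \<open>v2 * u1 - u2 * v1\<close> the derivative of \<open>P\<close> cancels and
  \<open>2 * P\<^sup>2 * K'\<close> remains, so vanishing mean curvature becomes a first-order
  equation for the rapidity.\<close>

lemma maximal_curveI:
  assumes M: "M > 0" and I: "open I" "connected I" "I \<noteq> {}"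
    and smooth: "smooth_on_open I u" "smooth_on_open I v"
    and u: "\<And>s. s \<in> I \<Longrightarrow> (u has_real_derivative P s * exp (- K s)) (at s)"
    and v: "\<And>s. s \<in> I \<Longrightarrow> (v has_real_derivative P s * exp (K s)) (at s)"
    and P: "\<And>s. s \<in> I \<Longrightarrow> P s > 0"
    and P': "\<And>s. s \<in> I \<Longrightarrow> (P has_real_derivative P' s) (at s)"
    and K': "\<And>s. s \<in> I \<Longrightarrow> (K has_real_derivative K' s) (at s)"
    and r: "\<And>s. s \<in> I \<Longrightarrow> r s > 0" "\<And>s. s \<in> I \<Longrightarrow> (r s - 2 * M) * exp (r s / (2 * M)) = u s * v s"
    and eq: "\<And>s. s \<in> I \<Longrightarrow> 2 * K' s = P s * (6 * M - r s) / (r s)\<^sup>2 * exp (- r s / (2 * M)) *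
        (v s * exp (- K s) - u s * exp (K s))"
  shows "spacelike_maximal_hypersurface M ((\<lambda>s. (u s, v s)) ` I)"
  unfolding spacelike_maximal_hypersurface_def
proof (intro conjI exI)
  have UV: "u s * v s > - 2 * M" if "s \<in> I" for s
    using area_fun_strict_mono[OF M, of 0 "r s"] r[OF that] by simp
  then show "(\<lambda>s. (u s, v s)) ` I \<subseteq> kruskal M" by (auto simp: kruskal_def)
  show "\<forall>p. p $ 1 \<in> I \<and> 0 < p $ 2 \<and> p $ 2 < pi \<longrightarrow>
     spacelike_at (kruskal_metric M) (rotate_curve u v) p \<and>
     (\<forall>n. unit_normal (kruskal_metric M) (rotate_curve u v) p n \<longrightarrow>
        mean_curvature (kruskal_metric M) (rotate_curve u v) p n = 0)"
  proof (intro allI impI)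
    fix p :: "real^3" assume p: "p $ 1 \<in> I \<and> 0 < p $ 2 \<and> p $ 2 < pi"
    define s where "s = p $ 1"
    have s: "s \<in> I" using p by (simp add: s_def)
    have ev: "eventually (\<lambda>x. x \<in> I) (nhds s)" using I(1) s eventually_nhds by blast
    have du: "deriv u x = P x * exp (- K x)" and dv: "deriv v x = P x * exp (K x)" if "x \<in> I" for x
      using u[OF that] v[OF that] by (auto intro: DERIV_imp_deriv)
    have "((\<lambda>x. P x * exp (- K x)) has_real_derivative P' s * exp (- K s) - P s * K' s * exp (- K s)) (at s)"
      using P'[OF s] K'[OF s] by (auto intro!: derivative_eq_intros)
    moreover have "eventually (\<lambda>x. deriv u x = P x * exp (- K x)) (nhds s)"
      using ev by eventually_elim (rule du)
    ultimately have u2: "(deriv u has_real_derivative P' s * exp (- K s) - P s * K' s * exp (- K s)) (at (p $ 1))"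
      unfolding s_def[symmetric] using DERIV_cong_ev[OF refl _ refl] by fast
    have "((\<lambda>x. P x * exp (K x)) has_real_derivative P' s * exp (K s) + P s * K' s * exp (K s)) (at s)"
      using P'[OF s] K'[OF s] by (auto intro!: derivative_eq_intros)
    moreover have "eventually (\<lambda>x. deriv v x = P x * exp (K x)) (nhds s)"
      using ev by eventually_elim (rule dv)
    ultimately have v2: "(deriv v has_real_derivative P' s * exp (K s) + P s * K' s * exp (K s)) (at (p $ 1))"
      unfolding s_def[symmetric] using DERIV_cong_ev[OF refl _ refl] by fast
    have rr: "area_radius M (u s) (v s) = r s" by (rule area_radius_eqI) (use M r s in auto)
    have ee: "exp (K s) * exp (- K s) = 1" by (simp flip: exp_add)
    have pos: "deriv u (p $ 1) * deriv v (p $ 1) > 0"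
      using P[OF s] by (simp add: du[OF s] dv[OF s] flip: s_def)
    have "(P' s * exp (K s) + P s * K' s * exp (K s)) * (P s * exp (- K s))
        - (P' s * exp (- K s) - P s * K' s * exp (- K s)) * (P s * exp (K s)) = 
        (P s)\<^sup>2 * (2 * K' s) * (exp (K s) * exp (- K s))"
      by (simp only: power2_eq_square) algebra
    also have "\<dots> = (P s)\<^sup>2 * (2 * K' s)" by (simp only: ee mult_1_right)
    also have "\<dots> = (P s * exp (- K s)) * (P s * exp (K s)) * (P s * (6 * M - r s) / (r s)\<^sup>2 * exp (- r s / (2 * M)) *
        (v s * exp (- K s) - u s * exp (K s)))"
      unfolding eq[OF s] using ee by (simp add: power2_eq_square mult.commute)
    also have "\<dots> = (P s * exp (- K s)) * (P s * exp (K s)) * (6 * M - r s) / (r s)\<^sup>2 * exp (- r s / (2 * M)) *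
        (v s * (P s * exp (- K s)) - u s * (P s * exp (K s)))"
      by (simp add: algebra_simps)
    finally have eq': "(P' s * exp (K s) + P s * K' s * exp (K s)) * deriv u (p $ 1)
        - (P' s * exp (- K s) - P s * K' s * exp (- K s)) * deriv v (p $ 1) = 
        deriv u (p $ 1) * deriv v (p $ 1) * (6 * M - area_radius M (u (p $ 1)) (v (p $ 1)))
         / (area_radius M (u (p $ 1)) (v (p $ 1)))\<^sup>2 * exp (- area_radius M (u (p $ 1)) (v (p $ 1)) / (2 * M))
         * (v (p $ 1) * deriv u (p $ 1) - u (p $ 1) * deriv v (p $ 1))"
      unfolding s_def[symmetric] rr du[OF s] dv[OF s] .
    have p2: "0 < p $ 2" "p $ 2 < pi" using p by auto
    note crit = maximal_criterion[OF M p2 u2 v2 _ pos eq']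
    show "spacelike_at (kruskal_metric M) (rotate_curve u v) p \<and>
     (\<forall>n. unit_normal (kruskal_metric M) (rotate_curve u v) p n \<longrightarrow>
        mean_curvature (kruskal_metric M) (rotate_curve u v) p n = 0)"
      using crit UV[OF s] by (simp add: s_def)
  qed
qed (use I smooth in auto)

text \<open>Exchanging \<open>U\<close> and \<open>V\<close> turns \<open>K\<close> into
  \<open>- K\<close>, and both sides of the rapidity equation change sign.\<close>

lemma maximal_curveI_swap:
  assumes M: "M > 0" and I: "open I" "connected I" "I \<noteq> {}"
    and smooth: "smooth_on_open I u" "smooth_on_open I v"
    and u: "\<And>s. s \<in> I \<Longrightarrow> (u has_real_derivative P s * exp (- K s)) (at s)"
    and v: "\<And>s. s \<in> I \<Longrightarrow> (v has_real_derivative P s * exp (K s)) (at s)"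
    and P: "\<And>s. s \<in> I \<Longrightarrow> P s > 0"
    and P': "\<And>s. s \<in> I \<Longrightarrow> (P has_real_derivative P' s) (at s)"
    and K': "\<And>s. s \<in> I \<Longrightarrow> (K has_real_derivative K' s) (at s)"
    and r: "\<And>s. s \<in> I \<Longrightarrow> r s > 0" "\<And>s. s \<in> I \<Longrightarrow> (r s - 2 * M) * exp (r s / (2 * M)) = u s * v s"
    and eq: "\<And>s. s \<in> I \<Longrightarrow> 2 * K' s = P s * (6 * M - r s) / (r s)\<^sup>2 * exp (- r s / (2 * M)) *
        (v s * exp (- K s) - u s * exp (K s))"
  shows "spacelike_maximal_hypersurface M (prod.swap ` (\<lambda>s. (u s, v s)) ` I)"
proof -
  have "spacelike_maximal_hypersurface M ((\<lambda>s. (v s, u s)) ` I)"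
  proof (rule maximal_curveI[where P=P and P'=P' and K="\<lambda>s. - K s" and K'="\<lambda>s. - K' s" and r=r])
    fix s assume s: "s \<in> I"
    show "2 * (- K' s) = P s * (6 * M - r s) / (r s)\<^sup>2 * exp (- r s / (2 * M)) *
        (u s * exp (- (- K s)) - v s * exp (- K s))"
      using eq[OF s] minus_diff_eq[of "v s * exp (- K s)" "u s * exp (K s)"]
      by (metis minus_minus mult_minus_right)
  qed (use assms in \<open>auto intro: DERIV_minus simp: mult.commute\<close>)
  then show ?thesis by (simp add: image_image)
qed

section \<open>The parametrisation of a hypersurface through its throat\<close>

text \<open>The quotient of \<open>D\<close> by its root \<open>x - a\<close>, see \<open>quot_mult\<close>. The substitution
  \<open>x = a + \<sigma> * w\<^sup>2\<close> removes the square root singularity of \<open>sqrt D\<close> at the throat, so that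
  \<open>w\<close> is a global smooth parameter and the reflection \<open>rho\<close> becomes \<open>w \<mapsto> - w\<close>. The sign
  \<open>\<sigma>\<close> is \<open>1\<close> for \<open>\<Sigma>\<^sup>+\<close> and \<open>- 1\<close> for \<open>\<Sigma>\<^sup>-\<close>.\<close>

definition throat_quot :: "real \<Rightarrow> real \<Rightarrow> real \<Rightarrow> real" where
  "throat_quot M a x = (x\<^sup>2 + a\<^sup>2) * (x + a) - 2 * M * (x\<^sup>2 + x * a + a\<^sup>2)"

definition throat_energy :: "real \<Rightarrow> real \<Rightarrow> real" where
  "throat_energy M a = sqrt (a ^ 3 * (2 * M - a))"

definition thr_rad :: "real \<Rightarrow> real \<Rightarrow> real \<Rightarrow> real" where
  "thr_rad \<sigma> a w = a + \<sigma> * w\<^sup>2"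

definition thr_root :: "real \<Rightarrow> real \<Rightarrow> real \<Rightarrow> real \<Rightarrow> real" where
  "thr_root M \<sigma> a w = sqrt (\<sigma> * throat_quot M a (thr_rad \<sigma> a w))"

definition thr_dens :: "real \<Rightarrow> real \<Rightarrow> real \<Rightarrow> real \<Rightarrow> real" where
  "thr_dens M \<sigma> a w = (6 * M - thr_rad \<sigma> a w) / (2 * M * thr_rad \<sigma> a w * thr_root M \<sigma> a w)"

text \<open>One of the two integrals is over an empty or degenerate interval.\<close>

definition thr_int :: "real \<Rightarrow> real \<Rightarrow> real \<Rightarrow> real \<Rightarrow> real" where
  "thr_int M \<sigma> a w = integral {0..w} (thr_dens M \<sigma> a) - integral {w..0} (thr_dens M \<sigma> a)"

definition thr_prof :: "real \<Rightarrow> real \<Rightarrow> real" where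
  "thr_prof M x = exp (x / (4 * M)) / (x * sqrt x)"

text \<open>With \<open>y = \<sigma> * w * thr_root\<close> one has \<open>y\<^sup>2 = D\<close>. The factors \<open>y \<plusminus> C\<close> carry the zeros of \<open>U\<close> and \<open>V\<close>
  on the horizons \<open>x = 2 * M\<close>; what remains of the integrals for \<open>ln V\<close> is regular there.\<close>

definition leafU :: "real \<Rightarrow> real \<Rightarrow> real \<Rightarrow> real \<Rightarrow> real" where
  "leafU M \<sigma> a w = (\<sigma> * w * thr_root M \<sigma> a w - throat_energy M a) * thr_prof M (thr_rad \<sigma> a w)
     * exp (- (throat_energy M a * thr_int M \<sigma> a w))"

definition leafV :: "real \<Rightarrow> real \<Rightarrow> real \<Rightarrow> real \<Rightarrow> real" where
  "leafV M \<sigma> a w = (\<sigma> * w * thr_root M \<sigma> a w + throat_energy M a) * thr_prof M (thr_rad \<sigma> a w)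
     * exp (throat_energy M a * thr_int M \<sigma> a w)"

definition throat_dom :: "real \<Rightarrow> real \<Rightarrow> real set" where
  "throat_dom \<sigma> a = {w. 0 < thr_rad \<sigma> a w}"

locale throat =
  fixes M \<sigma> a :: real
  assumes M_pos: "0 < M" and a_pos: "0 < a" and a_le: "a \<le> 2 * M"
    and sigma: "\<sigma> = 1 \<or> \<sigma> = -1" and side: "\<sigma> * (2 * a - 3 * M) > 0"
begin

lemma energy_square: "(throat_energy M a)\<^sup>2 = a ^ 3 * (2 * M - a)"
  using a_pos a_le by (simp add: throat_energy_def)

lemma quot_mult: "(x - a) * throat_quot M a x = (throat_energy M a)\<^sup>2 + x ^ 3 * (x - 2 * M)"
  unfolding energy_square throat_quot_def by algebra

text \<open>For \<open>a = 3 * M / 2\<close> the quotient vanishes at \<open>a\<close> once more.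
  Replacing \<open>M\<close> by \<open>2 * a / 3\<close> therefore leaves \<open>?q\<close>, which
  has the sign of \<open>x - a\<close>; the rest is a positive form times
  \<open>4 * a / 3 - 2 * M\<close>, whose sign is \<open>\<sigma>\<close> by \<open>side\<close>. So
  \<open>D\<close> has no further zero beyond the throat.\<close>

lemma quot_pos:
  assumes "x > 0" "\<sigma> * (x - a) \<ge> 0"
  shows "\<sigma> * throat_quot M a x > 0"
proof -
  let ?q = "(x\<^sup>2 + a\<^sup>2) * (x + a) - 4 * a / 3 * (x\<^sup>2 + x * a + a\<^sup>2)"
  have q: "throat_quot M a x = ?q + (4 * a / 3 - 2 * M) * (x\<^sup>2 + x * a + a\<^sup>2)"
    by (simp add: throat_quot_def algebra_simps)
  have p: "x\<^sup>2 + x * a + a\<^sup>2 > 0" using assms a_pos by (intro add_pos_pos) auto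
  have f: "3 * ?q = (x - a) * (3 * x\<^sup>2 + 2 * a * x + a\<^sup>2)" by algebra
  have g: "3 * x\<^sup>2 + 2 * a * x + a\<^sup>2 > 0" using assms a_pos by (intro add_pos_pos) auto
  have "\<sigma> * (4 * a / 3 - 2 * M) > 0" using sigma side by auto
  then have "\<sigma> * (4 * a / 3 - 2 * M) * (x\<^sup>2 + x * a + a\<^sup>2) > 0" using p by simp
  moreover have "\<sigma> * (3 * ?q) \<ge> 0"
    using mult_nonneg_nonneg[OF assms(2) less_imp_le[OF g]] by (metis f mult.assoc)
  moreover have "\<sigma> * throat_quot M a x = \<sigma> * ?q + \<sigma> * (4 * a / 3 - 2 * M) * (x\<^sup>2 + x * a + a\<^sup>2)"
    unfolding q by (simp only: distrib_left mult.assoc)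
  ultimately show ?thesis by linarith
qed

lemma rad_pos: "w \<in> throat_dom \<sigma> a \<Longrightarrow> thr_rad \<sigma> a w > 0"
  by (simp add: throat_dom_def)

lemma rad_side: "\<sigma> * (thr_rad \<sigma> a w - a) = w\<^sup>2"
  using sigma by (auto simp: thr_rad_def)

lemma root_pos: "w \<in> throat_dom \<sigma> a \<Longrightarrow> thr_root M \<sigma> a w > 0"
  and root_arg_pos: "w \<in> throat_dom \<sigma> a \<Longrightarrow> \<sigma> * throat_quot M a (thr_rad \<sigma> a w) > 0"
  using quot_pos[OF rad_pos] rad_side[of w] by (auto simp: thr_root_def)

lemma energy_relation:
  assumes "w \<in> throat_dom \<sigma> a"
  shows "(\<sigma> * w * thr_root M \<sigma> a w)\<^sup>2 =
    (throat_energy M a)\<^sup>2 + thr_rad \<sigma> a w ^ 3 * (thr_rad \<sigma> a w - 2 * M)"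
proof -
  have "(\<sigma> * w * thr_root M \<sigma> a w)\<^sup>2 = w\<^sup>2 * (\<sigma> * throat_quot M a (thr_rad \<sigma> a w))"
    using root_arg_pos[OF assms] sigma by (auto simp: power_mult_distrib thr_root_def)
  also have "\<dots> = (thr_rad \<sigma> a w - a) * throat_quot M a (thr_rad \<sigma> a w)"
    using rad_side[of w] sigma by auto
  finally show ?thesis by (simp only: quot_mult)
qed

lemma dom_cases:
  "throat_dom \<sigma> a = (if \<sigma> = 1 then UNIV else {- sqrt a <..< sqrt a})"
proof (cases "\<sigma> = 1")
  case True
  have "0 < a + w\<^sup>2" for w using a_pos by (rule add_pos_nonneg) simp
  then show ?thesis using True by (auto simp: throat_dom_def thr_rad_def)
next
  case False
  have "w\<^sup>2 < a \<longleftrightarrow> - sqrt a < w \<and> w < sqrt a" for w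
    using real_sqrt_less_iff[of "w\<^sup>2" a] by (simp add: abs_less_iff minus_less_iff conj_commute)
  then show ?thesis using False sigma by (simp add: throat_dom_def thr_rad_def set_eq_iff)
qed

lemma dom_open: "open (throat_dom \<sigma> a)" and dom_connected: "connected (throat_dom \<sigma> a)"
  and dom_0: "0 \<in> throat_dom \<sigma> a" and dom_minus: "- w \<in> throat_dom \<sigma> a \<longleftrightarrow> w \<in> throat_dom \<sigma> a"
  and dom_convex: "u \<in> throat_dom \<sigma> a \<Longrightarrow> v \<in> throat_dom \<sigma> a \<Longrightarrow> {u..v} \<subseteq> throat_dom \<sigma> a"
  using a_pos by (auto simp: dom_cases)

lemma smooth_rad: "smooth_on_open (throat_dom \<sigma> a) (thr_rad \<sigma> a)"
  unfolding thr_rad_def[abs_def] by (intro smooth_intros dom_open)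

lemma smooth_root: "smooth_on_open (throat_dom \<sigma> a) (thr_root M \<sigma> a)"
  unfolding thr_root_def[abs_def] throat_quot_def
  by (intro smooth_intros dom_open smooth_rad)
     (use root_arg_pos in \<open>auto simp: throat_quot_def\<close>)

lemma smooth_dens: "smooth_on_open (throat_dom \<sigma> a) (thr_dens M \<sigma> a)"
  unfolding thr_dens_def[abs_def]
  by (intro smooth_intros dom_open smooth_rad smooth_root)
     (use rad_pos root_pos M_pos in \<open>auto simp: less_imp_neq[symmetric]\<close>)

lemma smooth_imp_continuous: "smooth_on_open I f \<Longrightarrow> continuous_on I f"
  unfolding smooth_on_open_def
  by (metis continuous_at_imp_continuous_on differentiable_imp_continuous_within funpow_0)

lemma DERIV_int:
  assumes "w \<in> throat_dom \<sigma> a"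
  shows "(thr_int M \<sigma> a has_real_derivative thr_dens M \<sigma> a w) (at w)"
proof -
  obtain e where e: "e > 0" "ball w e \<subseteq> throat_dom \<sigma> a"
    using dom_open assms open_contains_ball by blast
  \<comment> \<open>On the symmetric interval \<open>{-b..b}\<close> one integral from
    \<open>-b\<close> represents \<open>thr_int\<close> on both sides of \<open>0\<close>. The end
    on the side of \<open>w\<close> lies in the ball, and the other one in the domain by
    symmetry.\<close>
  define b where "b = \<bar>w\<bar> + e / 2"
  have b: "b \<in> throat_dom \<sigma> a"
  proof (cases "w \<ge> 0")
    case True
    then have "b \<in> ball w e" using e by (auto simp: b_def dist_real_def)
    then show ?thesis using e by auto
  next
    case False
    then have "- b \<in> ball w e" using e by (auto simp: b_def dist_real_def)
    then show ?thesis using e dom_minus by auto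
  qed
  have w: "w \<in> {-b<..<b}" using e by (auto simp: b_def)
  have cont: "continuous_on {-b..b} (thr_dens M \<sigma> a)"
    by (rule continuous_on_subset[OF smooth_imp_continuous[OF smooth_dens]])
       (use dom_convex b dom_minus in auto)
  have int: "thr_dens M \<sigma> a integrable_on {x..y}" if "-b \<le> x" "y \<le> b" for x y
    by (rule integrable_continuous_interval, rule continuous_on_subset[OF cont]) (use that in auto)
  have eq: "thr_int M \<sigma> a x = integral {-b..x} (thr_dens M \<sigma> a) - integral {-b..0} (thr_dens M \<sigma> a)"
    if "x \<in> {-b<..<b}" for x
  proof (cases "x \<ge> 0")
    case True
    have "integral {x..0} (thr_dens M \<sigma> a) = 0" using True by (cases "x = 0") auto
    then show ?thesis
      using Henstock_Kurzweil_Integration.integral_combine[of "-b" 0 x "thr_dens M \<sigma> a"] int[of "-b" x] True that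
      by (auto simp: thr_int_def)
  next
    case False
    then show ?thesis
      using Henstock_Kurzweil_Integration.integral_combine[of "-b" x 0 "thr_dens M \<sigma> a"] int[of "-b" 0] that
      by (auto simp: thr_int_def)
  qed
  have "((\<lambda>x. integral {-b..x} (thr_dens M \<sigma> a)) has_real_derivative thr_dens M \<sigma> a w) (at w within {-b..b})"
    by (rule integral_has_real_derivative[OF cont]) (use w in auto)
  then have "((\<lambda>x. integral {-b..x} (thr_dens M \<sigma> a)) has_real_derivative thr_dens M \<sigma> a w) (at w)"
    using w at_within_interior[of w "{-b..b}"] by (simp add: interior_atLeastAtMost_real)
  then have "((\<lambda>x. integral {-b..x} (thr_dens M \<sigma> a) - integral {-b..0} (thr_dens M \<sigma> a))
      has_real_derivative thr_dens M \<sigma> a w) (at w)"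
    by (auto intro!: derivative_eq_intros)
  moreover have "eventually (\<lambda>x. thr_int M \<sigma> a x =
     integral {-b..x} (thr_dens M \<sigma> a) - integral {-b..0} (thr_dens M \<sigma> a)) (nhds w)"
    by (rule eventually_mono[OF eventually_nhds_in_open[of "{-b<..<b}" w]]) (use w eq in auto)
  ultimately show ?thesis
    using DERIV_cong_ev[OF refl _ refl] by fast
qed

lemma int_0: "thr_int M \<sigma> a 0 = 0" by (simp add: thr_int_def)

lemma rad_minus: "thr_rad \<sigma> a (- w) = thr_rad \<sigma> a w"
  and root_minus: "thr_root M \<sigma> a (- w) = thr_root M \<sigma> a w"
  and dens_minus: "thr_dens M \<sigma> a (- w) = thr_dens M \<sigma> a w"
  by (simp_all add: thr_rad_def thr_root_def thr_dens_def)

lemma int_minus: "thr_int M \<sigma> a (- w) = - thr_int M \<sigma> a w"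
  using Henstock_Kurzweil_Integration.integral_reflect_real[of 0 w "thr_dens M \<sigma> a"]
    Henstock_Kurzweil_Integration.integral_reflect_real[of w 0 "thr_dens M \<sigma> a"]
  by (simp add: thr_int_def dens_minus)

lemma leafU_minus: "leafU M \<sigma> a (- w) = - leafV M \<sigma> a w"
  by (simp add: leafU_def leafV_def rad_minus root_minus int_minus algebra_simps)

lemma leafV_minus: "leafV M \<sigma> a (- w) = - leafU M \<sigma> a w"
  using leafU_minus[of "- w"] by simp

section \<open>Derivatives and product of \<open>leafU\<close> and \<open>leafV\<close>\<close>

lemma DERIV_rad: "(thr_rad \<sigma> a has_real_derivative 2 * \<sigma> * w) (at w)"
  unfolding thr_rad_def by (auto intro!: derivative_eq_intros)

text \<open>This is \<open>y' = D' * x' / (2 * y)\<close> for \<open>y\<^sup>2 = D\<close>, where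
  \<open>x' / (2 * y) = 1 / thr_root\<close>. The division by \<open>y\<close> fails at the throat
  \<open>w = 0\<close>, so the derivative is taken through \<open>thr_root\<close>, which is
  positive there.\<close>

lemma DERIV_velocity:
  assumes w: "w \<in> throat_dom \<sigma> a"
  shows "((\<lambda>w. \<sigma> * w * thr_root M \<sigma> a w) has_real_derivative
     2 * (thr_rad \<sigma> a w)\<^sup>2 * (2 * thr_rad \<sigma> a w - 3 * M) / thr_root M \<sigma> a w) (at w)"
proof -
  define x where "x = thr_rad \<sigma> a w"
  define q' where "q' = 2 * x * (x + a) + (x\<^sup>2 + a\<^sup>2) - 2 * M * (2 * x + a)"
  define s where "s = thr_root M \<sigma> a w"
  have s: "s > 0" using root_pos[OF w] by (simp add: s_def)
  have ss: "s * s = \<sigma> * throat_quot M a x" using root_arg_pos[OF w] by (simp add: s_def thr_root_def x_def)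
  have "((\<lambda>x. throat_quot M a x) has_real_derivative q') (at (thr_rad \<sigma> a w))"
    unfolding throat_quot_def q'_def x_def[symmetric]
    by (auto intro!: derivative_eq_intros simp: algebra_simps power2_eq_square)
  from DERIV_chain2[OF this DERIV_rad]
  have "((\<lambda>w. \<sigma> * throat_quot M a (thr_rad \<sigma> a w)) has_real_derivative 2 * w * q') (at w)"
    by (rule DERIV_cong[OF DERIV_cmult]) (use sigma in auto)
  from DERIV_chain2[OF DERIV_real_sqrt[OF root_arg_pos[OF w]] this]
  have "((\<lambda>w. thr_root M \<sigma> a w) has_real_derivative w * q' / s) (at w)"
    unfolding thr_root_def[abs_def] s_def by (rule DERIV_cong) (simp add: field_simps)
  then have "((\<lambda>w. \<sigma> * w * thr_root M \<sigma> a w) has_real_derivative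
     \<sigma> * s + \<sigma> * w * (w * q' / s)) (at w)"
    by (auto intro!: derivative_eq_intros simp: s_def)
  moreover have "\<sigma> * s + \<sigma> * w * (w * q' / s) = 2 * x\<^sup>2 * (2 * x - 3 * M) / s"
  proof -
    have "(\<sigma> * s + \<sigma> * w * (w * q' / s)) * s = \<sigma> * (s * s) + \<sigma> * w\<^sup>2 * q'"
      using s by (simp add: field_simps power2_eq_square)
    also have "\<dots> = throat_quot M a x + (x - a) * q'"
      unfolding ss using sigma by (auto simp: x_def thr_rad_def)
    also have "\<dots> = 2 * x\<^sup>2 * (2 * x - 3 * M)"
      unfolding throat_quot_def q'_def by algebra
    finally show ?thesis using s by (intro eq_divide_imp) auto
  qed
  ultimately show ?thesis by (simp add: x_def s_def)
qed

lemma DERIV_prof: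
  assumes "x > 0"
  shows "(thr_prof M has_real_derivative thr_prof M x * (x - 6 * M) / (4 * M * x)) (at x)"
proof -
  have ss: "sqrt x * (sqrt x * z) = x * z" for z
    using assms by (simp flip: mult.assoc)
  show ?thesis
    unfolding thr_prof_def using assms M_pos
    by (auto intro!: derivative_eq_intros simp: divide_simps) (simp add: ss algebra_simps)
qed

lemma prof_pos: "x > 0 \<Longrightarrow> thr_prof M x > 0"
  by (simp add: thr_prof_def)

lemma prof_square: "x > 0 \<Longrightarrow> (thr_prof M x)\<^sup>2 = exp (x / (2 * M)) / x ^ 3"
  using M_pos by (simp add: thr_prof_def power_divide power_mult_distrib power2_eq_square power3_eq_cube
      flip: exp_add)

text \<open>The sign \<open>\<epsilon>\<close> treats \<open>leafV\<close> and \<open>leafU\<close>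
  at once. The term from \<open>thr_int\<close> completes the factor \<open>y\<close> that comes
  from the profile to \<open>y - c\<close>; then
  \<open>(y + c) * (y - c) = x ^ 3 * (x - 2 * M)\<close> removes \<open>c\<close>, so that apart
  from the exponentials both functions have the same speed.\<close>

lemma DERIV_leaf_aux:
  assumes w: "w \<in> throat_dom \<sigma> a" and \<epsilon>: "\<epsilon> = 1 \<or> \<epsilon> = - 1"
  shows "((\<lambda>w. (\<sigma> * w * thr_root M \<sigma> a w + \<epsilon> * throat_energy M a) * thr_prof M (thr_rad \<sigma> a w)
     * exp (\<epsilon> * throat_energy M a * thr_int M \<sigma> a w)) has_real_derivative
     thr_rad \<sigma> a w ^ 4 / (2 * M * thr_root M \<sigma> a w) * thr_prof M (thr_rad \<sigma> a w)
      * exp (\<epsilon> * throat_energy M a * thr_int M \<sigma> a w)) (at w)"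
proof -
  define x y s c p E where d: "x = thr_rad \<sigma> a w" "y = \<sigma> * w * thr_root M \<sigma> a w" "s = thr_root M \<sigma> a w"
    "c = \<epsilon> * throat_energy M a" "p = thr_prof M (thr_rad \<sigma> a w)" "E = exp (\<epsilon> * throat_energy M a * thr_int M \<sigma> a w)"
  have pos: "x > 0" "s > 0" "M > 0" using rad_pos[OF w] root_pos[OF w] M_pos by (auto simp: d)
  have "((\<lambda>w. thr_prof M (thr_rad \<sigma> a w)) has_real_derivative p * (x - 6 * M) / (4 * M * x) * (2 * \<sigma> * w)) (at w)"
    using DERIV_chain2[OF DERIV_prof[OF rad_pos[OF w]] DERIV_rad] by (simp add: d)
  moreover have "((\<lambda>w. exp (\<epsilon> * throat_energy M a * thr_int M \<sigma> a w)) has_real_derivative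
      E * (c * ((6 * M - x) / (2 * M * x * s)))) (at w)"
    using DERIV_fun_exp[OF DERIV_cmult[OF DERIV_int[OF w], of "\<epsilon> * throat_energy M a"]]
    by (simp add: d thr_dens_def)
  moreover have "((\<lambda>w. \<sigma> * w * thr_root M \<sigma> a w + \<epsilon> * throat_energy M a) has_real_derivative
     2 * x\<^sup>2 * (2 * x - 3 * M) / s) (at w)"
    using DERIV_add[OF DERIV_velocity[OF w] DERIV_const] by (simp add: d)
  ultimately have "((\<lambda>w. (\<sigma> * w * thr_root M \<sigma> a w + \<epsilon> * throat_energy M a) * thr_prof M (thr_rad \<sigma> a w)
     * exp (\<epsilon> * throat_energy M a * thr_int M \<sigma> a w)) has_real_derivative
     (2 * x\<^sup>2 * (2 * x - 3 * M) / s * p + p * (x - 6 * M) / (4 * M * x) * (2 * \<sigma> * w) * (y + c)) * E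
     + E * (c * ((6 * M - x) / (2 * M * x * s))) * ((y + c) * p)) (at w)"
    using DERIV_mult[OF DERIV_mult] unfolding d by blast
  moreover have "(2 * x\<^sup>2 * (2 * x - 3 * M) / s * p + p * (x - 6 * M) / (4 * M * x) * (2 * \<sigma> * w) * (y + c)) * E
     + E * (c * ((6 * M - x) / (2 * M * x * s))) * ((y + c) * p) = x ^ 4 / (2 * M * s) * p * E"
  proof -
    have sw: "\<sigma> * w = y / s" using pos by (simp add: d)
    have c2: "c\<^sup>2 = (throat_energy M a)\<^sup>2" using \<epsilon> by (auto simp: d)
    have rel: "(y + c) * (y - c) = x ^ 3 * (x - 2 * M)"
      using energy_relation[OF w, folded d] c2 by (simp add: algebra_simps power2_eq_square)
    have "(y + c) * (p * (x - 6 * M) / (4 * M * x) * (2 * \<sigma> * w)) * E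
       + (y + c) * p * (E * (c * ((6 * M - x) / (2 * M * x * s)))) =
       (y + c) * (y - c) * (x - 6 * M) / (2 * M * x * s) * p * E"
      unfolding mult.assoc[of 2] sw using pos by (simp add: field_simps)
    also have "\<dots> = x\<^sup>2 * (x - 2 * M) * (x - 6 * M) / (2 * M * s) * p * E"
      unfolding rel using pos by (simp add: field_simps power2_eq_square power3_eq_cube)
    also have "2 * x\<^sup>2 * (2 * x - 3 * M) / s * p * E + \<dots> =
       (4 * M * x\<^sup>2 * (2 * x - 3 * M) + x\<^sup>2 * (x - 2 * M) * (x - 6 * M)) / (2 * M * s) * p * E"
      using pos by (simp add: field_simps)
    also have "4 * M * x\<^sup>2 * (2 * x - 3 * M) + x\<^sup>2 * (x - 2 * M) * (x - 6 * M) = x ^ 4" by algebra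
    finally show ?thesis by (simp add: algebra_simps)
  qed
  ultimately show ?thesis by (simp add: d)
qed

definition speed :: "real \<Rightarrow> real" where
  "speed w = thr_rad \<sigma> a w ^ 4 / (2 * M * thr_root M \<sigma> a w) * thr_prof M (thr_rad \<sigma> a w)"

lemma speed_pos: "w \<in> throat_dom \<sigma> a \<Longrightarrow> speed w > 0"
  unfolding speed_def using rad_pos root_pos prof_pos M_pos
  by (intro mult_pos_pos divide_pos_pos zero_less_power) auto

lemma DERIV_leafU: "w \<in> throat_dom \<sigma> a \<Longrightarrow>
    (leafU M \<sigma> a has_real_derivative speed w * exp (- (throat_energy M a * thr_int M \<sigma> a w))) (at w)"
  using DERIV_leaf_aux[of w "-1"] by (simp add: leafU_def[abs_def] speed_def)

lemma DERIV_leafV: "w \<in> throat_dom \<sigma> a \<Longrightarrow>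
    (leafV M \<sigma> a has_real_derivative speed w * exp (throat_energy M a * thr_int M \<sigma> a w)) (at w)"
  using DERIV_leaf_aux[of w 1] by (simp add: leafV_def[abs_def] speed_def)

lemma leaf_product:
  assumes w: "w \<in> throat_dom \<sigma> a"
  shows "leafU M \<sigma> a w * leafV M \<sigma> a w = (thr_rad \<sigma> a w - 2 * M) * exp (thr_rad \<sigma> a w / (2 * M))"
proof -
  define x y c p where d: "x = thr_rad \<sigma> a w" "y = \<sigma> * w * thr_root M \<sigma> a w"
    "c = throat_energy M a" "p = thr_prof M (thr_rad \<sigma> a w)"
  have "leafU M \<sigma> a w * leafV M \<sigma> a w = (y\<^sup>2 - c\<^sup>2) * p\<^sup>2 *
      (exp (- (throat_energy M a * thr_int M \<sigma> a w)) * exp (throat_energy M a * thr_int M \<sigma> a w))"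
    unfolding leafU_def leafV_def d by algebra
  also have "\<dots> = x ^ 3 * (x - 2 * M) * p\<^sup>2"
    using energy_relation[OF w] by (simp add: d flip: exp_add)
  finally show ?thesis using rad_pos[OF w] prof_square[OF rad_pos[OF w]] by (simp add: d)
qed

lemma leaf_kruskal: "w \<in> throat_dom \<sigma> a \<Longrightarrow> leafU M \<sigma> a w * leafV M \<sigma> a w > - 2 * M"
  using area_fun_strict_mono[OF M_pos, of 0 "thr_rad \<sigma> a w"] rad_pos leaf_product by simp

lemma leaf_area_radius: "w \<in> throat_dom \<sigma> a \<Longrightarrow> area_radius M (leafU M \<sigma> a w) (leafV M \<sigma> a w) = thr_rad \<sigma> a w"
  by (rule area_radius_eqI) (simp_all add: M_pos rad_pos leaf_product)

lemma smooth_leaf: "smooth_on_open (throat_dom \<sigma> a) (leafU M \<sigma> a)" "smooth_on_open (throat_dom \<sigma> a) (leafV M \<sigma> a)"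
proof -
  have 1: "smooth_on_open (throat_dom \<sigma> a) (thr_int M \<sigma> a)"
    by (rule smooth_on_openI[OF dom_open DERIV_int smooth_dens])
  have 2: "smooth_on_open (throat_dom \<sigma> a) (\<lambda>w. thr_prof M (thr_rad \<sigma> a w))"
    unfolding thr_prof_def
    by (intro smooth_intros dom_open smooth_rad) (use rad_pos M_pos in \<open>auto simp: less_imp_neq[symmetric]\<close>)
  show "smooth_on_open (throat_dom \<sigma> a) (leafU M \<sigma> a)" "smooth_on_open (throat_dom \<sigma> a) (leafV M \<sigma> a)"
    unfolding leafU_def[abs_def] leafV_def[abs_def]
    by (intro smooth_intros dom_open smooth_root 1 2)+
qed

lemma DERIV_speed: "\<exists>d. (speed has_real_derivative d) (at w)" if w: "w \<in> throat_dom \<sigma> a"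
proof -
  have "smooth_on_open (throat_dom \<sigma> a) speed"
    unfolding speed_def[abs_def] thr_prof_def
    by (intro smooth_intros dom_open smooth_rad smooth_root)
       (use rad_pos root_pos M_pos in \<open>auto simp: less_imp_neq[symmetric]\<close>)
  then show ?thesis
    using w unfolding smooth_on_open_def by (metis DERIV_deriv_iff_real_differentiable funpow_0)
qed

text \<open>With \<open>K = C * J\<close> the exponentials cancel and
  \<open>V * exp (- K) - U * exp K = 2 * C * N\<close>. Since
  \<open>N\<^sup>2 * exp (- x / (2 * M)) = 1 / x ^ 3\<close>, the rapidity equation becomes an
  algebraic identity between \<open>speed\<close> and \<open>thr_dens\<close>.\<close>

lemma maximal_leaf:
  "spacelike_maximal_hypersurface M ((\<lambda>w. (leafU M \<sigma> a w, leafV M \<sigma> a w)) ` throat_dom \<sigma> a)"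
  "spacelike_maximal_hypersurface M (prod.swap ` (\<lambda>w. (leafU M \<sigma> a w, leafV M \<sigma> a w)) ` throat_dom \<sigma> a)"
proof -
  obtain P' where P': "\<And>w. w \<in> throat_dom \<sigma> a \<Longrightarrow> (speed has_real_derivative P' w) (at w)"
    using DERIV_speed by metis
  have K': "((\<lambda>w. throat_energy M a * thr_int M \<sigma> a w) has_real_derivative throat_energy M a * thr_dens M \<sigma> a w) (at w)"
    if "w \<in> throat_dom \<sigma> a" for w
    using DERIV_cmult[OF DERIV_int[OF that]] .
  have eq: "2 * (throat_energy M a * thr_dens M \<sigma> a w) = speed w * (6 * M - thr_rad \<sigma> a w) / (thr_rad \<sigma> a w)\<^sup>2
     * exp (- thr_rad \<sigma> a w / (2 * M)) *
     (leafV M \<sigma> a w * exp (- (throat_energy M a * thr_int M \<sigma> a w))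
       - leafU M \<sigma> a w * exp (throat_energy M a * thr_int M \<sigma> a w))" if w: "w \<in> throat_dom \<sigma> a" for w
  proof -
    define x y c p s K where d: "x = thr_rad \<sigma> a w" "y = \<sigma> * w * thr_root M \<sigma> a w"
      "c = throat_energy M a" "p = thr_prof M (thr_rad \<sigma> a w)" "s = thr_root M \<sigma> a w"
      "K = throat_energy M a * thr_int M \<sigma> a w"
    have pos: "x > 0" "s > 0" "M > 0" using rad_pos[OF w] root_pos[OF w] M_pos by (auto simp: d)
    have "leafV M \<sigma> a w * exp (- K) - leafU M \<sigma> a w * exp K = (y + c) * p * (exp K * exp (- K)) - (y - c) * p * (exp K * exp (- K))"
      unfolding leafU_def leafV_def d by algebra
    then have "leafV M \<sigma> a w * exp (- K) - leafU M \<sigma> a w * exp K = 2 * c * p"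
      by (simp add: algebra_simps flip: exp_add)
    then have "speed w * (6 * M - x) / x\<^sup>2 * exp (- x / (2 * M)) * (leafV M \<sigma> a w * exp (- K) - leafU M \<sigma> a w * exp K)
      = x\<^sup>2 / (M * s) * (6 * M - x) * c * (p\<^sup>2 * exp (- x / (2 * M)))"
      using pos d(4)[folded d(1)] unfolding speed_def d(1,5)[symmetric]
      by (simp add: field_simps power2_eq_square power4_eq_xxxx)
    also have "p\<^sup>2 * exp (- x / (2 * M)) = 1 / x ^ 3 * (exp (x / (2 * M)) * exp (- x / (2 * M)))"
      using prof_square[OF rad_pos[OF w]] by (simp add: d)
    also have "\<dots> = 1 / x ^ 3" by (simp flip: exp_add)
    also have "x\<^sup>2 / (M * s) * (6 * M - x) * c * (1 / x ^ 3) = 2 * (throat_energy M a * thr_dens M \<sigma> a w)"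
      using pos by (simp add: thr_dens_def field_simps power2_eq_square power3_eq_cube flip: d(1,3,5))
    finally show ?thesis by (simp add: d)
  qed
  note * = M_pos dom_open dom_connected _ smooth_leaf DERIV_leafU DERIV_leafV speed_pos P' K' rad_pos leaf_product[symmetric] eq
  show "spacelike_maximal_hypersurface M ((\<lambda>w. (leafU M \<sigma> a w, leafV M \<sigma> a w)) ` throat_dom \<sigma> a)"
    by (rule maximal_curveI[OF *]) (use dom_0 in auto)
  show "spacelike_maximal_hypersurface M (prod.swap ` (\<lambda>w. (leafU M \<sigma> a w, leafV M \<sigma> a w)) ` throat_dom \<sigma> a)"
    by (rule maximal_curveI_swap[OF *]) (use dom_0 in auto)
qed

end

section \<open>Half of a leaf as a function of the area radius\<close>

context throat
begin

lemma energy_pos: "a < 2 * M \<Longrightarrow> throat_energy M a > 0"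
  using a_pos by (simp add: throat_energy_def)

text \<open>For \<open>\<sigma> = - 1\<close> the summand \<open>y\<close> is not positive, but the
  radius stays below \<open>2 * M\<close>, where \<open>y\<^sup>2 < C\<^sup>2\<close>.\<close>

lemma leafV_pos:
  assumes w: "w \<in> throat_dom \<sigma> a" "w \<ge> 0" and a: "a < 2 * M"
  shows "leafV M \<sigma> a w > 0"
proof -
  have "\<sigma> * w * thr_root M \<sigma> a w + throat_energy M a > 0"
  proof (cases "\<sigma> = 1")
    case True
    then show ?thesis using energy_pos[OF a] w root_pos[OF w(1)] by (simp add: add_nonneg_pos)
  next
    case False
    then have "thr_rad \<sigma> a w = a - w\<^sup>2" using sigma by (auto simp: thr_rad_def)
    moreover have "w\<^sup>2 \<ge> 0" by simp
    ultimately have "thr_rad \<sigma> a w < 2 * M" using a by linarith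
    then have "(\<sigma> * w * thr_root M \<sigma> a w)\<^sup>2 < (throat_energy M a)\<^sup>2"
      unfolding energy_relation[OF w(1)] using rad_pos[OF w(1)] by (simp add: mult_pos_neg)
    then have "\<bar>\<sigma> * w * thr_root M \<sigma> a w\<bar> < throat_energy M a"
      using energy_pos[OF a] abs_square_less_1 power2_less_imp_less[of "\<bar>\<sigma> * w * thr_root M \<sigma> a w\<bar>" "throat_energy M a"] by simp
    then show ?thesis by linarith
  qed
  then show ?thesis using prof_pos[OF rad_pos[OF w(1)]] by (simp add: leafV_def)
qed

lemma leafV_0: "leafV M \<sigma> a 0 = sqrt (2 * M - a) * exp (a / (4 * M))"
proof -
  have "throat_energy M a = a * sqrt a * sqrt (2 * M - a)"
    using a_pos by (simp add: throat_energy_def real_sqrt_mult power3_eq_cube)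
  then show ?thesis
    using a_pos by (simp add: leafV_def thr_rad_def thr_prof_def int_0)
qed

lemma rad_sqrt: "\<sigma> * (r - a) \<ge> 0 \<Longrightarrow> thr_rad \<sigma> a (sqrt (\<sigma> * (r - a))) = r"
  using sigma by (auto simp: thr_rad_def)

lemma sqrt_dom: "r > 0 \<Longrightarrow> \<sigma> * (r - a) \<ge> 0 \<Longrightarrow> sqrt (\<sigma> * (r - a)) \<in> throat_dom \<sigma> a"
  using rad_sqrt by (simp add: throat_dom_def)

lemma D_eq_square:
  assumes "r > 0" "\<sigma> * (r - a) \<ge> 0"
  shows "D M (throat_energy M a) r = (sqrt (\<sigma> * (r - a)) * thr_root M \<sigma> a (sqrt (\<sigma> * (r - a))))\<^sup>2"
  using energy_relation[OF sqrt_dom[OF assms]] rad_sqrt[OF assms(2)] sigma by (auto simp: D_def)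

lemma sqrt_D_eq:
  assumes "r > 0" "\<sigma> * (r - a) \<ge> 0"
  shows "sqrt (D M (throat_energy M a) r) = sqrt (\<sigma> * (r - a)) * thr_root M \<sigma> a (sqrt (\<sigma> * (r - a)))"
  unfolding D_eq_square[OF assms] using root_pos[OF sqrt_dom[OF assms]] assms by simp

text \<open>On the half \<open>w \<ge> 0\<close> one has \<open>y = \<sigma> * sqrt D\<close>, so
  the denominator is \<open>4 * M * y * (y + C)\<close>. This links the closed form with the
  integrals that define the hypersurfaces; for \<open>\<sigma> = 1\<close> it is the integrand of
  \<open>V_plus\<close> up to the factor \<open>4 * M\<close>.\<close>

lemma DERIV_ln_leafV:
  assumes a: "a < 2 * M" and r: "r > 0" "\<sigma> * (r - a) > 0"
  defines "C \<equiv> throat_energy M a"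
  shows "((\<lambda>r. ln (leafV M \<sigma> a (sqrt (\<sigma> * (r - a))))) has_real_derivative
     r ^ 4 / (4 * M * (D M C r + \<sigma> * C * sqrt (D M C r)))) (at r)"
proof -
  define w s p E where d: "w = sqrt (\<sigma> * (r - a))" "s = thr_root M \<sigma> a w" "p = thr_prof M r"
    "E = exp (throat_energy M a * thr_int M \<sigma> a w)"
  have w: "w \<in> throat_dom \<sigma> a" "w > 0" "thr_rad \<sigma> a w = r" using sqrt_dom rad_sqrt r by (auto simp: d)
  have pos: "s > 0" "p > 0" "E > 0" "M > 0" "w > 0" using root_pos[OF w(1)] prof_pos r M_pos w by (auto simp: d)
  have V: "leafV M \<sigma> a w = (\<sigma> * w * s + C) * p * E" using w by (simp add: leafV_def C_def d)
  with leafV_pos[OF w(1) _ a] w have yc: "\<sigma> * w * s + C > 0" using pos by (simp add: zero_less_mult_iff)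
  have "((\<lambda>r. sqrt (\<sigma> * (r - a))) has_real_derivative \<sigma> / (2 * w)) (at r)"
    using r by (auto intro!: derivative_eq_intros simp: d field_simps)
  from DERIV_chain2[OF DERIV_leafV[OF w(1), unfolded d(1)] this]
  have "((\<lambda>r. leafV M \<sigma> a (sqrt (\<sigma> * (r - a)))) has_real_derivative speed w * E * (\<sigma> / (2 * w))) (at r)"
    unfolding d .
  from DERIV_chain2[OF DERIV_ln_divide this] leafV_pos[OF w(1) _ a] w
  have "((\<lambda>r. ln (leafV M \<sigma> a (sqrt (\<sigma> * (r - a))))) has_real_derivative
     1 / leafV M \<sigma> a w * (r ^ 4 / (2 * M * s) * p * E * (\<sigma> / (2 * w)))) (at r)"
    by (simp add: speed_def d)
  moreover have "1 / leafV M \<sigma> a w * (r ^ 4 / (2 * M * s) * p * E * (\<sigma> / (2 * w))) =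
     r ^ 4 / (4 * M * ((w * s)\<^sup>2 + \<sigma> * C * (w * s)))"
  proof -
    have "\<sigma> * (\<sigma> * w * s + C) = w * s + \<sigma> * C" using sigma by auto
    then have eq: "(w * s)\<^sup>2 + \<sigma> * C * (w * s) = \<sigma> * (w * s) * (\<sigma> * w * s + C)"
      by (simp add: power2_eq_square algebra_simps)
    define Y where "Y = \<sigma> * w * s + C"
    have "Y > 0" using yc by (simp add: Y_def)
    then show ?thesis unfolding V eq unfolding Y_def[symmetric] using pos sigma by (auto simp: field_simps)
  qed
  ultimately show ?thesis
    using D_eq_square[OF r(1)] sqrt_D_eq[OF r(1)] r by (simp add: C_def d)
qed

lemma continuous_leafV_radius:
  "continuous_on {r. r > 0 \<and> \<sigma> * (r - a) \<ge> 0} (\<lambda>r. leafV M \<sigma> a (sqrt (\<sigma> * (r - a))))"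
  by (rule continuous_on_compose2[OF smooth_imp_continuous[OF smooth_leaf(2)]])
     (use sqrt_dom in \<open>auto intro!: continuous_intros\<close>)

lemma continuous_ln_leafV:
  assumes "a < 2 * M"
  shows "continuous_on {r. r > 0 \<and> \<sigma> * (r - a) \<ge> 0} (\<lambda>r. ln (leafV M \<sigma> a (sqrt (\<sigma> * (r - a)))))"
  by (rule continuous_on_ln[OF continuous_leafV_radius])
     (use leafV_pos[OF sqrt_dom _ assms] in force)

lemma leafU_eq:
  assumes "a < 2 * M" "r > 0" "\<sigma> * (r - a) \<ge> 0"
  defines "w \<equiv> sqrt (\<sigma> * (r - a))"
  shows "leafU M \<sigma> a w = (r - 2 * M) * exp (r / (2 * M)) / leafV M \<sigma> a w"
  using leaf_product[OF sqrt_dom[OF assms(2,3)]] leafV_pos[OF sqrt_dom[OF assms(2,3)] _ assms(1)] rad_sqrt[OF assms(3)]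
    assms(3) by (simp add: w_def field_simps)

text \<open>The radii from the throat onwards correspond to \<open>w \<ge> 0\<close>, and
  \<open>rho\<close> supplies \<open>w \<le> 0\<close>; the two halves thus join to one curve that
  is smooth also at the throat.\<close>

lemma symmetrize_half:
  "symmetrize ((\<lambda>r. (leafU M \<sigma> a (sqrt (\<sigma> * (r - a))), leafV M \<sigma> a (sqrt (\<sigma> * (r - a))))) ` {r. r > 0 \<and> \<sigma> * (r - a) \<ge> 0})
   = (\<lambda>w. (leafU M \<sigma> a w, leafV M \<sigma> a w)) ` throat_dom \<sigma> a"
proof -
  let ?f = "\<lambda>w. (leafU M \<sigma> a w, leafV M \<sigma> a w)"
  have half: "(\<lambda>r. sqrt (\<sigma> * (r - a))) ` {r. r > 0 \<and> \<sigma> * (r - a) \<ge> 0} = throat_dom \<sigma> a \<inter> {0..}"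
  proof (intro equalityI subsetI)
    fix w assume w: "w \<in> throat_dom \<sigma> a \<inter> {0..}"
    then show "w \<in> (\<lambda>r. sqrt (\<sigma> * (r - a))) ` {r. r > 0 \<and> \<sigma> * (r - a) \<ge> 0}"
      using rad_pos[of w] rad_side[of w] by (intro image_eqI[of _ _ "thr_rad \<sigma> a w"]) auto
  qed (use sqrt_dom in auto)
  have "rho (?f w) = ?f (- w)" for w by (simp add: rho_def leafU_minus leafV_minus)
  then have "rho ` ?f ` (throat_dom \<sigma> a \<inter> {0..}) = ?f ` uminus ` (throat_dom \<sigma> a \<inter> {0..})"
    by (simp add: image_image)
  also have "uminus ` (throat_dom \<sigma> a \<inter> {0..}) = throat_dom \<sigma> a \<inter> {..0}"
    using dom_minus by (auto intro!: image_eqI[of _ uminus "- w" for w])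
  finally have "rho ` ?f ` (throat_dom \<sigma> a \<inter> {0..}) = ?f ` (throat_dom \<sigma> a \<inter> {..0})" .
  moreover have "throat_dom \<sigma> a = throat_dom \<sigma> a \<inter> {0..} \<union> throat_dom \<sigma> a \<inter> {..0}" by auto
  ultimately show ?thesis
    unfolding symmetrize_def using half image_image[of ?f "\<lambda>r. sqrt (\<sigma> * (r - a))"]
    by (metis (no_types, lifting) image_Un)
qed

end

section \<open>Throat radii\<close>

text \<open>Lets the throat radius replace \<open>c\<close> as the parameter of the family:
  \<open>c = - throat_energy M a\<close>.\<close>

lemma k0_eq: assumes "0 < x" "x \<le> 2 * M" shows "k0 M x = - throat_energy M x"
proof -
  have "x powr (3/2) = sqrt (x ^ 3)"
    using assms powr_powr[of x 3 "1/2"] by (simp add: powr_half_sqrt)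
  then show ?thesis
    using assms by (simp add: k0_def throat_energy_def powr_half_sqrt real_sqrt_mult)
qed

lemma DERIV_energy_arg: "((\<lambda>x. x ^ 3 * (2 * M - x)) has_real_derivative 2 * x\<^sup>2 * (3 * M - 2 * x)) (at x)" for x M :: real
  by (auto intro!: derivative_eq_intros simp: algebra_simps power2_eq_square power3_eq_cube)

lemma throat_energy_less1:
  assumes "0 \<le> x" "x < y" "y \<le> 3 * M / 2"
  shows "throat_energy M x < throat_energy M y"
proof -
  have "x ^ 3 * (2 * M - x) < y ^ 3 * (2 * M - y)"
    by (rule DERIV_pos_imp_increasing_open[where f="\<lambda>x. x ^ 3 * (2 * M - x)", OF assms(2)])
       (use assms DERIV_energy_arg[of M] in \<open>auto intro!: continuous_intros exI conjI\<close>)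
  then show ?thesis by (simp add: throat_energy_def)
qed

lemma throat_energy_less2:
  assumes "0 < M" "3 * M / 2 \<le> x" "x < y"
  shows "throat_energy M y < throat_energy M x"
proof -
  have "y ^ 3 * (2 * M - y) < x ^ 3 * (2 * M - x)"
    by (rule DERIV_neg_imp_decreasing_open[where f="\<lambda>x. x ^ 3 * (2 * M - x)", OF assms(3)])
       (use assms DERIV_energy_arg[of M] in \<open>auto intro!: continuous_intros exI conjI mult_pos_neg\<close>)
  then show ?thesis by (simp add: throat_energy_def)
qed

context
  fixes M :: real
  assumes M: "M > 0"
begin

lemma throat_energy_less: "0 \<le> x \<Longrightarrow> x \<noteq> 3 * M / 2 \<Longrightarrow> throat_energy M x < throat_energy M (3 * M / 2)"
  using throat_energy_less1[of x "3 * M / 2" M] throat_energy_less2[OF M, of "3 * M / 2" x]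
  by (cases x "3 * M / 2" rule: linorder_cases) auto

lemma throat_energy_le: "0 \<le> x \<Longrightarrow> throat_energy M x \<le> throat_energy M (3 * M / 2)"
  by (cases "x = 3 * M / 2") (simp only: order_refl, rule less_imp_le[OF throat_energy_less])

lemma r0_eq: "r0 M = 3 * M / 2"
  unfolding r0_def
proof (rule the_equality)
  show "3 * M / 2 \<in> {0<..<2 * M} \<and> (\<forall>x\<in>{0<..<2 * M}. k0 M (3 * M / 2) \<le> k0 M x)"
    using M throat_energy_le by (auto simp: k0_eq)
next
  fix r assume r: "r \<in> {0<..<2 * M} \<and> (\<forall>x\<in>{0<..<2 * M}. k0 M r \<le> k0 M x)"
  then have "k0 M r \<le> k0 M (3 * M / 2)" using M by auto
  then show "r = 3 * M / 2"
    using throat_energy_less[of r] M r k0_eq[of r M] k0_eq[of "3 * M / 2" M] by fastforce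
qed

lemma R0_eq: "R0 M = 3 * M / 2"
  using r0_eq by (simp add: R0_def r0_def k0t_def)

lemma c0_eq: "c0 M = - throat_energy M (3 * M / 2)"
  and C0_eq: "C0 M = throat_energy M (3 * M / 2)"
  using M by (simp_all add: c0_def C0_def r0_eq R0_eq k0t_def k0_eq)

lemma r_minus_eq:
  assumes "0 < a" "a < 3 * M / 2"
  shows "r_minus M (- throat_energy M a) = a"
  unfolding r_minus_def r0_eq
proof (rule the_equality)
  fix r assume "r \<in> {0<..<3 * M / 2} \<and> k0 M r = - throat_energy M a"
  then show "r = a"
    using throat_energy_less1[of r a M] throat_energy_less1[of a r M] assms
    by (cases r a rule: linorder_cases) (auto simp: k0_eq)
qed (use assms in \<open>auto simp: k0_eq\<close>)

lemma r_plus_eq: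
  assumes "3 * M / 2 < a" "a < 2 * M"
  shows "r_plus M (- throat_energy M a) = a"
  unfolding r_plus_def r0_eq
proof (rule the_equality)
  fix r assume "r \<in> {3 * M / 2<..<2 * M} \<and> k0 M r = - throat_energy M a"
  then show "r = a"
    using throat_energy_less2[OF M, of r a] throat_energy_less2[OF M, of a r] assms M
    by (cases r a rule: linorder_cases) (auto simp: k0_eq)
qed (use assms M in \<open>auto simp: k0_eq\<close>)

lemma rt_eq: "rt_plus M c = r_minus M (- c)" "rt_minus M c = r_plus M (- c)"
proof -
  have "k0t M r = c \<longleftrightarrow> k0 M r = - c" for r by (auto simp: k0t_def)
  then show "rt_plus M c = r_minus M (- c)" "rt_minus M c = r_plus M (- c)"
    by (simp_all add: rt_plus_def r_minus_def rt_minus_def r_plus_def r0_eq R0_eq)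
qed

lemma continuous_throat_energy: "continuous_on S (throat_energy M)"
  unfolding throat_energy_def[abs_def] by (intro continuous_intros)

lemma throat_energy_onto_minus:
  assumes "0 < C" "C < throat_energy M (3 * M / 2)"
  obtains a where "0 < a" "a < 3 * M / 2" "throat_energy M a = C"
proof -
  have 0: "throat_energy M 0 = 0" by (simp add: throat_energy_def)
  then obtain a where a: "0 \<le> a" "a \<le> 3 * M / 2" "throat_energy M a = C"
    using IVT'[of "throat_energy M" 0 C "3 * M / 2"] continuous_throat_energy assms M by auto
  have "a \<noteq> 0" "a \<noteq> 3 * M / 2"
    using a(3) assms 0 by (metis less_irrefl)+
  with a show ?thesis by (intro that[of a]) linarith+
qed

lemma throat_energy_onto_plus:
  assumes "0 < C" "C < throat_energy M (3 * M / 2)"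
  obtains a where "3 * M / 2 < a" "a < 2 * M" "throat_energy M a = C"
proof -
  have 0: "throat_energy M (2 * M) = 0" by (simp add: throat_energy_def)
  then obtain a where a: "3 * M / 2 \<le> a" "a \<le> 2 * M" "throat_energy M a = C"
    using IVT2'[of "throat_energy M" "2 * M" C "3 * M / 2"] continuous_throat_energy assms M by auto
  have "a \<noteq> 2 * M" "a \<noteq> 3 * M / 2"
    using a(3) assms 0 by (metis less_irrefl)+
  with a show ?thesis by (intro that[of a]) linarith+
qed

lemma throat_minus: "0 < a \<Longrightarrow> a < 3 * M / 2 \<Longrightarrow> throat M (- 1) a"
  and throat_plus: "3 * M / 2 < a \<Longrightarrow> a \<le> 2 * M \<Longrightarrow> throat M 1 a"
  using M by unfold_locales auto

text \<open>Both sides have the same logarithmic derivative beyond the throat and the same value at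
  it. The integrand is unbounded at the lower limit, where \<open>D\<close> vanishes, hence the
  fundamental theorem with derivatives in the interior only.\<close>

lemma V_plus_eq:
  assumes a: "3 * M / 2 < a" "a < 2 * M" and r: "a \<le> r"
  shows "V_plus M (- throat_energy M a) r = leafV M 1 a (sqrt (r - a))"
proof -
  interpret throat M 1 a using throat_plus a by simp
  define C where "C = throat_energy M a"
  define L where "L = (\<lambda>r. ln (leafV M 1 a (sqrt (r - a))))"
  have V: "leafV M 1 a (sqrt (r - a)) > 0" if "a \<le> r" for r
    using leafV_pos[of "sqrt (r - a)"] sqrt_dom[of r] that a_pos a by simp
  have "((\<lambda>x. x ^ 4 / (D M C x + C * sqrt (D M C x))) has_integral (4 * M * L r - 4 * M * L a)) {a..r}"
  proof (rule fundamental_theorem_of_calculus_interior[OF r])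
    show "continuous_on {a..r} (\<lambda>r. 4 * M * L r)"
    proof -
      have "continuous_on {a..r} L"
        using continuous_on_subset[OF continuous_ln_leafV[OF a(2)], of "{a..r}"] a_pos by (force simp: L_def)
      then show ?thesis by (rule continuous_on_mult_left)
    qed
    fix x assume "x \<in> {a<..<r}"
    then have "(L has_real_derivative x ^ 4 / (4 * M * (D M C x + C * sqrt (D M C x)))) (at x)"
      using DERIV_ln_leafV[OF a(2), of x] a_pos by (simp add: L_def C_def)
    from DERIV_cmult[OF this, of "4 * M"]
    show "((\<lambda>r. 4 * M * L r) has_vector_derivative x ^ 4 / (D M C x + C * sqrt (D M C x))) (at x)"
      using M by (simp add: has_real_derivative_iff_has_vector_derivative)
  qed
  then have "integral {a..r} (\<lambda>x. x ^ 4 / (D M C x + C * sqrt (D M C x))) = 4 * M * L r - 4 * M * L a"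
    by (rule integral_unique)
  moreover have "D M (- C) x = D M C x" for x by (simp add: D_def)
  moreover have "4 * M * L a = a + 2 * M * ln (2 * M - a)"
    using a M by (simp add: L_def leafV_0 ln_mult ln_sqrt algebra_simps)
  moreover have "\<bar>a - 2 * M\<bar> = 2 * M - a" using a by simp
  ultimately have "V_plus M (- C) r = exp (1 / (4 * M) * (4 * M * L r))"
    using r_plus_eq[OF a] unfolding V_plus_def C_def[symmetric] by simp
  then show ?thesis using V[OF r] M by (simp add: L_def C_def)
qed

lemma t_minus_eq:
  assumes a: "0 < a" "a < 3 * M / 2" and r: "0 < r" "r \<le> a"
  shows "t_minus M (- throat_energy M a) r =
    4 * M * ln (leafV M (- 1) a (sqrt (a - r))) - r - 2 * M * ln (2 * M - r)"
proof -
  interpret throat M "- 1" a using throat_minus a by simp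
  define C where "C = throat_energy M a"
  \<comment> \<open>The function \<open>t\<close> as obtained by solving the defining formula for
    \<open>V\<close>. It vanishes at the throat by \<open>leafV_0\<close>, like the
    integral.\<close>
  define G where "G = (\<lambda>r. 4 * M * ln (leafV M (- 1) a (sqrt (a - r))) - r - 2 * M * ln (2 * M - r))"
  have a2: "a < 2 * M" using a M by simp
  have "((\<lambda>x. x / (x - 2 * M) * (C / sqrt (D M C x))) has_integral (G a - G r)) {r..a}"
  proof (rule fundamental_theorem_of_calculus_interior[OF r(2)])
    show "continuous_on {r..a} G"
    proof -
      have "continuous_on {r..a} (\<lambda>r. ln (leafV M (- 1) a (sqrt (a - r))))"
        using continuous_on_subset[OF continuous_ln_leafV[OF a2], of "{r..a}"] r by force
      then show ?thesis
        unfolding G_def using a2 by (intro continuous_on_diff continuous_on_mult_left) (auto intro!: continuous_intros)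
    qed
    fix x assume x: "x \<in> {r<..<a}"
    define s where "s = sqrt (D M C x)"
    have s: "s > 0" "s\<^sup>2 = D M C x"
      using sqrt_D_eq[of x] D_eq_square[of x] root_pos[OF sqrt_dom[of x]] x r
      by (auto simp: C_def s_def)
    have xs: "x ^ 3 * (x - 2 * M) = (s - C) * (s + C)"
      using s(2) by (simp add: D_def algebra_simps power2_eq_square)
    have "(s - C) * (s + C) < 0" using x r a2 unfolding xs[symmetric] by (simp add: mult_pos_neg)
    then have sC: "s - C \<noteq> 0" by auto
    have "((\<lambda>r. ln (leafV M (- 1) a (sqrt (a - r)))) has_real_derivative x ^ 4 / (4 * M * (s\<^sup>2 - C * s))) (at x)"
      using DERIV_ln_leafV[OF a2, of x] x r by (simp add: C_def[symmetric] s_def[symmetric] s(2))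
    then have "(G has_real_derivative 4 * M * (x ^ 4 / (4 * M * (s\<^sup>2 - C * s))) - 1 + 2 * M / (2 * M - x)) (at x)"
    proof -
      have "((\<lambda>r. 4 * M * l r - r - 2 * M * ln (2 * M - r)) has_real_derivative
          4 * M * l' - 1 + 2 * M / (2 * M - x)) (at x)" if "(l has_real_derivative l') (at x)" for l l'
        using x a2 that by (auto intro!: derivative_eq_intros)
      from this[OF \<open>(_ has_real_derivative x ^ 4 / (4 * M * (s\<^sup>2 - C * s))) (at x)\<close>]
      show ?thesis unfolding G_def .
    qed
    moreover have "4 * M * (x ^ 4 / (4 * M * (s\<^sup>2 - C * s))) - 1 + 2 * M / (2 * M - x) = x / (x - 2 * M) * (C / s)"
    proof -
      have "s\<^sup>2 - C * s = s * (s - C)" by (simp add: power2_eq_square algebra_simps)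
      then have "x ^ 4 / (s\<^sup>2 - C * s) = x ^ 4 * (x - 2 * M) / (s * (s - C) * (x - 2 * M))"
        using x a2 by simp
      also have "x ^ 4 * (x - 2 * M) = x * ((s - C) * (s + C))"
        unfolding xs[symmetric] by (simp add: power4_eq_xxxx power3_eq_cube)
      also have "\<dots> / (s * (s - C) * (x - 2 * M)) = x * (s + C) / (s * (x - 2 * M))"
        using sC by simp
      finally have 1: "x ^ 4 / (s\<^sup>2 - C * s) = x * (s + C) / (s * (x - 2 * M))" .
      have 2: "4 * M * (x ^ 4 / (4 * M * (s\<^sup>2 - C * s))) = x ^ 4 / (s\<^sup>2 - C * s)" using M by simp
      have ne: "x - 2 * M \<noteq> 0" "2 * M - x \<noteq> 0" using x a2 by auto
      have 3: "2 * M / (2 * M - x) = - (2 * M / (x - 2 * M))" using ne by (simp add: field_simps)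
      have "x * (s + C) / (s * (x - 2 * M)) - 1 + - (2 * M / (x - 2 * M)) =
          (x * (s + C) - s * (x - 2 * M) - 2 * M * s) / (s * (x - 2 * M))"
        using s(1) ne(1) by (simp add: diff_divide_distrib)
      also have "x * (s + C) - s * (x - 2 * M) - 2 * M * s = x * C" by algebra
      finally show ?thesis unfolding 2 1 3 by (simp add: mult.commute)
    qed
    ultimately show "(G has_vector_derivative x / (x - 2 * M) * (C / sqrt (D M C x))) (at x)"
      by (simp add: has_real_derivative_iff_has_vector_derivative s_def)
  qed
  then have "integral {r..a} (\<lambda>x. x / (x - 2 * M) * (C / sqrt (D M C x))) = G a - G r"
    by (rule integral_unique)
  moreover have "D M (- C) x = D M C x" for x by (simp add: D_def)
  moreover have "G a = 0"
    using a2 M by (simp add: G_def leafV_0 ln_mult ln_sqrt algebra_simps)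
  ultimately show ?thesis
    using r_minus_eq[OF a] unfolding t_minus_def C_def[symmetric] by (simp add: G_def)
qed

end

section \<open>Hypersurfaces through different throats do not meet\<close>

lemma DERIV_D: "(D M C has_real_derivative 2 * x\<^sup>2 * (2 * x - 3 * M)) (at x)"
  unfolding D_def[abs_def]
  by (auto intro!: derivative_eq_intros simp: algebra_simps power2_eq_square power3_eq_cube)

lemma DERIV_sqrt_D:
  assumes "D M C x > 0"
  shows "((\<lambda>x. sqrt (D M C x)) has_real_derivative x\<^sup>2 * (2 * x - 3 * M) / sqrt (D M C x)) (at x)"
proof -
  define s where "s = sqrt (D M C x)"
  have "s \<noteq> 0" using assms by (simp add: s_def)
  have "((\<lambda>x. sqrt (D M C x)) has_real_derivative inverse s / 2 * (2 * x\<^sup>2 * (2 * x - 3 * M))) (at x)"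
    using DERIV_chain2[OF DERIV_real_sqrt[OF assms] DERIV_D] by (simp only: s_def)
  then show ?thesis
    unfolding s_def[symmetric] by (rule DERIV_cong) (use \<open>s \<noteq> 0\<close> in \<open>simp add: field_simps\<close>)
qed

lemma DERIV_ln_sqrt_D:
  assumes "D M C x > 0" "C > 0"
  defines "s \<equiv> sqrt (D M C x)"
  shows "((\<lambda>x. ln (C + sqrt (D M C x))) has_real_derivative x\<^sup>2 * (2 * x - 3 * M) / (s * (C + s))) (at x)"
proof -
  have "C + sqrt (D M C x) > 0" using assms by (simp add: add_pos_pos)
  from DERIV_chain2[OF DERIV_ln_divide[OF this] DERIV_add[OF DERIV_const DERIV_sqrt_D[OF assms(1)]]]
  show ?thesis by (rule DERIV_cong) (simp add: s_def field_simps)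
qed

lemma continuous_D: "continuous_on S (D M C)"
  unfolding D_def[abs_def] by (intro continuous_intros)

text \<open>As functions of the area radius, the differences of \<open>4 * M * ln V\<close> between two leaves have derivative
  \<open>plus_weight\<close> times that of the differences of \<open>ln (C + sqrt D)\<close>. Integration by parts
  would settle monotonicity in \<open>C\<close> if \<open>plus_weight\<close> were decreasing, which fails for \<open>x > 3 * M\<close>; the summand
  \<open>C * sqrt D / x ^ 3 + (x - 2 * M) * ln (C + sqrt D)\<close>, an antiderivative of \<open>2 * sqrt D / x ^ 3\<close> with
  respect to \<open>C\<close>, repairs this.\<close>

definition plus_weight :: "real \<Rightarrow> real \<Rightarrow> real" where
  "plus_weight M x = x\<^sup>2 / (2 * x - 3 * M)"

definition plus_weight' :: "real \<Rightarrow> real \<Rightarrow> real" where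
  "plus_weight' M x = 2 * x * (x - 3 * M) / (2 * x - 3 * M)\<^sup>2"

lemma DERIV_plus_weight:
  "2 * x \<noteq> 3 * M \<Longrightarrow> (plus_weight M has_real_derivative plus_weight' M x) (at x)"
  unfolding plus_weight_def[abs_def] plus_weight'_def
  by (auto intro!: derivative_eq_intros simp: power2_eq_square algebra_simps)

text \<open>The part of the radial derivative of \<open>plus_comparison\<close> that depends on
  \<open>C\<close>.\<close>

definition excess :: "real \<Rightarrow> real \<Rightarrow> real \<Rightarrow> real" where
  "excess M x C = 3 * C * sqrt (D M C x) / x ^ 4 - (plus_weight' M x + 1) * ln (C + sqrt (D M C x))"

text \<open>This is \<open>sqrt D\<close> times the derivative of \<open>excess\<close> in
  \<open>C\<close>. Its part without \<open>C\<close> is a nonnegative multiple of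
  \<open>(3 * M - x)\<^sup>2\<close>: it touches zero at \<open>3 * M\<close>, where
  \<open>plus_weight'\<close> changes sign, and does not become negative.\<close>

lemma excess_derivative_nonneg:
  assumes "M > 0" "x > 3 * M / 2"
  shows "3 * (D M C x + C\<^sup>2) / x ^ 4 - (plus_weight' M x + 1) \<ge> 0"
proof -
  have x: "x > M" "x > 0" "2 * x - 3 * M > 0" using assms by auto
  have "3 * (D M C x + C\<^sup>2) / x ^ 4 = 3 * (x - 2 * M) / x + 6 * C\<^sup>2 / x ^ 4"
    using x by (simp add: D_def field_simps power4_eq_xxxx power3_eq_cube)
  moreover have "3 * (x - 2 * M) / x - (plus_weight' M x + 1) =
      6 * (3 * M - x)\<^sup>2 * (x - M) / (x * (2 * x - 3 * M)\<^sup>2)"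
  proof -
    define d where "d = 2 * x - 3 * M"
    have "d > 0" using x by (simp add: d_def)
    have "3 * (x - 2 * M) / x - (2 * x * (x - 3 * M) / d\<^sup>2 + 1) =
      (3 * (x - 2 * M) * d\<^sup>2 - 2 * x * (x - 3 * M) * x - x * d\<^sup>2) / (x * d\<^sup>2)"
      using x \<open>d > 0\<close> by (simp add: field_simps power2_eq_square)
    also have "3 * (x - 2 * M) * d\<^sup>2 - 2 * x * (x - 3 * M) * x - x * d\<^sup>2 = 6 * (3 * M - x)\<^sup>2 * (x - M)"
      unfolding d_def by algebra
    finally show ?thesis by (simp add: plus_weight'_def d_def)
  qed
  ultimately have "3 * (D M C x + C\<^sup>2) / x ^ 4 - (plus_weight' M x + 1) =
    6 * (3 * M - x)\<^sup>2 * (x - M) / (x * (2 * x - 3 * M)\<^sup>2) + 6 * C\<^sup>2 / x ^ 4" by simp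
  also have "\<dots> \<ge> 0" using x by (intro add_nonneg_nonneg divide_nonneg_nonneg mult_nonneg_nonneg) auto
  finally show ?thesis .
qed

text \<open>At the lower end \<open>D\<close> may vanish, namely when \<open>x\<close> is the throat
  of energy \<open>B\<close>, and there the formula for the derivative in \<open>C\<close> breaks
  down. So derivatives are taken in the open interval, with continuity up to its ends.\<close>

lemma excess_mono:
  assumes M: "M > 0" "x > 3 * M / 2" and C: "0 < B" "B \<le> C" and DB: "D M B x \<ge> 0"
  shows "excess M x B \<le> excess M x C"
proof (rule DERIV_nonneg_imp_increasing_open[OF C(2)])
  fix c assume c: "B < c" "c < C"
  then have "B\<^sup>2 < c\<^sup>2" using C by (simp add: power_strict_mono)
  then have Dc: "D M c x > 0" using DB by (simp add: D_def)
  define s where "s = sqrt (D M c x)"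
  have s: "s > 0" "s\<^sup>2 = D M c x" using Dc by (simp_all add: s_def)
  have "((\<lambda>c. D M c x) has_real_derivative 2 * c) (at c)"
    unfolding D_def by (auto intro!: derivative_eq_intros)
  from DERIV_chain2[OF DERIV_real_sqrt[OF Dc] this]
  have d1: "((\<lambda>c. sqrt (D M c x)) has_real_derivative c / s) (at c)"
    by (rule DERIV_cong) (simp add: s_def field_simps)
  have cs: "c + s > 0" using c C s by simp
  have d2: "((\<lambda>c. ln (c + sqrt (D M c x))) has_real_derivative 1 / s) (at c)"
    by (rule DERIV_cong[OF DERIV_chain2[OF DERIV_ln_divide DERIV_add[OF DERIV_ident d1]]])
       (use cs s in \<open>simp_all add: s_def[symmetric] field_simps\<close>)
  have d3: "((\<lambda>c. 3 * c * sqrt (D M c x) / x ^ 4) has_real_derivative 3 * (s + c * (c / s)) / x ^ 4) (at c)"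
    by (rule DERIV_cong[OF DERIV_cdivide[OF DERIV_mult[OF DERIV_cmult[OF DERIV_ident] d1]]])
       (simp add: s_def algebra_simps)
  have "(excess M x has_real_derivative 3 * (s + c * (c / s)) / x ^ 4 - (plus_weight' M x + 1) * (1 / s)) (at c)"
    unfolding excess_def[abs_def] by (intro DERIV_diff d3 DERIV_cmult d2)
  moreover have "3 * (s + c * (c / s)) / x ^ 4 - (plus_weight' M x + 1) * (1 / s) =
     (3 * (s\<^sup>2 + c\<^sup>2) / x ^ 4 - (plus_weight' M x + 1)) / s"
  proof -
    have "s + c * (c / s) = (s\<^sup>2 + c\<^sup>2) / s" using s by (simp add: field_simps power2_eq_square)
    then show ?thesis by (simp add: diff_divide_distrib)
  qed
  ultimately show "\<exists>y. (excess M x has_real_derivative y) (at c) \<and> y \<ge> 0"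
    using excess_derivative_nonneg[OF M, of c] s by auto
next
  have "continuous_on {B..C} (\<lambda>c. D M c x)" unfolding D_def by (intro continuous_intros)
  moreover have "c + sqrt (D M c x) \<noteq> 0" if "c \<in> {B..C}" for c
  proof -
    have "B\<^sup>2 \<le> c\<^sup>2" using C that by (simp add: power_mono)
    then have "D M c x \<ge> 0" using DB by (simp add: D_def)
    then show ?thesis using C that by (smt (verit) atLeastAtMost_iff real_sqrt_ge_zero)
  qed
  ultimately show "continuous_on {B..C} (excess M x)"
    unfolding excess_def[abs_def]
    by (intro continuous_on_diff continuous_on_mult continuous_on_divide continuous_on_ln continuous_on_add
        continuous_on_real_sqrt continuous_on_id continuous_on_const) (use M in auto)
qed

context throat
begin

lemma D_pos: "r > 0 \<Longrightarrow> \<sigma> * (r - a) > 0 \<Longrightarrow> D M (throat_energy M a) r > 0"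
  using D_eq_square[of r] root_pos[OF sqrt_dom[of r]] by auto

lemma D_nonneg: "r > 0 \<Longrightarrow> \<sigma> * (r - a) \<ge> 0 \<Longrightarrow> D M (throat_energy M a) r \<ge> 0"
  using D_eq_square[of r] by auto

lemma D_throat: "D M (throat_energy M a) a = 0"
  using D_eq_square[of a] a_pos by simp

definition log_leafV :: "real \<Rightarrow> real" where
  "log_leafV r = 4 * M * ln (leafV M \<sigma> a (sqrt (\<sigma> * (r - a))))"

lemma DERIV_log_leafV:
  assumes "a < 2 * M" "r > 0" "\<sigma> * (r - a) > 0"
  defines "C \<equiv> throat_energy M a"
  shows "(log_leafV has_real_derivative r ^ 4 / (D M C r + \<sigma> * C * sqrt (D M C r))) (at r)"
  using DERIV_cmult[OF DERIV_ln_leafV[OF assms(1-3)], of "4 * M"] M_pos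
  by (simp add: log_leafV_def[abs_def] C_def)

lemma continuous_log_leafV:
  "a < 2 * M \<Longrightarrow> S \<subseteq> {r. r > 0 \<and> \<sigma> * (r - a) \<ge> 0} \<Longrightarrow> continuous_on S log_leafV"
  unfolding log_leafV_def[abs_def]
  by (intro continuous_on_mult_left continuous_on_subset[OF continuous_ln_leafV])

lemma log_leafV_throat: "a < 2 * M \<Longrightarrow> log_leafV a = a + 2 * M * ln (2 * M - a)"
  using M_pos by (simp add: log_leafV_def leafV_0 ln_mult ln_sqrt algebra_simps)

lemma continuous_ln_sqrt_D:
  assumes "a < 2 * M" "S \<subseteq> {r. r > 0 \<and> \<sigma> * (r - a) \<ge> 0}"
  shows "continuous_on S (\<lambda>x. ln (throat_energy M a + sqrt (D M (throat_energy M a) x)))"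
proof (intro continuous_on_ln continuous_on_add continuous_on_const continuous_on_real_sqrt continuous_D ballI)
  fix x assume "x \<in> S"
  then show "throat_energy M a + sqrt (D M (throat_energy M a) x) \<noteq> 0"
    using D_nonneg[of x] energy_pos[OF assms(1)] assms(2)
    by (smt (verit) mem_Collect_eq real_sqrt_ge_zero subsetD)
qed

end

lemma DERIV_ln_throat_energy:
  assumes x: "0 < x" "x < 2 * M"
  shows "((\<lambda>x. ln (throat_energy M x)) has_real_derivative (3 * M - 2 * x) / (x * (2 * M - x))) (at x)"
proof -
  define k where "k = throat_energy M x"
  have k: "k > 0" "k\<^sup>2 = x ^ 3 * (2 * M - x)" using x by (simp_all add: k_def throat_energy_def)
  have "x ^ 3 * (2 * M - x) > 0" using x by simp
  from DERIV_chain2[OF DERIV_real_sqrt[OF this] DERIV_energy_arg]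
  have "(throat_energy M has_real_derivative inverse k / 2 * (2 * x\<^sup>2 * (3 * M - 2 * x))) (at x)"
    unfolding throat_energy_def[abs_def] k_def .
  then have "(throat_energy M has_real_derivative x\<^sup>2 * (3 * M - 2 * x) / k) (at x)"
    by (rule DERIV_cong) (use k(1) in \<open>simp add: field_simps\<close>)
  from DERIV_chain2[OF DERIV_ln_divide this] k(1)
  have "((\<lambda>x. ln (throat_energy M x)) has_real_derivative 1 / k * (x\<^sup>2 * (3 * M - 2 * x) / k)) (at x)"
    by (simp add: k_def)
  moreover have "1 / k * (x\<^sup>2 * (3 * M - 2 * x) / k) = (3 * M - 2 * x) / (x * (2 * M - x))"
  proof -
    have "1 / k * (x\<^sup>2 * (3 * M - 2 * x) / k) = x\<^sup>2 * (3 * M - 2 * x) / k\<^sup>2" by (simp add: power2_eq_square)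
    then show ?thesis unfolding k(2) using x by (simp add: power2_eq_square power3_eq_cube)
  qed
  ultimately show ?thesis by simp
qed

section \<open>Order of the leaves with throat beyond \<open>3 * M / 2\<close>\<close>

definition plus_comparison :: "real \<Rightarrow> real \<Rightarrow> real \<Rightarrow> real" where
  "plus_comparison M a x = throat.log_leafV M 1 a x
     - ((plus_weight M x + x - 2 * M) * ln (throat_energy M a + sqrt (D M (throat_energy M a) x))
        + throat_energy M a * sqrt (D M (throat_energy M a) x) / x ^ 3)"

context
  fixes M a :: real
  assumes M: "M > 0" and a: "3 * M / 2 < a" "a < 2 * M"
begin

interpretation throat M 1 a using throat_plus[OF M] a by simp

text \<open>\<open>plus_weight\<close> times the derivative of \<open>ln (C + sqrt D)\<close> is the
  derivative of \<open>4 * M * ln V\<close>, and these cancel. Apart from \<open>excess\<close> the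
  correction leaves only \<open>(2 * x - 3 * M) / x\<close>, common to all leaves, so that
  differences of leaves are governed by \<open>excess\<close>.\<close>

lemma DERIV_plus_comparison:
  assumes x: "x > a"
  shows "(plus_comparison M a has_real_derivative
    excess M x (throat_energy M a) - (2 * x - 3 * M) / x) (at x)"
proof -
  define C where "C = throat_energy M a"
  define s where "s = sqrt (D M C x)"
  define l where "l = ln (C + s)"
  have x0: "x > 0" "2 * x - 3 * M > 0" using x a a_pos by auto
  have D0: "D M C x > 0" using D_pos[of x] x x0 by (simp add: C_def)
  have s: "s > 0" "s\<^sup>2 = D M C x" using D0 by (simp_all add: s_def)
  have C: "C > 0" using energy_pos a by (simp add: C_def)
  have d1: "(log_leafV has_real_derivative x ^ 4 / (s * (C + s))) (at x)"
    using DERIV_log_leafV[OF a(2), of x] x x0 s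
    by (simp add: C_def[symmetric] s_def[symmetric] s(2)[symmetric] power2_eq_square algebra_simps)
  have d2: "((\<lambda>x. (plus_weight M x + x - 2 * M) * ln (C + sqrt (D M C x))) has_real_derivative
      (plus_weight' M x + 1) * l + x\<^sup>2 * (2 * x - 3 * M) / (s * (C + s)) * (plus_weight M x + x - 2 * M)) (at x)"
    using DERIV_mult[OF DERIV_diff[OF DERIV_add[OF DERIV_plus_weight DERIV_ident] DERIV_const] DERIV_ln_sqrt_D[OF D0 C]]
      x0 by (simp add: s_def l_def)
  have d3: "((\<lambda>x. C * sqrt (D M C x) / x ^ 3) has_real_derivative
      (C * (x\<^sup>2 * (2 * x - 3 * M) / s) * x ^ 3 - C * s * (3 * x\<^sup>2)) / (x ^ 3 * x ^ 3)) (at x)"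
    using DERIV_divide[OF DERIV_cmult[OF DERIV_sqrt_D[OF D0], of C] DERIV_pow[of 3 x]] x0 by (simp add: s_def)
  have "(plus_comparison M a has_real_derivative x ^ 4 / (s * (C + s))
     - (((plus_weight' M x + 1) * l + x\<^sup>2 * (2 * x - 3 * M) / (s * (C + s)) * (plus_weight M x + x - 2 * M))
       + (C * (x\<^sup>2 * (2 * x - 3 * M) / s) * x ^ 3 - C * s * (3 * x\<^sup>2)) / (x ^ 3 * x ^ 3))) (at x)"
    unfolding plus_comparison_def[abs_def] C_def[symmetric] by (intro DERIV_diff DERIV_add d1 d2 d3)
  moreover have "x ^ 4 / (s * (C + s))
     - (((plus_weight' M x + 1) * l + x\<^sup>2 * (2 * x - 3 * M) / (s * (C + s)) * (plus_weight M x + x - 2 * M))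
       + (C * (x\<^sup>2 * (2 * x - 3 * M) / s) * x ^ 3 - C * s * (3 * x\<^sup>2)) / (x ^ 3 * x ^ 3))
     = excess M x C - (2 * x - 3 * M) / x"
  proof -
    define d where "d = 2 * x - 3 * M"
    have d: "d > 0" using x0 by (simp add: d_def)
    have rel: "x ^ 3 * (x - 2 * M) = (s - C) * (s + C)"
      using s(2) by (simp add: D_def algebra_simps power2_eq_square)
    have 1: "x\<^sup>2 * d / (s * (C + s)) * (plus_weight M x + x - 2 * M) =
        x ^ 4 / (s * (C + s)) + x\<^sup>2 * d * (x - 2 * M) / (s * (C + s))"
      unfolding plus_weight_def d_def[symmetric] using d s C
      by (simp add: distrib_left add_diff_eq[symmetric] power2_eq_square power4_eq_xxxx)
    have "x\<^sup>2 * d * (x - 2 * M) / (s * (C + s)) = d * (x ^ 3 * (x - 2 * M)) / (x * s * (C + s))"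
      using x0 by (simp add: power2_eq_square power3_eq_cube)
    also have "\<dots> = d * (s - C) / (x * s)"
      unfolding rel using s C by (simp add: add.commute)
    finally have 2: "x\<^sup>2 * d * (x - 2 * M) / (s * (C + s)) = d * (s - C) / (x * s)" .
    have 3: "(C * (x\<^sup>2 * d / s) * x ^ 3 - C * s * (3 * x\<^sup>2)) / (x ^ 3 * x ^ 3) =
        C * d / (x * s) - 3 * C * s / x ^ 4"
      using x0 s by (simp add: field_simps power2_eq_square power3_eq_cube power4_eq_xxxx)
    have 4: "d * (s - C) / (x * s) + C * d / (x * s) = d / x"
      using x0 s by (simp add: field_simps)
    show ?thesis unfolding d_def[symmetric] 1 2 3 excess_def s_def[symmetric] l_def[symmetric]
      using 4 by (simp add: algebra_simps)
  qed
  ultimately show ?thesis by (simp add: C_def)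
qed

lemma continuous_plus_comparison: "continuous_on {a..} (plus_comparison M a)"
  unfolding plus_comparison_def[abs_def] plus_weight_def
  by (intro continuous_on_diff continuous_on_add continuous_on_mult continuous_on_divide
      continuous_log_leafV continuous_ln_sqrt_D continuous_on_real_sqrt continuous_D
      continuous_on_power continuous_on_id continuous_on_const) (use a a_pos in auto)

lemma plus_comparison_throat: "plus_comparison M a a =
    a + 2 * M * ln (2 * M - a) - (plus_weight M a + a - 2 * M) * ln (throat_energy M a)"
  using log_leafV_throat[OF a(2)] D_throat by (simp add: plus_comparison_def)

text \<open>On the right stands the comparison function of the leaf with throat \<open>r\<close>,
  taken at that throat. As the throat \<open>x\<close> runs from \<open>a\<close> to
  \<open>r\<close>, the derivative of this value has the form of
  \<open>DERIV_plus_comparison\<close> with energy \<open>throat_energy M x\<close>. This energy is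
  at most that of \<open>a\<close>, and \<open>excess_mono\<close> applies.\<close>

lemma plus_comparison_at:
  assumes r: "a \<le> r" "r < 2 * M"
  shows "plus_comparison M a r \<ge> r + 2 * M * ln (2 * M - r) - (plus_weight M r + r - 2 * M) * ln (throat_energy M r)"
proof -
  define C where "C = throat_energy M a"
  define B where "B = (\<lambda>x. x + 2 * M * ln (2 * M - x) - (plus_weight M x + x - 2 * M) * ln (throat_energy M x))"
  have "plus_comparison M a a - B a \<le> plus_comparison M a r - B r"
  proof (rule DERIV_nonneg_imp_increasing_open[OF r(1), where f="\<lambda>x. plus_comparison M a x - B x"])
    fix x assume x: "a < x" "x < r"
    have x0: "x > 0" "2 * x - 3 * M > 0" "x < 2 * M" using x a a_pos r by auto
    interpret x: throat M 1 x using throat_plus[OF M] x0 by simp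
    define k where "k = throat_energy M x"
    have k: "k > 0" using x.energy_pos x0 by (simp add: k_def)
    note dk = DERIV_ln_throat_energy[OF x0(1,3)]
    have "((\<lambda>x. x + 2 * M * ln (2 * M - x)) has_real_derivative 1 - 2 * M / (2 * M - x)) (at x)"
      using x0 by (auto intro!: derivative_eq_intros)
    from DERIV_diff[OF this DERIV_mult[OF DERIV_diff[OF DERIV_add[OF DERIV_plus_weight DERIV_ident] DERIV_const] dk]] x0
    have dB: "(B has_real_derivative 1 - 2 * M / (2 * M - x) - ((plus_weight' M x + 1) * ln k
        + (3 * M - 2 * x) / (x * (2 * M - x)) * (plus_weight M x + x - 2 * M))) (at x)"
      unfolding B_def by (simp add: k_def)
    have e: "1 - 2 * M / (2 * M - x) - ((plus_weight' M x + 1) * ln k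
        + (3 * M - 2 * x) / (x * (2 * M - x)) * (plus_weight M x + x - 2 * M))
        = - (plus_weight' M x + 1) * ln k - (2 * x - 3 * M) / x"
    proof -
      define d where "d = 2 * x - 3 * M"
      define z where "z = 2 * M - x"
      have dz: "d > 0" "z > 0" "3 * M - 2 * x = - d" "x - 2 * M = - z" using x0 by (simp_all add: d_def z_def)
      have "- d / (x * z) * (x\<^sup>2 / d + - z) = - (x / z) + d / x"
        using dz x0 by (simp add: field_simps power2_eq_square)
      moreover have "1 - 2 * M / z = - (x / z)"
        using dz(2) by (simp add: z_def field_simps)
      moreover have "plus_weight M x + x - 2 * M = x\<^sup>2 / d + - z" by (simp add: plus_weight_def d_def z_def)
      ultimately show ?thesis unfolding z_def[symmetric] d_def[symmetric] dz(3) by simp (simp add: algebra_simps)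
    qed
    have "excess M x k = - (plus_weight' M x + 1) * ln k"
      using x.D_throat by (simp add: excess_def k_def algebra_simps)
    moreover have "excess M x k \<le> excess M x C"
    proof (rule excess_mono[OF M _ k])
      show "k \<le> C" using throat_energy_less2[OF M _ x(1)] a by (simp add: k_def C_def)
      show "0 \<le> D M k x" using x.D_throat by (simp add: k_def)
    qed (use x a in auto)
    ultimately show "\<exists>y. ((\<lambda>x. plus_comparison M a x - B x) has_real_derivative y) (at x) \<and> 0 \<le> y"
      using DERIV_diff[OF DERIV_plus_comparison[OF x(1)] dB] unfolding e C_def[symmetric]
      by (intro exI conjI) (assumption, linarith)
  next
    have "throat_energy M x \<noteq> 0" if "x \<in> {a..r}" for x
      using that a a_pos r by (simp add: throat_energy_def)
    then have "continuous_on {a..r} B"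
      unfolding B_def plus_weight_def using a a_pos r M
      by (intro continuous_on_diff continuous_on_add continuous_on_mult continuous_on_divide continuous_on_ln
        continuous_throat_energy[OF M] continuous_on_power continuous_on_id continuous_on_const) auto
    then show "continuous_on {a..r} (\<lambda>x. plus_comparison M a x - B x)"
      by (intro continuous_on_diff continuous_on_subset[OF continuous_plus_comparison]) auto
  qed
  moreover have "plus_comparison M a a - B a = 0" by (simp add: plus_comparison_throat B_def)
  ultimately show ?thesis by (simp add: B_def)
qed

end

text \<open>The smaller throat \<open>b\<close> has the larger energy. At radius \<open>a\<close>
  the comparison functions are ordered by \<open>plus_comparison_at\<close>, and from there on by
  \<open>excess_mono\<close>. The correction subtracted in them is strictly larger for the larger
  energy, which makes the order of \<open>ln V\<close> strict.\<close>

lemma leafV_plus_less: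
  assumes M: "M > 0" and a: "3 * M / 2 < b" "b < a" "a < 2 * M" and r: "a \<le> r"
  shows "leafV M 1 a (sqrt (r - a)) < leafV M 1 b (sqrt (r - b))"
proof -
  interpret A: throat M 1 a using throat_plus[OF M] a by simp
  interpret B: throat M 1 b using throat_plus[OF M] a by simp
  define C where "C = throat_energy M a" define E where "E = throat_energy M b"
  have CE: "0 < C" "C < E" using A.energy_pos a throat_energy_less2[OF M _ a(2)] by (simp_all add: C_def E_def)
  have b2: "b < 2 * M" and a1: "3 * M / 2 < a" using a by auto
  have "plus_comparison M b a - plus_comparison M a a \<le> plus_comparison M b r - plus_comparison M a r"
  proof (rule DERIV_nonneg_imp_increasing_open[OF r, where f="\<lambda>x. plus_comparison M b x - plus_comparison M a x"])
    fix x assume x: "a < x" "x < r"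
    have "excess M x C \<le> excess M x E"
      by (rule excess_mono[OF M]) (use x a CE A.D_nonneg[of x] A.a_pos in \<open>auto simp: C_def\<close>)
    then show "\<exists>y. ((\<lambda>x. plus_comparison M b x - plus_comparison M a x) has_real_derivative y) (at x) \<and> 0 \<le> y"
      using DERIV_diff[OF DERIV_plus_comparison[OF M a(1) b2, of x] DERIV_plus_comparison[OF M a1 a(3) x(1)]] x a
      by (auto simp: C_def E_def intro!: exI conjI)
  next
    show "continuous_on {a..r} (\<lambda>x. plus_comparison M b x - plus_comparison M a x)"
      using a by (intro continuous_on_diff continuous_on_subset[OF continuous_plus_comparison[OF M a(1) b2]]
        continuous_on_subset[OF continuous_plus_comparison[OF M a1 a(3)]]) auto
  qed
  moreover have "plus_comparison M b a \<ge> plus_comparison M a a"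
    using plus_comparison_at[OF M a(1) b2, of a] a plus_comparison_throat[OF M a1 a(3)] by simp
  ultimately have le: "plus_comparison M b r \<ge> plus_comparison M a r" by linarith
  define s t where "s = sqrt (D M C r)" and "t = sqrt (D M E r)"
  have "C\<^sup>2 < E\<^sup>2" using CE by (simp add: power_strict_mono)
  then have "D M C r < D M E r" by (simp add: D_def)
  moreover have "D M C r \<ge> 0" using A.D_nonneg[of r] r A.a_pos by (simp add: C_def)
  ultimately have st: "0 \<le> s" "s < t" by (simp_all add: s_def t_def)
  define P where "P = plus_weight M r + r - 2 * M"
  have r0: "r > 0" "2 * r - 3 * M > 0" using r a A.a_pos by auto
  \<comment> \<open>Completing the square in the numerator
    \<open>3 * r\<^sup>2 - 7 * M * r + 6 * M\<^sup>2\<close> shows that \<open>P\<close> is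
    positive.\<close>
  have "P = (3 * (r - 7 * M / 6)\<^sup>2 + 23 * M\<^sup>2 / 12) / (2 * r - 3 * M)"
    unfolding P_def plus_weight_def using r0 by (simp add: field_simps power2_eq_square)
  then have P: "P > 0" using r0 M by (simp add: add_nonneg_pos)
  have "P * ln (C + s) < P * ln (E + t)" using P st CE by (intro mult_strict_left_mono) (auto intro!: add_pos_nonneg add_strict_mono)
  moreover have "C * s / r ^ 3 \<le> E * t / r ^ 3" using st CE r0 by (intro divide_right_mono mult_mono) auto
  ultimately have "A.log_leafV r < B.log_leafV r"
    using le unfolding plus_comparison_def C_def[symmetric] E_def[symmetric] s_def[symmetric] t_def[symmetric] P_def[symmetric]
    by linarith
  moreover have "leafV M 1 a (sqrt (r - a)) > 0" "leafV M 1 b (sqrt (r - b)) > 0"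
    using A.leafV_pos[OF A.sqrt_dom[of r]] B.leafV_pos[OF B.sqrt_dom[of r]] r a r0 by auto
  ultimately show ?thesis using M by (simp add: A.log_leafV_def B.log_leafV_def)
qed

section \<open>Order of the leaves with throat below \<open>3 * M / 2\<close>\<close>

definition minus_comparison :: "real \<Rightarrow> real \<Rightarrow> real \<Rightarrow> real" where
  "minus_comparison M a x = throat.log_leafV M (- 1) a x
     + plus_weight M x * ln (throat_energy M a + sqrt (D M (throat_energy M a) x))"

context
  fixes M a :: real
  assumes M: "M > 0" and a: "0 < a" "a < 3 * M / 2"
begin

interpretation throat M "- 1" a using throat_minus[OF M] a by simp

lemma a_less: "a < 2 * M" using a M by simp

text \<open>Here \<open>y = - s\<close>, so \<open>4 * M * ln V\<close> has the derivative
  \<open>x ^ 4 / (s * (s - C))\<close>. The weighted logarithm adds the same with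
  \<open>s + C\<close>, and since \<open>(s - C) * (s + C) = x ^ 3 * (x - 2 * M)\<close> the sum is
  free of \<open>C\<close>. On this side of \<open>3 * M / 2\<close> the weight is decreasing, and
  no further correction enters.\<close>

lemma DERIV_minus_comparison:
  assumes x: "0 < x" "x < a"
  shows "(minus_comparison M a has_real_derivative
    plus_weight' M x * ln (throat_energy M a + sqrt (D M (throat_energy M a) x)) + 2 * x / (x - 2 * M)) (at x)"
proof -
  define C where "C = throat_energy M a"
  define s where "s = sqrt (D M C x)"
  define d where "d = 2 * x - 3 * M"
  have x0: "d < 0" "x < 2 * M" using x a a_less by (auto simp: d_def)
  have D0: "D M C x > 0" using D_pos[of x] x by (simp add: C_def)
  have s: "s > 0" "s\<^sup>2 = D M C x" using D0 by (simp_all add: s_def)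
  have C: "C > 0" using energy_pos a_less by (simp add: C_def)
  have rel: "x ^ 3 * (x - 2 * M) = (s - C) * (s + C)"
    using s(2) by (simp add: D_def algebra_simps power2_eq_square)
  moreover have "x ^ 3 * (x - 2 * M) < 0" using x x0 by (simp add: mult_pos_neg)
  ultimately have sC: "s - C \<noteq> 0" by auto
  have d1: "(log_leafV has_real_derivative x ^ 4 / (s * (s - C))) (at x)"
    using DERIV_log_leafV[OF a_less, of x] x s
    by (simp add: C_def[symmetric] s_def[symmetric] s(2)[symmetric] power2_eq_square algebra_simps)
  have d2: "((\<lambda>x. plus_weight M x * ln (C + sqrt (D M C x))) has_real_derivative
      plus_weight' M x * ln (C + s) + x\<^sup>2 * d / (s * (C + s)) * plus_weight M x) (at x)"
    using DERIV_mult[OF DERIV_plus_weight DERIV_ln_sqrt_D[OF D0 C]] x0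
    by (simp add: s_def d_def)
  have "(minus_comparison M a has_real_derivative x ^ 4 / (s * (s - C))
     + (plus_weight' M x * ln (C + s) + x\<^sup>2 * d / (s * (C + s)) * plus_weight M x)) (at x)"
    unfolding minus_comparison_def[abs_def] C_def[symmetric] by (intro DERIV_add d1 d2)
  moreover have "x ^ 4 / (s * (s - C)) + x\<^sup>2 * d / (s * (C + s)) * plus_weight M x = 2 * x / (x - 2 * M)"
  proof -
    have 1: "x\<^sup>2 * d / (s * (C + s)) * plus_weight M x = x ^ 4 / (s * (s + C))"
      unfolding plus_weight_def d_def[symmetric] using x0(1) by (simp add: power2_eq_square power4_eq_xxxx add.commute)
    have "x ^ 4 / (s * (s - C)) + x ^ 4 / (s * (s + C)) = 2 * x ^ 4 / ((s - C) * (s + C))"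
    proof -
      have "x ^ 4 / (s * (s - C)) = x ^ 4 * (s + C) / (s * ((s - C) * (s + C)))"
        "x ^ 4 / (s * (s + C)) = x ^ 4 * (s - C) / (s * ((s - C) * (s + C)))"
        using s(1) sC C by simp_all
      then have "x ^ 4 / (s * (s - C)) + x ^ 4 / (s * (s + C)) = s * (2 * x ^ 4) / (s * ((s - C) * (s + C)))"
        by (simp add: add_divide_distrib[symmetric] algebra_simps)
      then show ?thesis using s(1) by simp
    qed
    also have "\<dots> = 2 * x / (x - 2 * M)"
      unfolding rel[symmetric] using x by (simp add: power4_eq_xxxx power3_eq_cube)
    finally show ?thesis unfolding 1 .
  qed
  ultimately show ?thesis by (simp add: C_def s_def algebra_simps)
qed

lemma continuous_minus_comparison: "continuous_on {0<..a} (minus_comparison M a)"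
  unfolding minus_comparison_def[abs_def] plus_weight_def
  by (intro continuous_on_add continuous_on_mult continuous_on_divide continuous_on_diff
      continuous_log_leafV continuous_ln_sqrt_D continuous_on_power continuous_on_id continuous_on_const)
     (use a a_less in auto)

lemma minus_comparison_throat: "minus_comparison M a a =
    a + 2 * M * ln (2 * M - a) + plus_weight M a * ln (throat_energy M a)"
  using log_leafV_throat[OF a_less] D_throat by (simp add: minus_comparison_def)

lemma plus_weight'_neg: "0 < x \<Longrightarrow> x < 3 * M / 2 \<Longrightarrow> plus_weight' M x < 0"
  using M by (simp add: plus_weight'_def divide_neg_pos mult_pos_neg)

text \<open>As in \<open>plus_comparison_at\<close>, the throat runs through all radii between
  \<open>r\<close> and \<open>a\<close>. The leaf \<open>a\<close> has the larger logarithm, which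
  \<open>plus_weight' < 0\<close> turns into the smaller derivative; the difference thus grows
  towards smaller radii.\<close>

lemma minus_comparison_at:
  assumes r: "0 < r" "r \<le> a"
  shows "minus_comparison M a r \<ge> r + 2 * M * ln (2 * M - r) + plus_weight M r * ln (throat_energy M r)"
proof -
  define C where "C = throat_energy M a"
  define B where "B = (\<lambda>x. x + 2 * M * ln (2 * M - x) + plus_weight M x * ln (throat_energy M x))"
  have "minus_comparison M a r - B r \<ge> minus_comparison M a a - B a"
  proof (rule DERIV_nonpos_imp_decreasing_open[OF r(2), where f="\<lambda>x. minus_comparison M a x - B x"])
    fix x assume x: "r < x" "x < a"
    have x0: "x > 0" "2 * x - 3 * M < 0" "x < 2 * M" using x a a_less r by auto
    define k where "k = throat_energy M x"
    have "((\<lambda>x. x + 2 * M * ln (2 * M - x)) has_real_derivative 1 - 2 * M / (2 * M - x)) (at x)"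
      using x0 by (auto intro!: derivative_eq_intros)
    from DERIV_add[OF this DERIV_mult[OF DERIV_plus_weight DERIV_ln_throat_energy]] x0
    have dB: "(B has_real_derivative 1 - 2 * M / (2 * M - x) + (plus_weight' M x * ln k
        + (3 * M - 2 * x) / (x * (2 * M - x)) * plus_weight M x)) (at x)"
      unfolding B_def by (simp add: k_def)
    have e: "1 - 2 * M / (2 * M - x) + (plus_weight' M x * ln k
        + (3 * M - 2 * x) / (x * (2 * M - x)) * plus_weight M x) = plus_weight' M x * ln k + 2 * x / (x - 2 * M)"
    proof -
      define d where "d = 2 * x - 3 * M"
      define z where "z = 2 * M - x"
      have dz: "d < 0" "z > 0" "3 * M - 2 * x = - d" "x - 2 * M = - z" using x0 by (simp_all add: d_def z_def)
      have "- d / (x * z) * plus_weight M x = - (x / z)"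
        unfolding plus_weight_def d_def[symmetric] using dz x0 by (simp add: field_simps power2_eq_square)
      moreover have "1 - 2 * M / z = - (x / z)"
        using dz(2) by (simp add: z_def field_simps)
      ultimately show ?thesis unfolding z_def[symmetric] dz(3,4) by simp
    qed
    have "0 < k" "k \<le> C" using throat_energy_less1[of x a M] x0 x a by (auto simp: k_def C_def throat_energy_def)
    moreover have "sqrt (D M C x) \<ge> 0" using D_nonneg[of x] x0 x by (simp add: C_def)
    ultimately have "ln k \<le> ln (C + sqrt (D M C x))" by (subst ln_le_cancel_iff) linarith+
    then have "plus_weight' M x * ln (C + sqrt (D M C x)) \<le> plus_weight' M x * ln k"
      using plus_weight'_neg[of x] x0 by (intro mult_left_mono_neg) auto
    then show "\<exists>y. ((\<lambda>x. minus_comparison M a x - B x) has_real_derivative y) (at x) \<and> y \<le> 0"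
      using DERIV_diff[OF DERIV_minus_comparison[OF x0(1) x(2)] dB] unfolding e C_def[symmetric]
      by (intro exI conjI) (assumption, linarith)
  next
    have "throat_energy M x \<noteq> 0" if "x \<in> {r..a}" for x
      using that a_less r by (simp add: throat_energy_def)
    then have "continuous_on {r..a} B"
      unfolding B_def plus_weight_def using a a_less r M
      by (intro continuous_on_diff continuous_on_add continuous_on_mult continuous_on_divide continuous_on_ln
        continuous_throat_energy[OF M] continuous_on_power continuous_on_id continuous_on_const) auto
    then show "continuous_on {r..a} (\<lambda>x. minus_comparison M a x - B x)"
      using r by (intro continuous_on_diff continuous_on_subset[OF continuous_minus_comparison]) auto
  qed
  moreover have "minus_comparison M a a - B a = 0" by (simp add: minus_comparison_throat B_def)
  ultimately show ?thesis by (simp add: B_def)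
qed

end

lemma leafV_minus_less:
  assumes M: "M > 0" and a: "a < b" "b < 3 * M / 2" and r: "0 < r" "r \<le> a"
  shows "leafV M (- 1) a (sqrt (a - r)) < leafV M (- 1) b (sqrt (b - r))"
proof -
  have a0: "0 < a" "0 < b" "a < 3 * M / 2" using a r by auto
  interpret A: throat M "- 1" a using throat_minus[OF M] a0 by simp
  interpret B: throat M "- 1" b using throat_minus[OF M] a0 a by simp
  define C where "C = throat_energy M a" define E where "E = throat_energy M b"
  have CE: "0 < C" "C < E" using A.energy_pos a0 a M throat_energy_less1[of a b M] by (simp_all add: C_def E_def)
  have DCE: "sqrt (D M C x) < sqrt (D M E x)" for x
    using CE by (simp add: D_def power_strict_mono)
  have ln_less: "ln (C + sqrt (D M C x)) < ln (E + sqrt (D M E x))" if "0 < x" "x \<le> a" for x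
    using CE DCE[of x] A.D_nonneg[of x] that by (simp add: C_def add_pos_nonneg add_strict_mono)
  have "minus_comparison M b a - minus_comparison M a a \<le> minus_comparison M b r - minus_comparison M a r"
  proof (rule DERIV_nonpos_imp_decreasing_open[OF r(2), where f="\<lambda>x. minus_comparison M b x - minus_comparison M a x"])
    fix x assume x: "r < x" "x < a"
    have "plus_weight' M x * ln (E + sqrt (D M E x)) \<le> plus_weight' M x * ln (C + sqrt (D M C x))"
      using plus_weight'_neg[OF M a0(1,3), of x] ln_less[of x] x r a0 by (intro mult_left_mono_neg) auto
    then show "\<exists>y. ((\<lambda>x. minus_comparison M b x - minus_comparison M a x) has_real_derivative y) (at x) \<and> y \<le> 0"
      using DERIV_diff[OF DERIV_minus_comparison[OF M a0(2) a(2), of x] DERIV_minus_comparison[OF M a0(1,3) _ x(2)]] x r a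
      by (auto simp: C_def E_def intro!: exI conjI)
  next
    show "continuous_on {r..a} (\<lambda>x. minus_comparison M b x - minus_comparison M a x)"
      using a r by (intro continuous_on_diff continuous_on_subset[OF continuous_minus_comparison[OF M a0(2) a(2)]]
        continuous_on_subset[OF continuous_minus_comparison[OF M a0(1,3)]]) auto
  qed
  moreover have "minus_comparison M b a \<ge> minus_comparison M a a"
    using minus_comparison_at[OF M a0(2) a(2), of a] a a0 minus_comparison_throat[OF M a0(1,3)] by simp
  ultimately have le: "minus_comparison M b r \<ge> minus_comparison M a r" by linarith
  \<comment> \<open>The weight is negative, so the added term strictly decreases with the energy.
    Taking it off makes the order of \<open>log_leafV\<close> strict.\<close>
  have "plus_weight M r < 0" using r a by (simp add: plus_weight_def divide_pos_neg)
  then have "plus_weight M r * ln (E + sqrt (D M E r)) < plus_weight M r * ln (C + sqrt (D M C r))"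
    using ln_less[OF r] by (rule mult_strict_left_mono_neg[rotated])
  then have "A.log_leafV r < B.log_leafV r"
    using le unfolding minus_comparison_def C_def[symmetric] E_def[symmetric] by linarith
  moreover have "leafV M (- 1) a (sqrt (a - r)) > 0" "leafV M (- 1) b (sqrt (b - r)) > 0"
    using A.leafV_pos[OF A.sqrt_dom[of r]] B.leafV_pos[OF B.sqrt_dom[of r]] r a M by auto
  ultimately show ?thesis using M by (simp add: A.log_leafV_def B.log_leafV_def)
qed

section \<open>Every point lies on a hypersurface\<close>

text \<open>Moves the upper limit, which depends on the throat, into the integrand. Continuity in
  the throat then concerns a parameter integral over a fixed interval.\<close>

lemma (in throat) int_rescale:
  assumes w: "w \<in> throat_dom \<sigma> a" "w \<ge> 0"
  shows "thr_int M \<sigma> a w = integral {0..1} (\<lambda>s. w * thr_dens M \<sigma> a (w * s))"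
proof -
  have dom: "w * s \<in> throat_dom \<sigma> a" if "s \<in> {0..1}" for s
    using dom_convex[OF dom_0 w(1)] that w(2) by (auto simp: mult_left_le)
  have "((\<lambda>s. w * thr_dens M \<sigma> a (w * s)) has_integral (thr_int M \<sigma> a (w * 1) - thr_int M \<sigma> a (w * 0))) {0..1}"
  proof (rule fundamental_theorem_of_calculus)
    fix s :: real assume s: "s \<in> {0..1}"
    from DERIV_chain2[OF DERIV_int[OF dom[OF s]] DERIV_cmult[OF DERIV_ident]]
    have "((\<lambda>s. thr_int M \<sigma> a (w * s)) has_real_derivative w * thr_dens M \<sigma> a (w * s)) (at s)"
      by (simp add: mult.commute)
    then show "((\<lambda>s. thr_int M \<sigma> a (w * s)) has_vector_derivative w * thr_dens M \<sigma> a (w * s)) (at s within {0..1})"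
      by (simp add: has_real_derivative_iff_has_vector_derivative has_vector_derivative_at_within)
  qed simp
  from integral_unique[OF this] show ?thesis
    by (simp only: int_0 mult_1_right mult_zero_right diff_zero)
qed

text \<open>On the rescaled segment \<open>thr_rad\<close> and \<open>thr_root\<close> stay
  positive, also when \<open>r\<close> is the throat itself and the segment shrinks to
  \<open>w = 0\<close>; hence the integrand is jointly continuous.\<close>

lemma continuous_leafV_throat:
  assumes M: "M > 0" and r: "r > 0" and A: "\<And>a. a \<in> A \<Longrightarrow> throat M \<sigma> a" "\<And>a. a \<in> A \<Longrightarrow> \<sigma> * (r - a) \<ge> 0"
  shows "continuous_on A (\<lambda>a. leafV M \<sigma> a (sqrt (\<sigma> * (r - a))))"
proof -
  let ?w = "\<lambda>a. sqrt (\<sigma> * (r - a))"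
  have dom: "?w a * s \<in> throat_dom \<sigma> a" if "a \<in> A" "s \<in> {0..1}" for a s
  proof -
    interpret throat M \<sigma> a using A that by simp
    show ?thesis
      using dom_convex[OF dom_0 sqrt_dom[OF r A(2)[OF that(1)]]] that A(2)[OF that(1)] by (auto simp: mult_left_le)
  qed
  have cont: "continuous_on (A \<times> {0..1}) (\<lambda>z. ?w (fst z) * thr_dens M \<sigma> (fst z) (?w (fst z) * snd z))"
    unfolding thr_dens_def thr_root_def thr_rad_def throat_quot_def
  proof (intro continuous_intros ballI)
    fix z assume "z \<in> A \<times> {0..1 :: real}"
    then have a: "fst z \<in> A" "snd z \<in> {0..1}" by auto
    interpret throat M \<sigma> "fst z" using A a by simp
    have "2 * M * thr_rad \<sigma> (fst z) (?w (fst z) * snd z) * thr_root M \<sigma> (fst z) (?w (fst z) * snd z) \<noteq> 0"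
      using rad_pos[OF dom[OF a]] root_pos[OF dom[OF a]] M by simp
    then show "2 * M * (fst z + \<sigma> * (?w (fst z) * snd z)\<^sup>2) *
         sqrt (\<sigma> * (((fst z + \<sigma> * (?w (fst z) * snd z)\<^sup>2)\<^sup>2 + (fst z)\<^sup>2) * (fst z + \<sigma> * (?w (fst z) * snd z)\<^sup>2 + fst z)
            - 2 * M * ((fst z + \<sigma> * (?w (fst z) * snd z)\<^sup>2)\<^sup>2 + (fst z + \<sigma> * (?w (fst z) * snd z)\<^sup>2) * fst z + (fst z)\<^sup>2))) \<noteq> 0"
      unfolding thr_rad_def thr_root_def throat_quot_def .
  qed
  have "continuous_on A (\<lambda>a. integral (cbox 0 1) (\<lambda>s. ?w a * thr_dens M \<sigma> a (?w a * s)))"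
    by (rule integral_continuous_on_param) (use cont in \<open>simp add: case_prod_unfold\<close>)
  then have c1: "continuous_on A (\<lambda>a. integral {0..1} (\<lambda>s. ?w a * thr_dens M \<sigma> a (?w a * s)))" by simp
  have "continuous_on A (\<lambda>a. (\<sigma> * ?w a * sqrt (\<sigma> * throat_quot M a r) + throat_energy M a) * thr_prof M r *
     exp (throat_energy M a * integral {0..1} (\<lambda>s. ?w a * thr_dens M \<sigma> a (?w a * s))))"
    unfolding throat_quot_def
    by (intro continuous_intros c1 continuous_throat_energy[OF M])
  moreover have "leafV M \<sigma> a (?w a) = (\<sigma> * ?w a * sqrt (\<sigma> * throat_quot M a r) + throat_energy M a) * thr_prof M r *
     exp (throat_energy M a * integral {0..1} (\<lambda>s. ?w a * thr_dens M \<sigma> a (?w a * s)))" if a: "a \<in> A" for a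
  proof -
    interpret throat M \<sigma> a using A a by simp
    show ?thesis
      using A(2)[OF a] sqrt_dom[OF r A(2)[OF a]] by (simp add: leafV_def rad_sqrt thr_root_def int_rescale)
  qed
  ultimately show ?thesis using continuous_on_cong by (simp cong: continuous_on_cong)
qed

context throat
begin

lemma leafV_strict_mono:
  assumes "v \<in> throat_dom \<sigma> a" "w \<in> throat_dom \<sigma> a" "v < w"
  shows "leafV M \<sigma> a v < leafV M \<sigma> a w"
proof (rule DERIV_pos_imp_increasing[OF assms(3)])
  fix x assume "v \<le> x" "x \<le> w"
  then have "x \<in> throat_dom \<sigma> a" using dom_convex[OF assms(1,2)] by auto
  then show "\<exists>y. (leafV M \<sigma> a has_real_derivative y) (at x) \<and> 0 < y"
    using DERIV_leafV[of x] speed_pos[of x]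
    by (intro exI[of _ "speed x * exp (throat_energy M a * thr_int M \<sigma> a x)"]) auto
qed

text \<open>By reflection the sum is \<open>V\<close> at \<open>w\<close> minus \<open>V\<close> at
  \<open>- w\<close>.\<close>

lemma sum_pos: assumes "w \<in> throat_dom \<sigma> a" "0 < w" shows "leafU M \<sigma> a w + leafV M \<sigma> a w > 0"
  using leafV_strict_mono[of "- w" w] leafV_minus[of w] dom_minus[of w] assms by simp

text \<open>The bound tends to infinity as \<open>a\<close> approaches \<open>3 * M / 2\<close>, where the zero of \<open>D\<close> becomes double.\<close>

lemma int_lower_bound:
  assumes r: "0 < r" "r \<le> 2 * M" "\<sigma> * (r - a) \<ge> 0"
  shows "thr_int M \<sigma> a (sqrt (\<sigma> * (r - a))) \<ge>
    ln (\<sigma> * (r - 3 * M / 2) / (\<sigma> * (a - 3 * M / 2))) / (6 * M\<^sup>2)"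
proof -
  define W where "W = sqrt (\<sigma> * (r - a))"
  define \<delta> where "\<delta> = \<sigma> * (a - 3 * M / 2)"
  have \<delta>: "\<delta> > 0" using side sigma by (auto simp: \<delta>_def)
  have W: "W \<in> throat_dom \<sigma> a" "W \<ge> 0" "thr_rad \<sigma> a W = r" using sqrt_dom rad_sqrt r by (auto simp: W_def)
  \<comment> \<open>\<open>\<delta> + w\<^sup>2\<close> is the distance of the radius from
    \<open>3 * M / 2\<close>. It suffices that its logarithm, divided by
    \<open>6 * M\<^sup>2\<close>, nowhere grows faster than \<open>thr_int\<close>.\<close>
  have "thr_int M \<sigma> a 0 - ln (\<delta> + 0\<^sup>2) / (6 * M\<^sup>2) \<le> thr_int M \<sigma> a W - ln (\<delta> + W\<^sup>2) / (6 * M\<^sup>2)"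
  proof (rule DERIV_nonneg_imp_nondecreasing[OF W(2), where f="\<lambda>w. thr_int M \<sigma> a w - ln (\<delta> + w\<^sup>2) / (6 * M\<^sup>2)"])
    fix w assume w: "0 \<le> w" "w \<le> W"
    then have dom: "w \<in> throat_dom \<sigma> a" using dom_convex[OF dom_0 W(1)] by auto
    define x s where "x = thr_rad \<sigma> a w" "s = thr_root M \<sigma> a w"
    have xs: "x > 0" "s > 0" using rad_pos[OF dom] root_pos[OF dom] by (simp_all add: x_s_def)
    have x2: "x \<le> 2 * M"
    proof (cases "\<sigma> = 1")
      case True
      have "w\<^sup>2 \<le> W\<^sup>2" using w by (simp add: power_mono)
      then show ?thesis using True W(3) r by (simp add: x_s_def thr_rad_def)
    next
      case False
      have "w\<^sup>2 \<ge> 0" by simp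
      then show ?thesis using False sigma a_le by (auto simp: x_s_def thr_rad_def intro: order_trans[of _ a])
    qed
    have dw: "\<delta> + w\<^sup>2 > 0" using \<delta> by (simp add: add_pos_nonneg)
    have xr: "(x - 3 * M / 2)\<^sup>2 = (\<delta> + w\<^sup>2)\<^sup>2"
    proof -
      have "\<delta> + w\<^sup>2 = \<sigma> * (x - 3 * M / 2)" using rad_side[of w] by (simp add: x_s_def \<delta>_def algebra_simps)
      then show ?thesis using sigma by (auto simp: power_mult_distrib)
    qed
    have "(w * s)\<^sup>2 = a ^ 3 * (2 * M - a) + x ^ 3 * (x - 2 * M)"
      using energy_relation[OF dom] sigma unfolding energy_square x_s_def by (auto simp: power_mult_distrib)
    \<comment> \<open>With the energy raised to its maximum, \<open>D\<close> has the double zero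
      \<open>3 * M / 2\<close>. The remaining quadratic factor is below
      \<open>(3 * M)\<^sup>2\<close> for \<open>x \<le> 2 * M\<close>, a square chosen with a view
      to the root taken later.\<close>
    also have "\<dots> \<le> (3 * M / 2) ^ 3 * (2 * M - 3 * M / 2) + x ^ 3 * (x - 2 * M)"
      using throat_energy_le[OF M_pos, of a] a_pos by (simp add: throat_energy_def)
    also have "\<dots> = (x - 3 * M / 2)\<^sup>2 * (x\<^sup>2 + M * x + 3 / 4 * M\<^sup>2)" by (simp add: field_simps) algebra
    also have "\<dots> \<le> (\<delta> + w\<^sup>2)\<^sup>2 * (9 * M\<^sup>2)"
    proof -
      have "x\<^sup>2 \<le> (2 * M)\<^sup>2" using x2 xs by (intro power_mono) auto
      moreover have "M * x \<le> M * (2 * M)" using x2 M_pos by (intro mult_left_mono) auto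
      ultimately have "x\<^sup>2 + M * x + 3 / 4 * M\<^sup>2 \<le> 9 * M\<^sup>2"
        using zero_le_square[of M] unfolding power2_eq_square by linarith
      then show ?thesis unfolding xr by (intro mult_left_mono) auto
    qed
    also have "\<dots> = (3 * M * (\<delta> + w\<^sup>2))\<^sup>2" by (simp add: power_mult_distrib)
    finally have ws: "w * s \<le> 3 * M * (\<delta> + w\<^sup>2)"
      by (rule power2_le_imp_le) (rule mult_nonneg_nonneg, use dw M_pos in linarith, use dw in linarith)
    have "w / (3 * M\<^sup>2 * (\<delta> + w\<^sup>2)) = w * s / (3 * M\<^sup>2 * (\<delta> + w\<^sup>2) * s)"
      using xs by simp
    also have "\<dots> \<le> 3 * M * (\<delta> + w\<^sup>2) / (3 * M\<^sup>2 * (\<delta> + w\<^sup>2) * s)"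
      using ws dw M_pos xs by (intro divide_right_mono) auto
    also have "\<dots> = 1 / (M * s)" using dw M_pos by (simp add: power2_eq_square)
    also have "\<dots> = (4 * M) / (2 * M * (2 * M) * s)" using M_pos xs by simp
    also have "\<dots> \<le> (6 * M - x) / (2 * M * x * s)"
      using x2 xs M_pos by (intro frac_le mult_mono) auto
    finally have *: "w / (3 * M\<^sup>2 * (\<delta> + w\<^sup>2)) \<le> thr_dens M \<sigma> a w" by (simp add: thr_dens_def x_s_def)
    have "((\<lambda>w. ln (\<delta> + w\<^sup>2) / (6 * M\<^sup>2)) has_real_derivative w / (3 * M\<^sup>2 * (\<delta> + w\<^sup>2))) (at w)"
    proof -
      have "((\<lambda>w. \<delta> + w\<^sup>2) has_real_derivative 2 * w) (at w)" by (auto intro!: derivative_eq_intros)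
      from DERIV_cdivide[OF DERIV_chain2[OF DERIV_ln_divide[OF dw] this], of "6 * M\<^sup>2"]
      show ?thesis by (rule DERIV_cong) (use M_pos in simp)
    qed
    from DERIV_diff[OF DERIV_int[OF dom] this]
    show "\<exists>y. ((\<lambda>w. thr_int M \<sigma> a w - ln (\<delta> + w\<^sup>2) / (6 * M\<^sup>2)) has_real_derivative y) (at w) \<and> 0 \<le> y"
      using * by (intro exI conjI) (assumption, simp)
  qed
  then have "(ln (\<delta> + W\<^sup>2) - ln \<delta>) / (6 * M\<^sup>2) \<le> thr_int M \<sigma> a W"
    by (simp add: int_0 diff_divide_distrib)
  moreover have "\<delta> + W\<^sup>2 > 0" using \<delta> by (simp add: add_pos_nonneg)
  ultimately have "ln ((\<delta> + W\<^sup>2) / \<delta>) / (6 * M\<^sup>2) \<le> thr_int M \<sigma> a W"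
    using \<delta> by (simp add: ln_div)
  moreover have "\<delta> + W\<^sup>2 = \<sigma> * (r - 3 * M / 2)" using r by (simp add: W_def \<delta>_def algebra_simps)
  ultimately show ?thesis unfolding W_def \<delta>_def by simp
qed

end

text \<open>By \<open>int_lower_bound\<close> the factor \<open>exp (C * J)\<close> grows beyond all
  bounds as the throat tends to \<open>3 * M / 2\<close>, while the others stay away from
  \<open>0\<close>: \<open>C \<ge> k\<close> and
  \<open>C - s = k\<^sup>2 / (C + s) \<ge> k\<^sup>2 / (2 * m)\<close>, with \<open>k\<close> the
  energy of \<open>r\<close> as a throat and \<open>m\<close> the maximal energy.\<close>

lemma leafV_unbounded:
  assumes M: "M > 0" and r: "0 < r" "r < 2 * M" "\<sigma> * (r - 3 * M / 2) > 0" and \<sigma>: "\<sigma> = 1 \<or> \<sigma> = - 1"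
  shows "\<exists>a. throat M \<sigma> a \<and> a < 2 * M \<and> \<sigma> * (r - a) \<ge> 0 \<and> leafV M \<sigma> a (sqrt (\<sigma> * (r - a))) \<ge> K"
proof -
  define \<eta> where "\<eta> = \<sigma> * (r - 3 * M / 2)"
  define k where "k = throat_energy M r"
  define m where "m = throat_energy M (3 * M / 2)"
  define q where "q = k\<^sup>2 / (2 * m) * thr_prof M r"
  \<comment> \<open>This is \<open>ln (\<eta> / \<delta>)\<close>, prescribed in advance: at least
    \<open>1\<close>, so that the throat falls strictly between \<open>3 * M / 2\<close> and
    \<open>r\<close>, and so large that
    \<open>k * L / (6 * M\<^sup>2) \<ge> \<bar>K\<bar> / q\<close>.\<close>
  define L where "L = max 1 (6 * M\<^sup>2 * \<bar>K\<bar> / (k * q))"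
  define \<delta> where "\<delta> = \<eta> * exp (- L)"
  define a where "a = 3 * M / 2 + \<sigma> * \<delta>"
  have k: "k > 0" using r by (simp add: k_def throat_energy_def)
  have km: "k \<le> m" unfolding k_def m_def using throat_energy_le[OF M] r by simp
  have q: "q > 0" using k km r by (simp add: q_def thr_prof_def)
  have L: "L \<ge> 1" by (simp add: L_def)
  have \<eta>: "\<eta> > 0" using r by (simp add: \<eta>_def)
  have \<delta>: "\<delta> > 0" "\<delta> < \<eta>" using \<eta> L by (simp_all add: \<delta>_def mult_less_cancel_left1)
  have a: "\<sigma> * (r - a) = \<eta> - \<delta>" "\<sigma> * (a - 3 * M / 2) = \<delta>" "0 < a" "a < 2 * M"
    using \<sigma> \<delta> r M by (auto simp: a_def \<eta>_def algebra_simps)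
  have th: "throat M \<sigma> a" using M a \<sigma> \<delta> by unfold_locales (auto simp: algebra_simps)
  then interpret throat M \<sigma> a .
  define C where "C = throat_energy M a"
  define w where "w = sqrt (\<sigma> * (r - a))"
  have ra: "\<sigma> * (r - a) \<ge> 0" using a \<delta> by simp
  have w: "w \<in> throat_dom \<sigma> a" "thr_rad \<sigma> a w = r" "w \<ge> 0"
    using sqrt_dom[OF r(1) ra] rad_sqrt[OF ra] ra by (auto simp: w_def)
  interpret R: throat M \<sigma> r using M r \<sigma> by unfold_locales (auto simp: algebra_simps)
  have "(w * thr_root M \<sigma> a w)\<^sup>2 = C\<^sup>2 - k\<^sup>2"
    using energy_relation[OF w(1)] \<sigma> unfolding w(2) k_def R.energy_square C_def by (auto simp: algebra_simps power_mult_distrib)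
  then obtain s where s: "s = w * thr_root M \<sigma> a w" "s \<ge> 0" "C\<^sup>2 - s\<^sup>2 = k\<^sup>2"
    using w root_pos[OF w(1)] by simp
  have C: "C > 0" "C \<le> m" "k \<le> C"
  proof -
    show "C > 0" using energy_pos a by (simp add: C_def)
    show "C \<le> m" using throat_energy_le[OF M, of a] a by (simp add: C_def m_def)
    have "k\<^sup>2 \<le> C\<^sup>2" using s(3) zero_le_power2[of s] by linarith
    then show "k \<le> C" by (rule power2_le_imp_le) (use \<open>C > 0\<close> in simp)
  qed
  have "s\<^sup>2 \<le> C\<^sup>2" using s(3) zero_le_power2[of k] by linarith
  then have sC: "s \<le> C" by (rule power2_le_imp_le) (use C in simp)
  have "k\<^sup>2 = (C - s) * (C + s)" using s(3) by (simp add: power2_eq_square algebra_simps)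
  also have "\<dots> \<le> (C - s) * (2 * m)" using sC C by (intro mult_left_mono) auto
  finally have "k\<^sup>2 / (2 * m) \<le> C - s" using k km by (simp add: divide_le_eq)
  also have "\<dots> \<le> \<sigma> * w * thr_root M \<sigma> a w + C" using s \<sigma> by auto
  finally have 1: "q \<le> (\<sigma> * w * thr_root M \<sigma> a w + C) * thr_prof M r"
    unfolding q_def using prof_pos[OF r(1)] by (intro mult_right_mono) auto
  have "ln (\<eta> / \<delta>) = L" using \<eta> by (simp add: \<delta>_def exp_minus field_simps)
  then have "L / (6 * M\<^sup>2) \<le> thr_int M \<sigma> a w"
    using int_lower_bound[OF r(1) _ ra] r a by (simp add: w_def \<eta>_def)
  moreover have "0 \<le> L / (6 * M\<^sup>2)" using L by simp
  ultimately have "k * (L / (6 * M\<^sup>2)) \<le> C * thr_int M \<sigma> a w"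
    using C k by (intro mult_mono) auto
  moreover have "\<bar>K\<bar> / q \<le> k * (L / (6 * M\<^sup>2))"
  proof -
    have "6 * M\<^sup>2 * \<bar>K\<bar> / (k * q) \<le> L" by (simp add: L_def)
    then show ?thesis using k q M by (simp add: field_simps)
  qed
  moreover have "C * thr_int M \<sigma> a w \<le> exp (C * thr_int M \<sigma> a w)"
    using exp_ge_add_one_self[of "C * thr_int M \<sigma> a w"] by linarith
  ultimately have 2: "\<bar>K\<bar> / q \<le> exp (C * thr_int M \<sigma> a w)" by linarith
  have "K \<le> q * (\<bar>K\<bar> / q)" using q by simp
  also have "\<dots> \<le> (\<sigma> * w * thr_root M \<sigma> a w + C) * thr_prof M r * exp (C * thr_int M \<sigma> a w)"
    using 1 2 q by (intro mult_mono) auto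
  also have "\<dots> = leafV M \<sigma> a w" by (simp add: leafV_def w C_def)
  finally show ?thesis using th a ra by (auto simp: w_def)
qed

text \<open>The value of \<open>sqrt \<bar>U * V\<bar>\<close> at area radius \<open>r\<close>, the
  least \<open>V\<close> possible when \<open>\<bar>U\<bar> \<le> V\<close>. It is attained on
  \<open>U = - V\<close> inside the horizon and on the diagonal outside.\<close>

definition null_bound :: "real \<Rightarrow> real \<Rightarrow> real" where
  "null_bound M r = sqrt \<bar>r - 2 * M\<bar> * exp (r / (4 * M))"

lemma null_bound_square: "M > 0 \<Longrightarrow> (null_bound M r)\<^sup>2 = \<bar>(r - 2 * M) * exp (r / (2 * M))\<bar>"
  by (simp add: null_bound_def power_mult_distrib abs_mult flip: exp_double)

lemma leafV_horizon:
  assumes M: "M > 0" and r: "2 * M \<le> r"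
  shows "leafV M 1 (2 * M) (sqrt (r - 2 * M)) = null_bound M r"
proof -
  interpret throat M 1 "2 * M" using throat_plus[OF M] M by simp
  have "throat_energy M (2 * M) = 0" by (simp add: throat_energy_def)
  moreover have "throat_quot M (2 * M) r = r ^ 3"
    using quot_mult[of r] by (cases "r = 2 * M") (auto simp: throat_energy_def throat_quot_def power3_eq_cube power2_eq_square algebra_simps)
  moreover have "thr_rad 1 (2 * M) (sqrt (r - 2 * M)) = r" using r by (simp add: thr_rad_def)
  moreover have "sqrt (r ^ 3) = r * sqrt r" using r M by (simp add: real_sqrt_mult power3_eq_cube)
  ultimately show ?thesis
    using r M by (simp add: leafV_def thr_root_def thr_prof_def null_bound_def)
qed

text \<open>The order of the leaves is known for throats below \<open>2 * M\<close> only; continuity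
  extends it to the diagonal, and the intermediate throat \<open>c\<close> keeps the inequality
  strict.\<close>

lemma leafV_plus_gt:
  assumes M: "M > 0" and b: "3 * M / 2 < b" "b < 2 * M" and r: "2 * M \<le> r"
  shows "leafV M 1 b (sqrt (r - b)) > null_bound M r"
proof -
  let ?f = "\<lambda>a. leafV M 1 a (sqrt (r - a))"
  define c where "c = (b + 2 * M) / 2"
  have c: "b < c" "c < 2 * M" using b by (auto simp: c_def)
  have cont: "continuous_on {c..2 * M} ?f"
    using continuous_leafV_throat[OF M, of r "{c..2 * M}" 1] throat_plus[OF M] b c r M by auto
  have "?f (2 * M) \<le> ?f c"
  proof (rule ccontr)
    assume n: "\<not> ?f (2 * M) \<le> ?f c"
    define K where "K = (?f (2 * M) + ?f c) / 2"
    have K: "?f c < K" "K < ?f (2 * M)" using n by (auto simp: K_def field_simps)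
    then obtain x where x: "c \<le> x" "x \<le> 2 * M" "?f x = K"
      using IVT'[of ?f c K "2 * M"] cont c by auto
    then have "x \<noteq> c" "x \<noteq> 2 * M" using K by auto
    then show False using leafV_plus_less[OF M, of c x r] x K b c r by simp
  qed
  also have "?f c < ?f b" using leafV_plus_less[OF M b(1) c(1,2), of r] c r by simp
  finally show ?thesis using leafV_horizon[OF M r] by simp
qed

text \<open>Intermediate values in the throat: \<open>min r (2 * M)\<close>, the largest throat
  possible at radius \<open>r\<close>, gives the null bound, and throats near
  \<open>3 * M / 2\<close> give arbitrarily large values.\<close>

lemma leafV_plus_onto:
  assumes M: "M > 0" and r: "r > 3 * M / 2" and K: "K \<ge> null_bound M r"
  shows "\<exists>a. 3 * M / 2 < a \<and> a \<le> 2 * M \<and> a \<le> r \<and> leafV M 1 a (sqrt (r - a)) = K"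
proof -
  let ?f = "\<lambda>a. leafV M 1 a (sqrt (r - a))"
  define e where "e = min r (2 * M)"
  \<comment> \<open>\<open>leafV_unbounded\<close> applies inside the horizon. For larger
    \<open>r\<close> it is used at \<open>7 * M / 4\<close>, a radius between
    \<open>3 * M / 2\<close> and \<open>2 * M\<close>, because \<open>V\<close> increases along the
    leaf from there to \<open>r\<close>.\<close>
  define r1 where "r1 = min r (7 * M / 4)"
  have r1: "3 * M / 2 < r1" "r1 < 2 * M" using r M by (auto simp: r1_def)
  obtain a where a: "throat M 1 a" "a < 2 * M" "a \<le> r1" "leafV M 1 a (sqrt (r1 - a)) \<ge> K"
    using leafV_unbounded[OF M, of r1 1 K] r1 M by auto
  interpret throat M 1 a by fact
  have ar: "a \<le> r" "r1 \<le> r" "3 * M / 2 < a" using a side by (auto simp: r1_def)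
  have "?f a \<ge> K"
  proof (cases "r1 = r")
    case False
    then have "leafV M 1 a (sqrt (r1 - a)) < ?f a"
      using ar a sqrt_dom[of r] sqrt_dom[of r1] a_pos by (intro leafV_strict_mono) auto
    then show ?thesis using a by simp
  qed (use a in auto)
  moreover have "?f e = null_bound M r"
  proof (cases "r < 2 * M")
    case True
    interpret R: throat M 1 r using throat_plus[OF M] True r by simp
    show ?thesis using True R.leafV_0 by (simp add: e_def null_bound_def)
  qed (use leafV_horizon[OF M] in \<open>auto simp: e_def\<close>)
  moreover have "continuous_on {a..e} ?f"
    using continuous_leafV_throat[OF M, of r "{a..e}" 1] throat_plus[OF M] ar a_pos by (auto simp: e_def)
  moreover have "a \<le> e" using ar a by (simp add: e_def)
  ultimately obtain x where "a \<le> x" "x \<le> e" "?f x = K"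
    using IVT2'[of ?f e K a] K by auto
  then show ?thesis using ar by (auto simp: e_def intro!: exI[of _ x])
qed

lemma leafV_minus_onto:
  assumes M: "M > 0" and r: "0 < r" "r < 3 * M / 2" and K: "K \<ge> null_bound M r"
  shows "\<exists>a. r \<le> a \<and> a < 3 * M / 2 \<and> leafV M (- 1) a (sqrt (a - r)) = K"
proof -
  let ?f = "\<lambda>a. leafV M (- 1) a (sqrt (a - r))"
  obtain a where a: "throat M (- 1) a" "r \<le> a" "?f a \<ge> K"
    using leafV_unbounded[OF M, of r "- 1" K] r M by auto
  interpret throat M "- 1" a by fact
  interpret R: throat M "- 1" r using throat_minus[OF M] r by simp
  have a3: "a < 3 * M / 2" using side by simp
  have "?f r = null_bound M r" using R.leafV_0 r M by (simp add: null_bound_def)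
  moreover have "continuous_on {r..a} ?f"
    using continuous_leafV_throat[OF M, of r "{r..a}" "- 1"] throat_minus[OF M] a3 r by auto
  ultimately obtain x where "r \<le> x" "x \<le> a" "?f x = K"
    using IVT'[of ?f r K a] K a by auto
  then show ?thesis using a3 by (auto intro!: exI[of _ x])
qed

section \<open>The foliation\<close>

definition throat_leaf :: "real \<Rightarrow> real \<Rightarrow> real \<Rightarrow> (real \<times> real) set" where
  "throat_leaf M \<sigma> a = (\<lambda>w. (leafU M \<sigma> a w, leafV M \<sigma> a w)) ` throat_dom \<sigma> a"

lemma rho_rho [simp]: "rho (rho p) = p"
  by (cases p) (simp add: rho_def)

lemma T_axisymmetric_symmetrize: "T_axisymmetric (symmetrize S)"
  by (auto simp: T_axisymmetric_def symmetrize_def image_Un image_image)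

lemma swap_symmetrize: "prod.swap ` symmetrize S = symmetrize (prod.swap ` S)"
proof -
  have "prod.swap (rho p) = rho (prod.swap p)" for p by (cases p) (simp add: rho_def)
  then show ?thesis by (simp add: symmetrize_def image_Un image_image)
qed

lemma T_axisymmetric_swap: "T_axisymmetric S \<Longrightarrow> T_axisymmetric (prod.swap ` S)"
proof -
  have "rho (prod.swap p) = prod.swap (rho p)" for p by (cases p) (simp add: rho_def)
  then show "T_axisymmetric S \<Longrightarrow> T_axisymmetric (prod.swap ` S)"
    unfolding T_axisymmetric_def image_image by (simp add: image_image[symmetric])
qed

context throat
begin

lemma throat_leaf_symmetrize: "throat_leaf M \<sigma> a =
  symmetrize ((\<lambda>r. (leafU M \<sigma> a (sqrt (\<sigma> * (r - a))), leafV M \<sigma> a (sqrt (\<sigma> * (r - a))))) ` {r. r > 0 \<and> \<sigma> * (r - a) \<ge> 0})"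
  by (simp only: symmetrize_half throat_leaf_def)

lemma throat_leaf_radius:
  assumes "(U, V) \<in> throat_leaf M \<sigma> a"
  shows "\<sigma> * (area_radius M U V - a) \<ge> 0" "(U, V) \<in> kruskal M"
  using assms leaf_area_radius leaf_kruskal rad_side by (auto simp: throat_leaf_def kruskal_def)

text \<open>\<open>U + V \<ge> 0\<close> selects \<open>w \<ge> 0\<close>, where the radius
  determines \<open>w\<close>; once \<open>V\<close> agrees, the product determines
  \<open>U\<close>. Membership thus becomes a single equation for the throat.\<close>

lemma throat_leaf_iff:
  assumes a: "a < 2 * M" and p: "(U, V) \<in> kruskal M" "U < V" "U + V \<ge> 0"
  defines "r \<equiv> area_radius M U V"
  shows "(U, V) \<in> throat_leaf M \<sigma> a \<longleftrightarrow> \<sigma> * (r - a) \<ge> 0 \<and> V = leafV M \<sigma> a (sqrt (\<sigma> * (r - a)))"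
proof
  assume "(U, V) \<in> throat_leaf M \<sigma> a"
  then obtain w where w: "w \<in> throat_dom \<sigma> a" "U = leafU M \<sigma> a w" "V = leafV M \<sigma> a w"
    by (auto simp: throat_leaf_def)
  have r: "r = thr_rad \<sigma> a w" using leaf_area_radius[OF w(1)] by (simp add: r_def w)
  have "w \<ge> 0"
  proof (rule ccontr)
    assume "\<not> w \<ge> 0"
    then show False
      using sum_pos[of "- w"] dom_minus[of w] w p(3) leafU_minus[of w] leafV_minus[of w] by simp
  qed
  then show "\<sigma> * (r - a) \<ge> 0 \<and> V = leafV M \<sigma> a (sqrt (\<sigma> * (r - a)))"
    using rad_side[of w] by (simp add: r w)
next
  assume R: "\<sigma> * (r - a) \<ge> 0 \<and> V = leafV M \<sigma> a (sqrt (\<sigma> * (r - a)))"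
  have UV: "U * V > - 2 * M" using p by (simp add: kruskal_def)
  have r: "r > 0" "(r - 2 * M) * exp (r / (2 * M)) = U * V"
    using area_radius[OF M_pos UV] by (simp_all add: r_def)
  have "V > 0" using p by linarith
  then have "U = leafU M \<sigma> a (sqrt (\<sigma> * (r - a)))"
    using leafU_eq[OF a r(1)] R r(2) by (simp add: field_simps)
  then show "(U, V) \<in> throat_leaf M \<sigma> a"
    using R sqrt_dom[OF r(1)] by (auto simp: throat_leaf_def)
qed

text \<open>Inside the horizon \<open>U < 0 < V\<close>; from the horizon outwards
  \<open>leafV_plus_gt\<close> gives \<open>V\<^sup>2 > U * V\<close>. The half \<open>w < 0\<close>
  follows by reflection.\<close>

lemma throat_leaf_less:
  assumes a: "a < 2 * M" and p: "(U, V) \<in> throat_leaf M \<sigma> a"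
  shows "U < V"
proof -
  have *: "leafU M \<sigma> a w < leafV M \<sigma> a w" if w: "w \<in> throat_dom \<sigma> a" "w \<ge> 0" for w
  proof -
    define r where "r = thr_rad \<sigma> a w"
    have V: "leafV M \<sigma> a w > 0" using leafV_pos[OF w a] .
    have UV: "leafU M \<sigma> a w * leafV M \<sigma> a w = (r - 2 * M) * exp (r / (2 * M))"
      using leaf_product[OF w(1)] by (simp add: r_def)
    show ?thesis
    proof (cases "r < 2 * M")
      case True
      then have "leafU M \<sigma> a w * leafV M \<sigma> a w < 0" unfolding UV by (simp add: mult_neg_pos)
      then have "leafU M \<sigma> a w < 0" using V by (simp add: mult_less_0_iff)
      then show ?thesis using V by simp
    next
      case False
      have s1: "\<sigma> = 1"
      proof (rule ccontr)
        assume "\<sigma> \<noteq> 1"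
        then have "r = a - w\<^sup>2" using sigma by (auto simp: r_def thr_rad_def)
        moreover have "w\<^sup>2 \<ge> 0" by simp
        ultimately show False using False a by linarith
      qed
      have "r - a = w\<^sup>2" by (simp add: r_def thr_rad_def s1)
      then have "null_bound M r < leafV M \<sigma> a w"
        using leafV_plus_gt[OF M_pos _ a, of r] side s1 False w(2) by simp
      moreover have "null_bound M r \<ge> 0" by (simp add: null_bound_def)
      ultimately have "(null_bound M r)\<^sup>2 < (leafV M \<sigma> a w)\<^sup>2" by (simp add: power_strict_mono)
      then have "leafU M \<sigma> a w * leafV M \<sigma> a w < leafV M \<sigma> a w * leafV M \<sigma> a w"
        using abs_ge_self[of "(r - 2 * M) * exp (r / (2 * M))"]
        unfolding UV null_bound_square[OF M_pos] power2_eq_square[of "leafV M \<sigma> a w"] by linarith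
      then show ?thesis using V by simp
    qed
  qed
  obtain w where w: "w \<in> throat_dom \<sigma> a" "U = leafU M \<sigma> a w" "V = leafV M \<sigma> a w"
    using p by (auto simp: throat_leaf_def)
  show ?thesis
  proof (cases "w \<ge> 0")
    case False
    then show ?thesis using *[of "- w"] w dom_minus[of w] leafU_minus[of w] leafV_minus[of w] by simp
  qed (use * w in simp)
qed

lemma throat_leaf_maximal:
  "spacelike_maximal_hypersurface M (throat_leaf M \<sigma> a)"
  "spacelike_maximal_hypersurface M (prod.swap ` throat_leaf M \<sigma> a)"
  using maximal_leaf by (simp_all add: throat_leaf_def)

end

section \<open>Identification of the given hypersurfaces\<close>

context
  fixes M :: real
  assumes M: "M > 0"
begin

lemma Sigma_plus_eq:
  assumes a: "3 * M / 2 < a" "a < 2 * M"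
  shows "Sigma_plus M (- throat_energy M a) = throat_leaf M 1 a"
proof -
  interpret throat M 1 a using throat_plus[OF M] a by simp
  have ne: "throat_energy M a \<noteq> 0" using energy_pos[OF a(2)] by simp
  have "Sigma_plus M (- throat_energy M a) = symmetrize
     ((\<lambda>r. ((r - 2 * M) * exp (r / (2 * M)) / V_plus M (- throat_energy M a) r, V_plus M (- throat_energy M a) r)) ` {a..})"
    using ne r_plus_eq[OF M a] by (simp add: Sigma_plus_def)
  also have "(\<lambda>r. ((r - 2 * M) * exp (r / (2 * M)) / V_plus M (- throat_energy M a) r, V_plus M (- throat_energy M a) r)) ` {a..} =
     (\<lambda>r. (leafU M 1 a (sqrt (1 * (r - a))), leafV M 1 a (sqrt (1 * (r - a))))) ` {r. r > 0 \<and> 1 * (r - a) \<ge> 0}"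
  proof (rule image_cong)
    show "{a..} = {r. r > 0 \<and> 1 * (r - a) \<ge> 0}" using a_pos by auto
    show "((r - 2 * M) * exp (r / (2 * M)) / V_plus M (- throat_energy M a) r, V_plus M (- throat_energy M a) r)
     = (leafU M 1 a (sqrt (1 * (r - a))), leafV M 1 a (sqrt (1 * (r - a))))" if "r \<in> {r. r > 0 \<and> 1 * (r - a) \<ge> 0}" for r
      using leafU_eq[OF a(2), of r] V_plus_eq[OF M a, of r] that by simp
  qed
  finally show ?thesis unfolding throat_leaf_symmetrize .
qed

lemma Sigma_minus_eq:
  assumes a: "0 < a" "a < 3 * M / 2"
  shows "Sigma_minus M (- throat_energy M a) = throat_leaf M (- 1) a"
proof -
  interpret throat M "- 1" a using throat_minus[OF M] a by simp
  have a2: "a < 2 * M" using a M by simp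
  have ne: "- throat_energy M a \<noteq> c0 M" using throat_energy_less[OF M, of a] a by (simp add: c0_eq[OF M])
  have "Sigma_minus M (- throat_energy M a) = symmetrize ((\<lambda>r. (- exp (- (1 / (4 * M)) * (t_minus M (- throat_energy M a) r - r - 2 * M * ln \<bar>r - 2 * M\<bar>)),
      exp ((1 / (4 * M)) * (t_minus M (- throat_energy M a) r + r + 2 * M * ln \<bar>r - 2 * M\<bar>)))) ` {0<..a})"
    using ne r_minus_eq[OF M a] by (simp add: Sigma_minus_def)
  also have "(\<lambda>r. (- exp (- (1 / (4 * M)) * (t_minus M (- throat_energy M a) r - r - 2 * M * ln \<bar>r - 2 * M\<bar>)),
      exp ((1 / (4 * M)) * (t_minus M (- throat_energy M a) r + r + 2 * M * ln \<bar>r - 2 * M\<bar>)))) ` {0<..a} =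
     (\<lambda>r. (leafU M (- 1) a (sqrt (- 1 * (r - a))), leafV M (- 1) a (sqrt (- 1 * (r - a))))) ` {r. r > 0 \<and> - 1 * (r - a) \<ge> 0}"
  proof (rule image_cong)
    show "{0<..a} = {r. r > 0 \<and> - 1 * (r - a) \<ge> 0}" by auto
    show "(- exp (- (1 / (4 * M)) * (t_minus M (- throat_energy M a) r - r - 2 * M * ln \<bar>r - 2 * M\<bar>)),
      exp ((1 / (4 * M)) * (t_minus M (- throat_energy M a) r + r + 2 * M * ln \<bar>r - 2 * M\<bar>)))
     = (leafU M (- 1) a (sqrt (- 1 * (r - a))), leafV M (- 1) a (sqrt (- 1 * (r - a))))" if "r \<in> {r. r > 0 \<and> - 1 * (r - a) \<ge> 0}" for r
  proof -
    define v where "v = leafV M (- 1) a (sqrt (a - r))"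
    have r: "0 < r" "r \<le> a" "r < 2 * M" using that a2 by auto
    have v: "v > 0" using leafV_pos[OF sqrt_dom[of r] _ a2] r by (simp add: v_def)
    have ab: "\<bar>r - 2 * M\<bar> = 2 * M - r" using r by simp
    have t: "t_minus M (- throat_energy M a) r = 4 * M * ln v - r - 2 * M * ln (2 * M - r)"
      using t_minus_eq[OF M a r(1,2)] by (simp add: v_def)
    have 1: "1 / (4 * M) * (t_minus M (- throat_energy M a) r + r + 2 * M * ln \<bar>r - 2 * M\<bar>) = ln v"
      unfolding t ab using M by simp
    have 2: "- (1 / (4 * M)) * (t_minus M (- throat_energy M a) r - r - 2 * M * ln \<bar>r - 2 * M\<bar>)
        = r / (2 * M) + ln (2 * M - r) - ln v"
      unfolding t ab using M by (simp add: field_simps)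
    have "leafU M (- 1) a (sqrt (a - r)) = - exp (r / (2 * M) + ln (2 * M - r) - ln v)"
    proof -
      have "exp (r / (2 * M) + ln (2 * M - r) - ln v) = exp (r / (2 * M)) * (2 * M - r) / v"
        using r v by (simp add: exp_diff exp_add)
      moreover have "leafU M (- 1) a (sqrt (a - r)) = (r - 2 * M) * exp (r / (2 * M)) / v"
        using leafU_eq[OF a2, of r] r by (simp add: v_def)
      ultimately show ?thesis by (simp add: algebra_simps minus_divide_left)
    qed
    then show ?thesis unfolding 1 2 using v by (simp add: v_def)
  qed
  qed
  finally show ?thesis unfolding throat_leaf_symmetrize .
qed

lemma Sigma_plus_0: "Sigma_plus M 0 = {(U, V). U = V}"
proof -
  let ?S = "(\<lambda>r. (sqrt (r - 2 * M) * exp (r / (4 * M)), sqrt (r - 2 * M) * exp (r / (4 * M)))) ` {2 * M..}"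
  have half: "(s, s) \<in> ?S" if "s \<ge> 0" for s
  proof -
    define r where "r = area_radius M s s"
    have "s * s > - 2 * M" using M zero_le_square[of s] by linarith
    from area_radius[OF M this]
    have r: "r > 0" "(r - 2 * M) * exp (r / (2 * M)) = s * s" by (simp_all add: r_def)
    have "(r - 2 * M) * exp (r / (2 * M)) \<ge> 0" unfolding r by simp
    then have r2: "r \<ge> 2 * M" by (simp add: zero_le_mult_iff)
    have "(sqrt (r - 2 * M) * exp (r / (4 * M)))\<^sup>2 = (r - 2 * M) * exp (r / (2 * M))"
      using r2 by (simp add: power_mult_distrib flip: exp_double)
    then have "(sqrt (r - 2 * M) * exp (r / (4 * M)))\<^sup>2 = s\<^sup>2" by (simp add: r power2_eq_square)
    then have "sqrt (r - 2 * M) * exp (r / (4 * M)) = s" using that r2 by (simp add: power2_eq_iff_nonneg)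
    then show ?thesis using r2 by (auto intro!: image_eqI[of _ _ r])
  qed
  have "(s, s) \<in> symmetrize ?S" for s
  proof (cases "s \<ge> 0")
    case False
    have "(s, s) \<in> rho ` ?S"
      by (rule image_eqI[of _ rho "(- s, - s)"], simp add: rho_def, rule half) (use False in simp)
    then show ?thesis unfolding symmetrize_def by (rule UnI2)
  qed (use half in \<open>auto simp: symmetrize_def\<close>)
  moreover have "symmetrize ?S \<subseteq> {(U, V). U = V}" by (auto simp: symmetrize_def rho_def)
  ultimately show ?thesis by (auto simp: Sigma_plus_def)
qed

definition cylinder :: "(real \<times> real) set" where
  "cylinder = {(U, V) \<in> kruskal M. U < 0 \<and> V > 0 \<and> area_radius M U V = 3 * M / 2}"

lemma Sigma_minus_c0: "Sigma_minus M (c0 M) = cylinder"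
  by (simp add: Sigma_minus_def r0_eq[OF M] cylinder_def)

text \<open>Radius \<open>3 * M / 2\<close> means \<open>U * V = - k\<^sup>2\<close>, and the signs
  of \<open>U\<close> and \<open>V\<close> select one branch of this hyperbola.\<close>

lemma cylinder_curve:
  defines "k \<equiv> sqrt (M / 2 * exp (3 / 4))"
  shows "cylinder = (\<lambda>s. (- k * exp (- s), k * exp s)) ` UNIV"
proof -
  have k: "k > 0" "k\<^sup>2 = M / 2 * exp (3 / 4)" using M by (simp_all add: k_def)
  have e: "(3 * M / 2 - 2 * M) * exp (3 * M / 2 / (2 * M)) = - k\<^sup>2" using M by (simp add: k(2))
  have b: "- k\<^sup>2 > - 2 * M"
    using area_fun_strict_mono[OF M, of 0 "3 * M / 2"] M unfolding e by simp
  show ?thesis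
  proof (intro equalityI subsetI)
    fix p assume "p \<in> cylinder"
    then obtain U V where p: "p = (U, V)" "U * V > - 2 * M" "U < 0" "V > 0" "area_radius M U V = 3 * M / 2"
      by (auto simp: cylinder_def kruskal_def)
    have UV: "U * V = - k\<^sup>2" using area_radius(2)[OF M p(2)] unfolding p(5) e by simp
    define s where "s = ln (V / k)"
    have "k * exp s = V" using k p by (simp add: s_def)
    moreover have "- k * exp (- s) = U" using k p UV by (simp add: s_def exp_minus field_simps power2_eq_square)
    ultimately show "p \<in> (\<lambda>s. (- k * exp (- s), k * exp s)) ` UNIV" using p by (auto intro!: image_eqI[of _ _ s])
  next
    fix p assume "p \<in> (\<lambda>s. (- k * exp (- s), k * exp s)) ` UNIV"
    then obtain s where p: "p = (- k * exp (- s), k * exp s)" by auto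
    have UV: "- k * exp (- s) * (k * exp s) = - k\<^sup>2"
      by (simp add: power2_eq_square mult.assoc mult.left_commute flip: exp_add)
    have "area_radius M (- k * exp (- s)) (k * exp s) = 3 * M / 2"
      by (rule area_radius_eqI[OF M]) (use M UV e in simp_all)
    then show "p \<in> cylinder" using k b UV by (simp add: p cylinder_def kruskal_def)
  qed
qed

text \<open>The parameter of the hyperbola is its rapidity and the speed is the constant
  \<open>k\<close>, so the rapidity equation reduces to a numerical identity at radius
  \<open>3 * M / 2\<close>.\<close>

lemma cylinder_maximal:
  "spacelike_maximal_hypersurface M cylinder" "spacelike_maximal_hypersurface M (prod.swap ` cylinder)"
proof -
  define k where "k = sqrt (M / 2 * exp (3 / 4))"
  have k: "k > 0" "k\<^sup>2 = M / 2 * exp (3 / 4)" using M by (simp_all add: k_def)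
  have d: "((\<lambda>s. - k * exp (- s)) has_real_derivative k * exp (- s)) (at s)"
    "((\<lambda>s. k * exp s) has_real_derivative k * exp s) (at s)" for s
    by (auto intro!: derivative_eq_intros)
  have eq: "2 * 1 = k * (6 * M - 3 * M / 2) / (3 * M / 2)\<^sup>2 * exp (- (3 * M / 2) / (2 * M)) *
      (k * exp s * exp (- s) - - k * exp (- s) * exp s)" for s
  proof -
    have "k * exp s * exp (- s) - - k * exp (- s) * exp s = 2 * k * (exp s * exp (- s))" by simp
    also have "\<dots> = 2 * k" by (simp flip: exp_add)
    finally have 1: "k * exp s * exp (- s) - - k * exp (- s) * exp s = 2 * k" .
    have "- (3 * M / 2) / (2 * M) = - (3 / 4)" using M by simp
    moreover have "k * (6 * M - 3 * M / 2) / (3 * M / 2)\<^sup>2 * exp (- (3 / 4)) * (2 * k) =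
        2 * (6 * M - 3 * M / 2) / (3 * M / 2)\<^sup>2 * (M / 2) * (exp (3 / 4) * exp (- (3 / 4)))"
      using k(2) by (simp add: power2_eq_square field_simps)
    moreover have "exp (3 / 4) * exp (- (3 / 4)) = (1 :: real)" by (simp flip: exp_add)
    ultimately show ?thesis unfolding 1 using M by (simp add: power2_eq_square field_simps)
  qed
  have prod: "(3 * M / 2 - 2 * M) * exp (3 * M / 2 / (2 * M)) = - k * exp (- s) * (k * exp s)" for s
  proof -
    have "- k * exp (- s) * (k * exp s) = - (k\<^sup>2 * (exp (- s) * exp s))" by (simp add: power2_eq_square)
    also have "exp (- s) * exp s = 1" by (simp flip: exp_add)
    finally show ?thesis using M by (simp add: k(2))
  qed
  have r: "0 < 3 * M / 2" using M by simp
  have sm: "smooth_on_open UNIV (\<lambda>s. - k * exp (- s))" "smooth_on_open UNIV (\<lambda>s. k * exp s)"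
    by (intro smooth_intros open_UNIV)+
  note * = M open_UNIV connected_UNIV UNIV_not_empty sm d k(1) DERIV_const DERIV_ident r prod eq
  show "spacelike_maximal_hypersurface M cylinder"
    unfolding cylinder_curve k_def[symmetric]
    by (rule maximal_curveI[where P="\<lambda>_. k" and P'="\<lambda>_. 0" and K="\<lambda>s. s" and K'="\<lambda>_. 1" and r="\<lambda>_. 3 * M / 2", OF *])
  show "spacelike_maximal_hypersurface M (prod.swap ` cylinder)"
    unfolding cylinder_curve k_def[symmetric]
    by (rule maximal_curveI_swap[where P="\<lambda>_. k" and P'="\<lambda>_. 0" and K="\<lambda>s. s" and K'="\<lambda>_. 1" and r="\<lambda>_. 3 * M / 2", OF *])
qed

lemma diagonal_maximal: "spacelike_maximal_hypersurface M {(U, V). U = V}"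
proof -
  have b: "s * s > - 2 * M" for s using M zero_le_square[of s] by linarith
  have "spacelike_maximal_hypersurface M ((\<lambda>s. (s, s)) ` UNIV)"
    by (rule maximal_curveI[where P="\<lambda>_. 1" and P'="\<lambda>_. 0" and K="\<lambda>_. 0" and K'="\<lambda>_. 0" and r="\<lambda>s. area_radius M s s"])
       (use M area_radius[OF M b] in \<open>auto intro: smooth_ident\<close>)
  moreover have "(\<lambda>s. (s, s)) ` UNIV = {(U, V). U = (V :: real)}" by auto
  ultimately show ?thesis by simp
qed

lemma T_axisymmetric_cylinder: "T_axisymmetric cylinder"
proof -
  have "rho p \<in> cylinder" if "p \<in> cylinder" for p
  proof -
    have "area_radius M (- V) (- U) = area_radius M U V" for U V
      by (simp add: area_radius_def mult.commute)
    then show ?thesis using that by (auto simp: cylinder_def kruskal_def rho_def mult.commute)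
  qed
  then have "rho ` cylinder \<subseteq> cylinder" by blast
  moreover have "cylinder \<subseteq> rho ` cylinder"
    using image_mono[OF calculation, of rho] by (simp add: image_image)
  ultimately show ?thesis unfolding T_axisymmetric_def by (rule subset_antisym)
qed

section \<open>The unique leaf through a point with \<open>U < V\<close>\<close>

definition upper_indices :: "leaf_index set" where
  "upper_indices = Plus ` {c0 M<..<0} \<union> Minus ` {c0 M..<0}"

lemma upper_index_cases:
  assumes "i \<in> upper_indices"
  obtains "i = Minus (c0 M)" "leaf M i = cylinder"
  | a where "0 < a" "a < 3 * M / 2" "i = Minus (- throat_energy M a)" "leaf M i = throat_leaf M (- 1) a"
  | a where "3 * M / 2 < a" "a < 2 * M" "i = Plus (- throat_energy M a)" "leaf M i = throat_leaf M 1 a"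
proof -
  consider c where "i = Plus c" "c0 M < c" "c < 0" | c where "i = Minus c" "c0 M < c" "c < 0" | "i = Minus (c0 M)"
    using assms by (force simp: upper_indices_def)
  then show thesis
  proof cases
    case (1 c)
    obtain a where "3 * M / 2 < a" "a < 2 * M" "throat_energy M a = - c"
      using throat_energy_onto_plus[OF M, of "- c"] 1 by (auto simp: c0_eq[OF M])
    then show ?thesis using that(3)[of a] Sigma_plus_eq[of a] 1 by simp
  next
    case (2 c)
    obtain a where "0 < a" "a < 3 * M / 2" "throat_energy M a = - c"
      using throat_energy_onto_minus[OF M, of "- c"] 2 by (auto simp: c0_eq[OF M])
    then show ?thesis using that(2)[of a] Sigma_minus_eq[of a] 2 by simp
  next
    case 3
    then show ?thesis using that(1) Sigma_minus_c0 by simp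
  qed
qed

lemma upper_leaf:
  assumes "i \<in> upper_indices"
  shows "T_axisymmetric (leaf M i)" "spacelike_maximal_hypersurface M (leaf M i)"
    "spacelike_maximal_hypersurface M (prod.swap ` leaf M i)"
    "(U, V) \<in> leaf M i \<Longrightarrow> (U, V) \<in> kruskal M \<and> U < V"
proof -
  have "T_axisymmetric (leaf M i) \<and> spacelike_maximal_hypersurface M (leaf M i) \<and>
    spacelike_maximal_hypersurface M (prod.swap ` leaf M i) \<and>
    ((U, V) \<in> leaf M i \<longrightarrow> (U, V) \<in> kruskal M \<and> U < V)"
    using assms
  proof (cases rule: upper_index_cases)
    case 1
    then show ?thesis using cylinder_maximal T_axisymmetric_cylinder by (auto simp: cylinder_def)
  next
    case (2 a)
    interpret throat M "- 1" a using throat_minus[OF M] 2 by simp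
    show ?thesis
      using throat_leaf_maximal throat_leaf_less[of U V] throat_leaf_radius[of U V] 2 M
        T_axisymmetric_symmetrize throat_leaf_symmetrize by auto
  next
    case (3 a)
    interpret throat M 1 a using throat_plus[OF M] 3 by simp
    show ?thesis
      using throat_leaf_maximal throat_leaf_less[of U V] throat_leaf_radius[of U V] 3
        T_axisymmetric_symmetrize throat_leaf_symmetrize by auto
  qed
  then show "T_axisymmetric (leaf M i)" "spacelike_maximal_hypersurface M (leaf M i)"
    "spacelike_maximal_hypersurface M (prod.swap ` leaf M i)"
    "(U, V) \<in> leaf M i \<Longrightarrow> (U, V) \<in> kruskal M \<and> U < V" by auto
qed

lemma throat_index_minus:
  assumes a: "0 < a" "a < 3 * M / 2"
  shows "Minus (- throat_energy M a) \<in> upper_indices"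
proof -
  have "throat_energy M a < throat_energy M (3 * M / 2)" using throat_energy_less[OF M, of a] a by simp
  moreover have "throat_energy M a > 0" using throat.energy_pos[OF throat_minus[OF M a]] a M by simp
  ultimately show ?thesis by (auto simp: upper_indices_def c0_eq[OF M])
qed

lemma throat_index_plus:
  assumes a: "3 * M / 2 < a" "a < 2 * M"
  shows "Plus (- throat_energy M a) \<in> upper_indices"
proof -
  have "throat_energy M a < throat_energy M (3 * M / 2)" using throat_energy_less[OF M, of a] a M by simp
  moreover have "throat_energy M a > 0" using throat.energy_pos[OF throat_plus[OF M]] a by simp
  ultimately show ?thesis by (auto simp: upper_indices_def c0_eq[OF M])
qed

lemma c0_index: "Minus (c0 M) \<in> upper_indices"
  using M by (simp add: upper_indices_def c0_eq[OF M] throat_energy_def)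

text \<open>Every leaf stays on its side of the radius \<open>3 * M / 2\<close>, so the radius of
  the point decides between the cylinder and the two kinds of throat leaves. Within a kind, the
  range of \<open>V\<close> over the throats gives existence and its strict monotonicity
  uniqueness.\<close>

lemma upper_half_unique:
  assumes p: "(U, V) \<in> kruskal M" "U < V" "U + V \<ge> 0"
  shows "\<exists>!i. i \<in> upper_indices \<and> (U, V) \<in> leaf M i"
proof -
  define r where "r = area_radius M U V"
  have UV: "U * V > - 2 * M" using p by (simp add: kruskal_def)
  have r: "r > 0" "(r - 2 * M) * exp (r / (2 * M)) = U * V"
    using area_radius[OF M UV] by (simp_all add: r_def)
  have V: "V > 0" using p by linarith
  have bound: "null_bound M r \<le> V"
  proof -
    have "\<bar>U * V\<bar> \<le> V * V"
      using p V by (simp add: abs_mult abs_le_iff)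
    then have "(null_bound M r)\<^sup>2 \<le> V\<^sup>2" unfolding null_bound_square[OF M] r by (simp add: power2_eq_square)
    then show ?thesis by (rule power2_le_imp_le) (use V in simp)
  qed
  note iff_minus = throat.throat_leaf_iff[OF throat_minus[OF M] _ p, folded r_def, simplified]
  note iff_plus = throat.throat_leaf_iff[OF throat_plus[OF M] _ p, folded r_def, simplified]
  have radius: "i = Minus (c0 M) \<and> r = 3 * M / 2 \<or>
      (\<exists>a. 0 < a \<and> a < 3 * M / 2 \<and> i = Minus (- throat_energy M a) \<and> r \<le> a \<and> V = leafV M (- 1) a (sqrt (a - r))) \<or>
      (\<exists>a. 3 * M / 2 < a \<and> a < 2 * M \<and> i = Plus (- throat_energy M a) \<and> a \<le> r \<and> V = leafV M 1 a (sqrt (r - a)))"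
    if "i \<in> upper_indices" "(U, V) \<in> leaf M i" for i
    using that(1)
  proof (cases rule: upper_index_cases)
    case 1
    then show ?thesis using that(2) by (simp add: cylinder_def r_def)
  next
    case (2 a)
    then show ?thesis using that(2) iff_minus[of a] M by auto
  next
    case (3 a)
    then show ?thesis using that(2) iff_plus[of a] by auto
  qed
  consider "r = 3 * M / 2" | "r < 3 * M / 2" | "r > 3 * M / 2" by linarith
  then show ?thesis
  proof cases
    case 1
    have "U * V < 0" using 1 r M by (simp flip: r(2) add: mult_neg_pos)
    then have "U < 0" using V by (simp add: mult_less_0_iff)
    then have "(U, V) \<in> leaf M (Minus (c0 M))"
      using p V 1 by (simp add: Sigma_minus_c0 cylinder_def r_def)
    then show ?thesis using c0_index radius 1 by (intro ex1I[of _ "Minus (c0 M)"]) force+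
  next
    case 2
    obtain a where a: "r \<le> a" "a < 3 * M / 2" "leafV M (- 1) a (sqrt (a - r)) = V"
      using leafV_minus_onto[OF M r(1) 2 bound] by auto
    have a0: "0 < a" using a r by simp
    show ?thesis
    proof (rule ex1I[of _ "Minus (- throat_energy M a)"])
      show "Minus (- throat_energy M a) \<in> upper_indices \<and> (U, V) \<in> leaf M (Minus (- throat_energy M a))"
        using throat_index_minus[OF a0 a(2)] Sigma_minus_eq[OF a0 a(2)] iff_minus[of a] a a0 M by simp
      fix i assume "i \<in> upper_indices \<and> (U, V) \<in> leaf M i"
      then obtain b where b: "b < 3 * M / 2" "i = Minus (- throat_energy M b)" "r \<le> b" "V = leafV M (- 1) b (sqrt (b - r))"
        using radius[of i] 2 by auto
      have "b = a"
        using leafV_minus_less[OF M, of a b r] leafV_minus_less[OF M, of b a r] a b r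
        by (cases a b rule: linorder_cases) auto
      then show "i = Minus (- throat_energy M a)" using b by simp
    qed
  next
    case 3
    obtain a where a: "3 * M / 2 < a" "a \<le> 2 * M" "a \<le> r" "leafV M 1 a (sqrt (r - a)) = V"
      using leafV_plus_onto[OF M 3 bound] by auto
    \<comment> \<open>The throat \<open>2 * M\<close> would put the point on the diagonal, against
      \<open>U < V\<close>.\<close>
    have a2: "a < 2 * M"
    proof (rule ccontr)
      assume "\<not> a < 2 * M"
      then have a2: "a = 2 * M" "2 * M \<le> r" using a by auto
      then have "V = null_bound M r" using a leafV_horizon[OF M] by simp
      moreover have "(r - 2 * M) * exp (r / (2 * M)) \<ge> 0" using a2 by simp
      ultimately have "V\<^sup>2 = U * V" using null_bound_square[OF M, of r] unfolding r(2) by simp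
      then show False using V p by (simp add: power2_eq_square)
    qed
    show ?thesis
    proof (rule ex1I[of _ "Plus (- throat_energy M a)"])
      show "Plus (- throat_energy M a) \<in> upper_indices \<and> (U, V) \<in> leaf M (Plus (- throat_energy M a))"
        using throat_index_plus[OF a(1) a2] Sigma_plus_eq[OF a(1) a2] iff_plus[of a] a a2 by simp
      fix i assume "i \<in> upper_indices \<and> (U, V) \<in> leaf M i"
      then obtain b where b: "3 * M / 2 < b" "b < 2 * M" "i = Plus (- throat_energy M b)" "b \<le> r" "V = leafV M 1 b (sqrt (r - b))"
        using radius[of i] 3 by auto
      have "b = a"
        using leafV_plus_less[OF M, of a b r] leafV_plus_less[OF M, of b a r] a a2 b
        by (cases a b rule: linorder_cases) auto
      then show "i = Plus (- throat_energy M a)" using b by simp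
    qed
  qed
qed

lemma upper_unique:
  assumes p: "(U, V) \<in> kruskal M" "U < V"
  shows "\<exists>!i. i \<in> upper_indices \<and> (U, V) \<in> leaf M i"
proof (cases "U + V \<ge> 0")
  case False
  have iff: "(- V, - U) \<in> leaf M i \<longleftrightarrow> (U, V) \<in> leaf M i" if "i \<in> upper_indices" for i
  proof -
    have "rho q \<in> leaf M i" if "q \<in> leaf M i" for q
      using upper_leaf(1)[OF \<open>i \<in> upper_indices\<close>] that unfolding T_axisymmetric_def by blast
    from this[of "(U, V)"] this[of "(- V, - U)"] show ?thesis by (auto simp: rho_def)
  qed
  have "\<exists>!i. i \<in> upper_indices \<and> (- V, - U) \<in> leaf M i"
    by (rule upper_half_unique) (use p False in \<open>auto simp: kruskal_def mult.commute\<close>)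
  then show ?thesis using iff by metis
qed (rule upper_half_unique[OF p])

section \<open>The reflection exchanging \<open>U\<close> and \<open>V\<close>\<close>

lemma Sigmat_plus_eq: "Sigmat_plus M c = prod.swap ` Sigma_minus M (- c)"
proof (cases "c = C0 M")
  case True
  then have c: "- c = c0 M" by (simp add: c0_eq[OF M] C0_eq[OF M])
  show ?thesis
    unfolding c Sigma_minus_def Sigmat_plus_def using True r0_eq[OF M] R0_eq[OF M]
    by (auto simp: kruskal_def mult.commute area_radius_def image_iff)
next
  case False
  then have c: "- c \<noteq> c0 M" by (simp add: c0_eq[OF M] C0_eq[OF M])
  have t: "tt_plus M c r = - t_minus M (- c) r" for r
  proof -
    have "x / (2 * M - x) * (c / sqrt (D M c x)) = - (x / (x - 2 * M) * (- (- c) / sqrt (D M (- c) x)))" for x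
    proof -
      have "x / (2 * M - x) = - (x / (x - 2 * M))" by (metis minus_diff_eq minus_divide_right)
      then show ?thesis by (simp add: D_def)
    qed
    then show ?thesis unfolding tt_plus_def t_minus_def rt_eq[OF M] by simp
  qed
  \<comment> \<open>Changing the sign of \<open>t\<close> exchanges the two exponents and thereby
    the roles of \<open>U\<close> and \<open>V\<close>.\<close>
  have "- k * (- t - r - l) = k * (t + r + l)" "k * (- t + r + l) = - k * (t - r - l)" for k t r l :: real
    by algebra+
  note e = this[of "1 / (4 * M)"]
  have s1: "Sigma_minus M (- c) = symmetrize ((\<lambda>r.
        (- exp (- (1 / (4 * M)) * (t_minus M (- c) r - r - 2 * M * ln \<bar>r - 2 * M\<bar>)),
         exp ((1 / (4 * M)) * (t_minus M (- c) r + r + 2 * M * ln \<bar>r - 2 * M\<bar>))))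
        ` {0<..r_minus M (- c)})" unfolding Sigma_minus_def using c by (simp only: if_False)
  have s2: "Sigmat_plus M c = symmetrize ((\<lambda>r.
        (exp (- (1 / (4 * M)) * (- t_minus M (- c) r - r - 2 * M * ln \<bar>r - 2 * M\<bar>)),
         - exp ((1 / (4 * M)) * (- t_minus M (- c) r + r + 2 * M * ln \<bar>r - 2 * M\<bar>))))
        ` {0<..r_minus M (- c)})" unfolding Sigmat_plus_def t rt_eq[OF M] using False by (simp only: if_False)
  show ?thesis unfolding s1 s2 e swap_symmetrize image_image swap_simp ..
qed

lemma Sigmat_minus_eq:
  assumes "c \<noteq> 0"
  shows "Sigmat_minus M c = prod.swap ` Sigma_plus M (- c)"
proof -
  have "Ut_minus M c r = V_plus M (- c) r" for r
    by (simp add: Ut_minus_def V_plus_def rt_eq[OF M] D_def)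
  then show ?thesis
    using assms by (simp add: Sigma_plus_def Sigmat_minus_def swap_symmetrize image_image rt_eq[OF M])
qed

text \<open>The exchange of \<open>U\<close> and \<open>V\<close> on indices. \<open>Plus 0\<close>
  has to be kept apart: the diagonal is its own mirror image, while \<open>Tilde_Minus 0\<close> is
  no leaf index.\<close>

fun mirror_index :: "leaf_index \<Rightarrow> leaf_index" where
  "mirror_index (Tilde_Plus c) = Minus (- c)"
| "mirror_index (Tilde_Minus c) = Plus (- c)"
| "mirror_index (Plus c) = Tilde_Minus (- c)"
| "mirror_index (Minus c) = Tilde_Plus (- c)"

lemma mirror_mirror: "mirror_index (mirror_index i) = i"
  by (cases i) auto

lemma leaf_indices_eq: "leaf_indices M = upper_indices \<union> {Plus 0} \<union> mirror_index ` upper_indices"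
proof -
  have C: "C0 M = - c0 M" "c0 M < 0" using M by (simp_all add: c0_eq[OF M] C0_eq[OF M] throat_energy_def)
  have all: "Tilde_Plus c \<in> leaf_indices M \<longleftrightarrow> 0 < c \<and> c \<le> - c0 M"
    "Tilde_Minus c \<in> leaf_indices M \<longleftrightarrow> 0 < c \<and> c < - c0 M"
    "Plus c \<in> leaf_indices M \<longleftrightarrow> c0 M < c \<and> c \<le> 0"
    "Minus c \<in> leaf_indices M \<longleftrightarrow> c0 M \<le> c \<and> c < 0" for c
    by (auto simp: leaf_indices_def C(1))
  have upper: "Tilde_Plus c \<in> upper_indices \<longleftrightarrow> False" "Tilde_Minus c \<in> upper_indices \<longleftrightarrow> False"
    "Plus c \<in> upper_indices \<longleftrightarrow> c0 M < c \<and> c < 0"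
    "Minus c \<in> upper_indices \<longleftrightarrow> c0 M \<le> c \<and> c < 0" for c
    by (auto simp: upper_indices_def)
  have iff: "i \<in> leaf_indices M \<longleftrightarrow> i \<in> upper_indices \<or> i = Plus 0 \<or> mirror_index i \<in> upper_indices" for i
  proof (cases i)
    case (Tilde_Plus c)
    show ?thesis using C(2)
      by (simp only: Tilde_Plus mirror_index.simps all upper leaf_index.distinct leaf_index.inject simp_thms) (safe; linarith)
  next
    case (Tilde_Minus c)
    show ?thesis using C(2)
      by (simp only: Tilde_Minus mirror_index.simps all upper leaf_index.distinct leaf_index.inject simp_thms) (safe; linarith)
  next
    case (Plus c)
    show ?thesis using C(2)
      by (simp only: Plus mirror_index.simps all upper leaf_index.distinct leaf_index.inject simp_thms) (safe; linarith)
  next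
    case (Minus c)
    show ?thesis using C(2)
      by (simp only: Minus mirror_index.simps all upper leaf_index.distinct simp_thms)
  qed
  have image: "i \<in> mirror_index ` upper_indices \<longleftrightarrow> mirror_index i \<in> upper_indices" for i
  proof
    assume "mirror_index i \<in> upper_indices"
    from imageI[OF this, of mirror_index] show "i \<in> mirror_index ` upper_indices" by (simp only: mirror_mirror)
  next
    assume "i \<in> mirror_index ` upper_indices"
    then show "mirror_index i \<in> upper_indices" by (elim imageE) (simp only: mirror_mirror)
  qed
  show ?thesis by (rule set_eqI) (simp only: iff image Un_iff singleton_iff disj_assoc)
qed

lemma leaf_mirror:
  assumes "i \<in> upper_indices"
  shows "leaf M (mirror_index i) = prod.swap ` leaf M i"
  using assms Sigmat_plus_eq[of "- _"] Sigmat_minus_eq[of "- _"] by (auto simp: upper_indices_def)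

end

theorem theorem3p17:
  fixes M :: real
  assumes "M > 0"
  shows "(\<forall>i\<in>leaf_indices M. T_axisymmetric (leaf M i) \<and> spacelike_maximal_hypersurface M (leaf M i))
    \<and> disjoint_family_on (leaf M) (leaf_indices M)
    \<and> (\<Union>i\<in>leaf_indices M. leaf M i) = kruskal M"
proof -
  let ?N = "upper_indices M"
  note eq = leaf_indices_eq[OF assms] and mirror = leaf_mirror[OF assms]
  have diag: "leaf M (Plus 0) = {(U, V). U = V}" by (simp add: Sigma_plus_0[OF assms])
  have good: "T_axisymmetric (leaf M i) \<and> spacelike_maximal_hypersurface M (leaf M i)" if i: "i \<in> leaf_indices M" for i
  proof -
    consider "i \<in> ?N" | "i = Plus 0" | j where "j \<in> ?N" "i = mirror_index j"
      using i by (auto simp: eq)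
    then show ?thesis
    proof cases
      case 1
      then show ?thesis using upper_leaf[OF assms] by simp
    next
      case 2
      have "T_axisymmetric (Sigma_plus M 0)" by (simp add: Sigma_plus_def T_axisymmetric_symmetrize)
      then show ?thesis using 2 diagonal_maximal[OF assms] Sigma_plus_0[OF assms] by simp
    next
      case (3 j)
      then show ?thesis using upper_leaf[OF assms 3(1)] mirror[OF 3(1)] T_axisymmetric_swap by simp
    qed
  qed
  \<comment> \<open>Disjointness and covering together say that exactly one leaf passes through each
    point. The sign of \<open>V - U\<close> tells whether to look among the upper leaves, at the
    diagonal or among the mirror images.\<close>
  have unique: "\<exists>!i. i \<in> leaf_indices M \<and> (U, V) \<in> leaf M i" if p: "(U, V) \<in> kruskal M" for U V
  proof -
    have q: "(V, U) \<in> kruskal M" using p by (simp add: kruskal_def mult.commute)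
    have swap: "(U, V) \<in> prod.swap ` S \<longleftrightarrow> (V, U) \<in> S" for S :: "(real \<times> real) set" and U V by force
    have char: "i \<in> ?N \<and> U < V \<or> i = Plus 0 \<and> U = V \<or>
        (\<exists>j. j \<in> ?N \<and> V < U \<and> (V, U) \<in> leaf M j \<and> i = mirror_index j)"
      if i: "i \<in> leaf_indices M" "(U, V) \<in> leaf M i" for i
    proof -
      consider "i \<in> ?N" | "i = Plus 0" | j where "j \<in> ?N" "i = mirror_index j"
        using i by (auto simp: eq)
      then show ?thesis
      proof cases
        case 1
        then show ?thesis using upper_leaf(4)[OF assms 1 i(2)] by simp
      next
        case 2
        then show ?thesis using i(2) diag by simp
      next
        case (3 j)
        then have "(V, U) \<in> leaf M j" using i(2) mirror[OF 3(1)] swap by simp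
        then show ?thesis using 3 upper_leaf(4)[OF assms 3(1)] by blast
      qed
    qed
    consider "U < V" | "U = V" | "V < U" by linarith
    then show ?thesis
    proof cases
      case 1
      obtain j where j: "j \<in> ?N" "(U, V) \<in> leaf M j" "\<And>i. i \<in> ?N \<Longrightarrow> (U, V) \<in> leaf M i \<Longrightarrow> i = j"
        using upper_unique[OF assms p 1] by blast
      show ?thesis
      proof (rule ex1I[of _ j])
        show "i = j" if "i \<in> leaf_indices M \<and> (U, V) \<in> leaf M i" for i
          using that char[of i] 1 j(3)[of i] by auto
      qed (use j(1,2) eq in blast)
    next
      case 2
      show ?thesis
      proof (rule ex1I[of _ "Plus 0"])
        show "i = Plus 0" if "i \<in> leaf_indices M \<and> (U, V) \<in> leaf M i" for i
          using that char[of i] 2 by auto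
      qed (use 2 diag eq in simp)
    next
      case 3
      obtain j where j: "j \<in> ?N" "(V, U) \<in> leaf M j" "\<And>i. i \<in> ?N \<Longrightarrow> (V, U) \<in> leaf M i \<Longrightarrow> i = j"
        using upper_unique[OF assms q 3] by blast
      show ?thesis
      proof (rule ex1I[of _ "mirror_index j"])
        show "mirror_index j \<in> leaf_indices M \<and> (U, V) \<in> leaf M (mirror_index j)"
          using j(1,2) mirror[OF j(1)] swap eq by simp
        show "i = mirror_index j" if "i \<in> leaf_indices M \<and> (U, V) \<in> leaf M i" for i
          using that char[of i] 3 j(3) by auto
      qed
    qed
  qed
  have sub: "leaf M i \<subseteq> kruskal M" if "i \<in> leaf_indices M" for i
    using good[OF that] by (simp add: spacelike_maximal_hypersurface_def)
  have "disjoint_family_on (leaf M) (leaf_indices M)"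
    unfolding disjoint_family_on_def
  proof (intro ballI impI equals0I)
    fix i j p assume "i \<in> leaf_indices M" "j \<in> leaf_indices M" "i \<noteq> j" "p \<in> leaf M i \<inter> leaf M j"
    then show False using unique[of "fst p" "snd p"] sub[of i] by auto
  qed
  moreover have "(\<Union>i\<in>leaf_indices M. leaf M i) = kruskal M"
    using sub unique by fast
  ultimately show ?thesis using good by blast
qed

end
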